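(* Consider the power-of-two-choices model with $N$ queues and true parameter $\theta^*=(\lambda^*,\nu^* )$, with empirical measure process $\varrho^N(t)=\varrho^N(t,\theta^* )$, its limit $\varrho(t)=\varrho(t,\theta^* )$, the numbers $a_{11},a_{12},a_{22}$, and the approximate least squares estimator $(\lambda^{N,m},\nu^{N,m})$ defined in the context. Suppose that $\varrho^N(0)\to\varrho_0$ in $\mathcal{S}$ as $N\to\infty$ and that $a_{11}a_{22}>(a_{12})^2$. Then $$\begin{pmatrix}\lambda^{N,m}\\ \nu^{N,m}\end{pmatrix}\longrightarrow\begin{pmatrix}\lambda^*\\ \nu^*\end{pmatrix}\quad\text{in probability as } N\to\infty \text{ and } m\to\infty .$$
   Context: Model. Fix $T>0$. There are $N$ parallel identical queues, each with a single server of service rate $\nu$ and an infinite buffer. Tasks arrive at rate $N\lambda$; each task is allocated $2$ queues with uniform probability among the $N$ (they may coincide) and joins the shortest one, ties being resolved uniformly. All these random events are independent. The parameter is $\theta=(\lambda,\nu)$; the observed system is governed by the true parameter $\theta^*=(\lambda^*,\nu^* )$. Let $X^N_i(t)$ be the length of queue $i$ at time $t$ and $$\varrho^N_j(t)=\frac1N\sum_{i=1}^N \mathbf 1_{\{X^N_i(t)=j\}},\qquad j\in\mathbb{Z}_+=\{0,1,2,\dots\},\ t\in[0,T].$$ This takes values in $\mathcal{S}=\{s\in\mathbb{R}_+^{\mathbb{Z}_+}:\sum_{j\ge0}s_j=1\}$, identified with the space of probability measures on $\mathbb{Z}_+$. Functions $U_j,V_j$. For $x\in\ell_1$ (summable real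 sequences indexed by $\mathbb{Z}_+$), with the convention $x_{-1}=0$, and for all $j\in\mathbb{Z}_+$, $$U_j(x)=2x_{j-1}\sum_{i=j}^\infty x_i-2x_j\sum_{i=j+1}^\infty x_i+x_{j-1}^2-x_j^2,\qquad V_j(x)=x_{j+1}-x_j .$$ Limit. $\varrho(\cdot)=\varrho(\cdot,\theta^* )$ is the unique solution in $\mathcal{C}([0,T],\mathcal{S})$ (continuous $\mathcal{S}$-valued functions) of $\dot\varrho_j(t)=\lambda^*U_j(\varrho(t))+\nu^*V_j(\varrho(t))$, $j\in\mathbb{Z}_+$, $\varrho(0)=\varrho_0$. Limiting quantities: $$a_{11}=\sum_{j=0}^\infty\Big[\int_0^TU_j(\varrho(s))ds\Big]^2,\quad a_{12}=a_{21}=\sum_{j=0}^\infty\int_0^TU_j(\varrho(s))ds\int_0^TV_j(\varrho(s))ds,\quad a_{22}=\sum_{j=0}^\infty\Big[\int_0^TV_j(\varrho(s))ds\Big]^2 .$$ Estimator. For $m\in\mathbb{N}$, $N\ge2$, let $t_k=kT/m$, $k=1,\dots,m$, and $$\bar U_j=\frac Tm\sum_{k=1}^mU_j(\varrho^N(t_k)),\qquad \bar V_j=\frac Tm\sum_{k=1}^mV_j(\varrho^N(t_k)),$$ $$a^{N,m}_{11}=\sum_{j\ge0}\bar U_j^2,\quad a^{N,m}_{12}=a^{N,m}_{21}=\sum_{j\ge0}\bar U_j\bar V_j,\quad a^{N,m}_{22}=\sum_{j\ge0}\bar V_j^2,$$ $$b^{N,m}_1=\sum_{j\ge0}[\varrho^N_j(T)-\varrho^N_j(0)]\bar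 U_j,\qquad b^{N,m}_2=\sum_{j\ge0}[\varrho^N_j(T)-\varrho^N_j(0)]\bar V_j .$$ The approximate least squares estimator is $$\begin{pmatrix}\lambda^{N,m}\\ \nu^{N,m}\end{pmatrix}=\frac{1}{a^{N,m}_{11}a^{N,m}_{22}-(a^{N,m}_{12})^2}\begin{pmatrix}a^{N,m}_{22}&-a^{N,m}_{12}\\-a^{N,m}_{21}&a^{N,m}_{11}\end{pmatrix}\begin{pmatrix}b^{N,m}_1\\ b^{N,m}_2\end{pmatrix}.$$
   Formalization: As printed, V_0(x)=x_1-x_0 loses mass, so for ν*>0 the limit equation has no solution in S; the formal theorem is stated both for the printed V and for the corrected V with V_0(x)=x_1 (used in the equation, the a's and the estimator), V_j unchanged for j≥1. *)

theory Defs
  imports "HOL-Probability.Probability"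
begin

section \<open>Markov jump processes\<close>

definition transition_function :: "'s set \<Rightarrow> (real \<Rightarrow> 's \<Rightarrow> 's pmf) \<Rightarrow> bool" where
  "transition_function S p \<longleftrightarrow>
     (\<forall>x\<in>S. p 0 x = return_pmf x) \<and>
     (\<forall>t\<ge>0. \<forall>x\<in>S. set_pmf (p t x) \<subseteq> S) \<and>
     (\<forall>s\<ge>0. \<forall>t\<ge>0. \<forall>x\<in>S. p (s + t) x = bind_pmf (p s x) (p t))"

text \<open>
  The right derivative of the transition function at time 0 is the conservative rate matrix with
  off-diagonal entries \<open>r x y\<close>; the diagonal values \<open>r x x\<close> are not used.
\<close>

definition has_jump_rates ::
    "'s set \<Rightarrow> (real \<Rightarrow> 's \<Rightarrow> 's pmf) \<Rightarrow> ('s \<Rightarrow> 's \<Rightarrow> real) \<Rightarrow> bool" where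
  "has_jump_rates S p r \<longleftrightarrow>
     (\<forall>x\<in>S. \<forall>y\<in>S.
        ((\<lambda>h. (pmf (p h x) y - of_bool (y = x)) / h) \<longlongrightarrow>
           (if y = x then - infsum (r x) (S - {x}) else r x y)) (at_right 0))"

text \<open>
  A right-continuous, time-homogeneous Markov process on the time interval \<open>[0, T]\<close> with discrete
  state space \<open>S\<close> and jump rates \<open>r\<close>. The initial law is arbitrary. Right-continuity with respect to
  the discrete topology means being constant on a right neighbourhood of each time point.
\<close>

definition markov_jump_process ::
    "'w measure \<Rightarrow> real \<Rightarrow> 's set \<Rightarrow> ('s \<Rightarrow> 's \<Rightarrow> real) \<Rightarrow> (real \<Rightarrow> 'w \<Rightarrow> 's) \<Rightarrow> bool" where
  "markov_jump_process M T S r X \<longleftrightarrow>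
     prob_space M \<and>
     (\<forall>t\<in>{0..T}. X t \<in> M \<rightarrow>\<^sub>M count_space UNIV) \<and>
     (\<forall>t\<in>{0..T}. \<forall>\<omega>\<in>space M. X t \<omega> \<in> S) \<and>
     (\<forall>\<omega>\<in>space M. \<forall>t\<in>{0..<T}. \<forall>\<^sub>F s in at_right t. X s \<omega> = X t \<omega>) \<and>
     (\<exists>p. transition_function S p \<and> has_jump_rates S p r \<and>
        (\<forall>n t x. 0 \<le> t 0 \<and> (\<forall>i\<le>n. t i < t (Suc i)) \<and> t (Suc n) \<le> T \<longrightarrow>
           measure M {\<omega>\<in>space M. \<forall>i\<le>Suc n. X (t i) \<omega> = x i} =
           measure M {\<omega>\<in>space M. \<forall>i\<le>n. X (t i) \<omega> = x i} *
             pmf (p (t (Suc n) - t n) (x n)) (x (Suc n))))"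


section \<open>The power-of-two-choices model\<close>

text \<open>
  The queues are indexed by \<open>{..<N}\<close>; a configuration \<open>x\<close> assigns to each queue its length and is
  padded by 0 outside of the index set, so that the state space is countable.
\<close>

definition queue_states :: "nat \<Rightarrow> (nat \<Rightarrow> nat) set" where
  "queue_states N = {x. \<forall>i\<ge>N. x i = 0}"

definition joined_queue_pmf :: "nat \<Rightarrow> (nat \<Rightarrow> nat) \<Rightarrow> nat pmf" where
  "joined_queue_pmf N x =
     bind_pmf (pmf_of_set ({..<N} \<times> {..<N}))
       (\<lambda>(a, b). pmf_of_set {i\<in>{a, b}. x i = min (x a) (x b)})"

definition two_choices_rate ::
    "nat \<Rightarrow> real \<Rightarrow> real \<Rightarrow> (nat \<Rightarrow> nat) \<Rightarrow> (nat \<Rightarrow> nat) \<Rightarrow> real" where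
  "two_choices_rate N lam nu x y =
     (\<Sum>i<N. (if y = x(i := x i + 1) then real N * lam * pmf (joined_queue_pmf N x) i else 0) +
             (if 0 < x i \<and> y = x(i := x i - 1) then nu else 0))"

definition two_choices_process ::
    "'w measure \<Rightarrow> real \<Rightarrow> nat \<Rightarrow> real \<Rightarrow> real \<Rightarrow> (real \<Rightarrow> 'w \<Rightarrow> nat \<Rightarrow> nat) \<Rightarrow> bool" where
  "two_choices_process M T N lam nu X \<longleftrightarrow>
     markov_jump_process M T (queue_states N) (two_choices_rate N lam nu) X"

definition empirical :: "nat \<Rightarrow> (nat \<Rightarrow> nat) \<Rightarrow> nat \<Rightarrow> real" where
  "empirical N x j = (\<Sum>i<N. of_bool (x i = j)) / real N"


section \<open>The mean-field limit\<close>

definition prob_seqs :: "(nat \<Rightarrow> real) set" where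
  "prob_seqs = {s. (\<forall>j. 0 \<le> s j) \<and> s sums 1}"

text \<open>
  On \<open>prob_seqs\<close> the \<open>\<ell>\<^sub>1\<close>-distance metrizes weak convergence of probability measures.
\<close>

definition l1_dist :: "(nat \<Rightarrow> real) \<Rightarrow> (nat \<Rightarrow> real) \<Rightarrow> real" where
  "l1_dist x y = (\<Sum>j. \<bar>x j - y j\<bar>)"

definition pred_term :: "(nat \<Rightarrow> real) \<Rightarrow> nat \<Rightarrow> real" where
  "pred_term x j = (if j = 0 then 0 else x (j - 1))"

definition U :: "(nat \<Rightarrow> real) \<Rightarrow> nat \<Rightarrow> real" where
  "U x j = 2 * pred_term x j * (\<Sum>i. x (j + i)) - 2 * x j * (\<Sum>i. x (j + 1 + i))
           + (pred_term x j)\<^sup>2 - (x j)\<^sup>2"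

text \<open>
  \<open>V False\<close> is the formula \<open>V\<^sub>j(x) = x\<^sub>j\<^sub>+\<^sub>1 - x\<^sub>j\<close> for all \<open>j\<close>, including \<open>j = 0\<close>. That formula counts
  departures from empty queues: it satisfies \<open>\<Sum>\<^sub>j V\<^sub>j(x) = - x\<^sub>0\<close>, so for \<open>nu > 0\<close> the differential
  equation below has no solution in \<open>prob_seqs\<close>. \<open>V True\<close> differs from it only in \<open>V\<^sub>0(x) = x\<^sub>1\<close>, which
  is the drift produced by the queues (empty queues are not served) and conserves mass. The flag is
  kept as a parameter so that results can be stated for both conventions.
\<close>

definition V :: "bool \<Rightarrow> (nat \<Rightarrow> real) \<Rightarrow> nat \<Rightarrow> real" where
  "V idle x j = x (j + 1) - (if idle \<and> j = 0 then 0 else x j)"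

definition mean_field_solution ::
    "bool \<Rightarrow> real \<Rightarrow> real \<Rightarrow> real \<Rightarrow> (nat \<Rightarrow> real) \<Rightarrow> (real \<Rightarrow> nat \<Rightarrow> real) \<Rightarrow> bool" where
  "mean_field_solution idle T lam nu rho0 rho \<longleftrightarrow>
     (\<forall>t\<in>{0..T}. rho t \<in> prob_seqs) \<and>
     (\<forall>t\<in>{0..T}. ((\<lambda>s. l1_dist (rho s) (rho t)) \<longlongrightarrow> 0) (at t within {0..T})) \<and>
     (\<forall>t\<in>{0..T}. \<forall>j. ((\<lambda>s. rho s j) has_real_derivative
        (lam * U (rho t) j + nu * V idle (rho t) j)) (at t within {0..T})) \<and>
     rho 0 = rho0"

definition a11 :: "real \<Rightarrow> (real \<Rightarrow> nat \<Rightarrow> real) \<Rightarrow> real" where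
  "a11 T rho = (\<Sum>j. (integral {0..T} (\<lambda>s. U (rho s) j))\<^sup>2)"

definition a12 :: "bool \<Rightarrow> real \<Rightarrow> (real \<Rightarrow> nat \<Rightarrow> real) \<Rightarrow> real" where
  "a12 idle T rho =
     (\<Sum>j. integral {0..T} (\<lambda>s. U (rho s) j) * integral {0..T} (\<lambda>s. V idle (rho s) j))"

definition a22 :: "bool \<Rightarrow> real \<Rightarrow> (real \<Rightarrow> nat \<Rightarrow> real) \<Rightarrow> real" where
  "a22 idle T rho = (\<Sum>j. (integral {0..T} (\<lambda>s. V idle (rho s) j))\<^sup>2)"


section \<open>The approximate least squares estimator\<close>

text \<open>
  In this section \<open>r\<close> is an observed path of the empirical measure.
\<close>

definition U_bar :: "real \<Rightarrow> nat \<Rightarrow> (real \<Rightarrow> nat \<Rightarrow> real) \<Rightarrow> nat \<Rightarrow> real" where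
  "U_bar T m r j = T / real m * (\<Sum>k=1..m. U (r (real k * T / real m)) j)"

definition V_bar :: "bool \<Rightarrow> real \<Rightarrow> nat \<Rightarrow> (real \<Rightarrow> nat \<Rightarrow> real) \<Rightarrow> nat \<Rightarrow> real" where
  "V_bar idle T m r j = T / real m * (\<Sum>k=1..m. V idle (r (real k * T / real m)) j)"

text \<open>
  If the determinant in the denominator vanishes, the estimator takes the value \<open>(0, 0)\<close>, by the
  convention on division by 0.
\<close>

definition alse :: "bool \<Rightarrow> real \<Rightarrow> nat \<Rightarrow> (real \<Rightarrow> nat \<Rightarrow> real) \<Rightarrow> real \<times> real" where
  "alse idle T m r =
     (let a11 = (\<Sum>j. (U_bar T m r j)\<^sup>2);
          a12 = (\<Sum>j. U_bar T m r j * V_bar idle T m r j);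
          a22 = (\<Sum>j. (V_bar idle T m r j)\<^sup>2);
          b1 = (\<Sum>j. (r T j - r 0 j) * U_bar T m r j);
          b2 = (\<Sum>j. (r T j - r 0 j) * V_bar idle T m r j);
          d = a11 * a22 - a12\<^sup>2
      in ((a22 * b1 - a12 * b2) / d, (- a12 * b1 + a11 * b2) / d))"

end

theory Submission
  imports Defs
begin

text \<open>
  The estimator solves the normal equations of the linear regression
  \<open>\<varrho>\<^sub>j(T) - \<varrho>\<^sub>j(0) = \<lambda> u\<^sub>j + \<nu> v\<^sub>j\<close> with \<open>u\<^sub>j = \<integral> U\<^sub>j(\<varrho>(s)) ds\<close> and \<open>v\<^sub>j = \<integral> V\<^sub>j(\<varrho>(s)) ds\<close>, an identity that
  the limit satisfies exactly with the true parameter. The determinant condition makes the solution of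
  the normal equations a continuous function of the Gram coefficients and of the right-hand sides.
  These are inner products of sequences, so it is enough that the sampled averages of \<open>U\<close> and \<open>V\<close> along
  the observed path, and its increment over \<open>[0, T]\<close>, converge to their limits in the summable norm
  (\<open>alse_near_true_parameter\<close>). The drift is Lipschitz in that norm and the limit is a Lipschitz curve,
  so the Riemann sums of the limit are accurate up to a constant divided by \<open>m\<close>, and what remains is the
  average over the sampling times of the distance between \<open>\<varrho>\<^sup>N\<close> and \<open>\<varrho>\<close>.

  By linearity and Markov's inequality, it suffices that the expected distance at time \<open>t\<close> tends to 0
  uniformly in \<open>t\<close>. This concerns one time at a time, so it can be read off from the forward equation of
  the one-dimensional marginals. In terms of the fraction \<open>Q\<^sub>k\<close> of queues of length at least \<open>k\<close>, the limit equation reads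
  \<open>q\<^sub>k' = \<lambda> (q\<^sub>k\<^sub>-\<^sub>1\<^sup>2 - q\<^sub>k\<^sup>2) - \<nu> (q\<^sub>k - q\<^sub>k\<^sub>+\<^sub>1)\<close>, and the generator applied to \<open>Q\<^sub>k\<close> gives precisely the same
  expression in \<open>Q\<close>. Since jumps of \<open>Q\<^sub>k\<close> have size \<open>1/N\<close> and occur at a rate of order \<open>N\<close>, the function
  \<open>g\<^sub>k(t) = E (Q\<^sub>k(t) - q\<^sub>k(t))\<^sup>2\<close> satisfies \<open>g\<^sub>k' \<le> L (g\<^sub>k\<^sub>-\<^sub>1 + 3 g\<^sub>k + g\<^sub>k\<^sub>+\<^sub>1) + L/N\<close>. Weighting with \<open>2\<^sup>-\<^sup>k\<close> closes
  this infinite system, and Gronwall's inequality bounds \<open>g\<^sub>k\<close> (\<open>two_choices_mean_square\<close>). Convergence of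
  all tails, together with a uniform bound on the tails of the limit, gives convergence in the summable
  norm (\<open>empirical_mean_l1_error_tendsto_0\<close>).

  The forward equation itself comes from the transition function, of which only the derivatives at time 0
  of its individual entries are known: supermultiplicativity of the holding probabilities turns them into
  the bound \<open>1 - p\<^sub>h(x, x) \<le> q h\<close>, which makes dominated convergence available.

  If empty queues are counted as served (\<open>idle = False\<close>) and \<open>\<nu> > 0\<close>, mass is lost and the limit equation
  has no solution among probability sequences; if \<open>\<nu> = 0\<close>, the two forms of the limit equation coincide.
  So the limit can always be taken to solve the conservative equation, while the estimator is
  treated for both conventions.
\<close>

section \<open>A Gronwall inequality for right derivatives\<close>

text \<open>
  For a slope \<open>c > 0\<close>, consider the last point at which \<open>g\<close> does not exceed the line of slope \<open>c\<close> through
  \<open>(a, g a)\<close>. It is \<open>b\<close>, because from any earlier such point the right derivative leads to a later one.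
\<close>

lemma nonincreasing_of_right_derivative_le_0:
  fixes g :: "real \<Rightarrow> real"
  assumes "a \<le> b" and cont: "continuous_on {a..b} g"
    and der: "\<And>t. a \<le> t \<Longrightarrow> t < b \<Longrightarrow> \<exists>d\<le>0. (g has_real_derivative d) (at_right t)"
  shows "g b \<le> g a"
proof (rule field_le_epsilon)
  fix e :: real assume "e > 0"
  define c where "c = e / (b - a + 1)"
  have c: "c > 0" "c * (b - a) \<le> e"
    using \<open>a \<le> b\<close> \<open>e > 0\<close> by (auto simp: c_def field_simps)
  define A where "A = {t \<in> {a..b}. g t - c * (t - a) \<le> g a}"
  have "closed A"
    unfolding A_def by (intro continuous_on_closed_Collect_le continuous_intros cont closed_atLeastAtMost)
  have "A \<noteq> {}" "bdd_above A"
    using \<open>a \<le> b\<close> by (auto simp: A_def intro!: bdd_aboveI[of _ b] exI[of _ a])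
  define s where "s = Sup A"
  have sA: "s \<in> A"
    unfolding s_def using \<open>closed A\<close> \<open>A \<noteq> {}\<close> \<open>bdd_above A\<close> by (rule closed_contains_Sup[rotated 2])
  have "s = b"
  proof (rule ccontr)
    assume "s \<noteq> b"
    with sA have s: "a \<le> s" "s < b" by (auto simp: A_def)
    from der[OF this] obtain d where "d \<le> 0" and d: "(g has_real_derivative d) (at_right s)" by auto
    from d have "((\<lambda>y. (g y - g s) / (y - s)) \<longlongrightarrow> d) (at_right s)"
      by (simp add: has_field_derivative_iff)
    then have "\<forall>\<^sub>F y in at_right s. (g y - g s) / (y - s) < c"
      by (rule order_tendstoD) (use \<open>d \<le> 0\<close> c in auto)
    moreover have "\<forall>\<^sub>F y in at_right s. y \<in> {s<..<b}"
      using s by (intro eventually_at_right_real)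
    ultimately have "\<forall>\<^sub>F y in at_right s. y \<in> A \<and> y > s"
    proof eventually_elim
      case (elim y)
      then have "g y - g s < c * (y - s)" by (simp add: field_simps)
      then have "g y - c * (y - a) \<le> g a" using sA by (simp add: A_def algebra_simps)
      then show ?case using elim s by (auto simp: A_def)
    qed
    then obtain y where "y \<in> A" "y > s"
      using eventually_happens trivial_limit_at_right_real by blast
    then show False
      using \<open>bdd_above A\<close> cSup_upper[of y A] by (simp add: s_def)
  qed
  then show "g b \<le> g a + e" using sA c by (auto simp: A_def)
qed

text \<open>
  Expectations of a jump process are only seen to have right derivatives, so the usual
  Gronwall lemma, which assumes two-sided ones, does not apply. The function
  \<open>exp (- C s) f s - D s\<close> has a nonpositive right derivative.
\<close>

lemma gronwall_right_derivative:
  fixes f f' :: "real \<Rightarrow> real"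
  assumes "0 \<le> C" "0 \<le> D" "0 \<le> t" and cont: "continuous_on {0..t} f"
    and der: "\<And>s. 0 \<le> s \<Longrightarrow> s < t \<Longrightarrow> (f has_real_derivative f' s) (at_right s)"
    and le: "\<And>s. 0 \<le> s \<Longrightarrow> s < t \<Longrightarrow> f' s \<le> C * f s + D"
  shows "f t \<le> (f 0 + D * t) * exp (C * t)"
proof -
  define g where "g = (\<lambda>s. exp (- C * s) * f s - D * s)"
  have "g t \<le> g 0"
  proof (rule nonincreasing_of_right_derivative_le_0[where g=g])
    show "continuous_on {0..t} g"
      unfolding g_def by (intro continuous_intros cont)
    fix s assume s: "0 \<le> s" "s < t"
    have "(g has_real_derivative (exp (- C * s) * f' s + (- C * exp (- C * s)) * f s - D)) (at_right s)"
      unfolding g_def by (auto intro!: derivative_eq_intros der s)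
    moreover have "exp (- C * s) * f' s + (- C * exp (- C * s)) * f s - D \<le> 0"
    proof -
      have "exp (- C * s) * f' s \<le> exp (- C * s) * (C * f s + D)"
        using le[OF s] by (intro mult_left_mono) auto
      moreover have "exp (- C * s) * D \<le> 1 * D"
        using assms s by (intro mult_right_mono) auto
      ultimately show ?thesis by (simp add: algebra_simps)
    qed
    ultimately show "\<exists>d\<le>0. (g has_real_derivative d) (at_right s)" by blast
  qed (use assms in auto)
  then have "exp (- C * t) * f t \<le> f 0 + D * t" by (simp add: g_def)
  then have "exp (C * t) * (exp (- C * t) * f t) \<le> exp (C * t) * (f 0 + D * t)"
    by (intro mult_left_mono) auto
  then show ?thesis by (simp add: exp_minus field_simps)
qed

section \<open>Laws on countable state spaces\<close>

lemma integral_bind_pmf_bounded: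
  fixes \<phi> :: "'b \<Rightarrow> real"
  assumes B: "\<And>y. \<bar>\<phi> y\<bar> \<le> B"
  shows "(\<integral>y. \<phi> y \<partial>bind_pmf \<mu> K) = (\<integral>x. (\<integral>y. \<phi> y \<partial>K x) \<partial>\<mu>)"
proof -
  have i: "integrable (measure_pmf \<nu>) \<phi>" for \<nu> :: "'b pmf"
    by (rule measure_pmf.integrable_const_bound[where B=B]) (use B in auto)
  have i': "integrable (measure_pmf \<mu>) (\<lambda>x. \<integral>y. \<phi> y \<partial>K x)"
  proof (rule measure_pmf.integrable_const_bound[where B=B])
    have "\<bar>\<integral>y. \<phi> y \<partial>K x\<bar> \<le> B" for x
    proof -
      have "\<bar>\<integral>y. \<phi> y \<partial>K x\<bar> \<le> (\<integral>y. \<bar>\<phi> y\<bar> \<partial>K x)" by (rule integral_abs_bound)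
      also have "\<dots> \<le> (\<integral>y. B \<partial>K x)" by (intro integral_mono i integrable_abs B) auto
      finally show ?thesis by simp
    qed
    then show "AE x in \<mu>. norm (\<integral>y. \<phi> y \<partial>K x) \<le> B" by auto
  qed auto
  have pos: "0 \<le> \<phi> y + B" for y using B[of y] by linarith
  have eq: "ennreal ((\<integral>y. \<phi> y \<partial>\<nu>) + B) = (\<integral>\<^sup>+y. ennreal (\<phi> y + B) \<partial>\<nu>)" for \<nu> :: "'b pmf"
    using pos i by (subst nn_integral_eq_integral) auto
  have pos': "0 \<le> (\<integral>y. \<phi> y \<partial>\<nu>) + B" for \<nu> :: "'b pmf"
  proof -
    have "0 \<le> (\<integral>y. \<phi> y + B \<partial>\<nu>)" by (intro Bochner_Integration.integral_nonneg) (use pos in auto)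
    then show ?thesis using i by simp
  qed
  have "ennreal ((\<integral>y. \<phi> y \<partial>bind_pmf \<mu> K) + B) = (\<integral>\<^sup>+x. (\<integral>\<^sup>+y. ennreal (\<phi> y + B) \<partial>K x) \<partial>\<mu>)"
    by (simp add: eq)
  also have "\<dots> = (\<integral>\<^sup>+x. ennreal ((\<integral>y. \<phi> y \<partial>K x) + B) \<partial>\<mu>)"
    by (simp add: eq)
  also have "\<dots> = ennreal ((\<integral>x. (\<integral>y. \<phi> y \<partial>K x) \<partial>\<mu>) + B)"
    using pos' i' by (subst nn_integral_eq_integral) auto
  finally have *: "ennreal ((\<integral>y. \<phi> y \<partial>bind_pmf \<mu> K) + B) = ennreal ((\<integral>x. (\<integral>y. \<phi> y \<partial>K x) \<partial>\<mu>) + B)" .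
  have "0 \<le> (\<integral>x. (\<integral>y. \<phi> y \<partial>K x) + B \<partial>\<mu>)"
    by (intro Bochner_Integration.integral_nonneg) (use pos' in auto)
  then have "0 \<le> (\<integral>x. (\<integral>y. \<phi> y \<partial>K x) \<partial>\<mu>) + B" using i' by simp
  with * pos' show ?thesis
    by (simp add: ennreal_inj)
qed

text \<open>
  Countability of \<open>S\<close> is what makes the law discrete: the atoms of mass 0 in \<open>S\<close> then form a null set.
\<close>

lemma countable_valued_law_pmf:
  assumes "prob_space M" and Y: "Y \<in> M \<rightarrow>\<^sub>M count_space UNIV"
    and S: "\<And>\<omega>. \<omega> \<in> space M \<Longrightarrow> Y \<omega> \<in> S" and "countable S"
  obtains \<mu> where "distr M (count_space UNIV) Y = measure_pmf \<mu>"
proof -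
  interpret prob_space M by fact
  let ?D = "distr M (count_space UNIV) Y"
  interpret D: prob_space ?D using Y by (rule prob_space_distr)
  let ?Z = "{x\<in>S. measure ?D {x} = 0}"
  have "AE x in ?D. x \<in> S" using S Y by (subst AE_distr_iff) auto
  moreover have "AE x in ?D. x \<notin> ?Z"
  proof (rule AE_not_in)
    have "(\<Union>x\<in>?Z. {x}) \<in> null_sets ?D"
      using \<open>countable S\<close>
      by (intro null_sets_UN') (auto simp: null_sets_def D.emeasure_eq_measure intro: countable_subset[of _ S])
    then show "?Z \<in> null_sets ?D" by simp
  qed
  ultimately have "AE x in ?D. measure ?D {x} \<noteq> 0" by eventually_elim auto
  then have "measure_pmf (Abs_pmf ?D) = ?D"
    by (intro Abs_pmf_inverse) (auto intro: D.prob_space_axioms)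
  then show ?thesis using that[of "Abs_pmf ?D"] by simp
qed

text \<open>
  The joint law of a starting point and the state reached from it in one Markov step.
\<close>

lemma pmf_bind_map_Pair:
  "pmf (bind_pmf \<mu> (\<lambda>x. map_pmf (Pair x) (K x))) (a, b) = pmf \<mu> a * pmf (K a) b"
proof -
  have "pmf (map_pmf (Pair x) (K x)) (a, b) = (if x = a then pmf (K a) b else 0)" for x
  proof (cases "x = a")
    case True
    then show ?thesis by (simp add: pmf_map_inj' inj_def)
  next
    case False
    then show ?thesis by (auto simp: pmf_eq_0_set_pmf)
  qed
  then show ?thesis
    by (simp add: pmf_bind integral_measure_pmf_real[where A="{a}"] mult.commute split: if_splits)
qed

lemma integrable_bounded_pmf:
  fixes \<phi> :: "'a \<Rightarrow> real"
  assumes "\<And>y. \<bar>\<phi> y\<bar> \<le> B"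
  shows "integrable (measure_pmf \<nu>) \<phi>"
  by (rule measure_pmf.integrable_const_bound[where B=B]) (use assms in auto)

text \<open>
  Outside of \<open>x\<close> and the finite set \<open>A\<close>, the increment of \<open>\<phi>\<close> is at most \<open>2 B\<close> and the mass is what \<open>x\<close> and \<open>A\<close>
  leave over. Used with the set of jump targets for \<open>A\<close>, and with \<open>A = {}\<close>.
\<close>

lemma expectation_minus_finite_part:
  fixes \<phi> :: "'s \<Rightarrow> real" and \<nu> :: "'s pmf"
  assumes B: "\<And>y. \<bar>\<phi> y\<bar> \<le> B" and A: "finite A" "x \<notin> A"
  shows "\<bar>(\<integral>y. \<phi> y \<partial>\<nu>) - \<phi> x - (\<Sum>y\<in>A. pmf \<nu> y * (\<phi> y - \<phi> x))\<bar>
           \<le> 2 * B * (1 - pmf \<nu> x - (\<Sum>y\<in>A. pmf \<nu> y))"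
proof -
  let ?I = "insert x A"
  have i: "integrable (measure_pmf \<nu>) \<phi>" by (rule integrable_bounded_pmf[OF B])
  have iI: "(\<integral>y. indicator ?I y * (\<phi> y - \<phi> x) \<partial>\<nu>) = (\<Sum>y\<in>A. pmf \<nu> y * (\<phi> y - \<phi> x))"
    using A by (subst integral_measure_pmf_real[where A="?I"]) (auto simp: indicator_def mult.commute intro!: sum.cong split: if_splits)
  have B2: "\<bar>\<phi> y - \<phi> x\<bar> \<le> 2 * B" for y using B[of y] B[of x] by linarith
  have ii: "integrable (measure_pmf \<nu>) (\<lambda>y. indicator ?I y * (\<phi> y - \<phi> x))"
    by (rule integrable_bounded_pmf[where B="2*B"]) (use B2 B2[of x] in \<open>auto simp: indicator_def\<close>)
  have ij: "integrable (measure_pmf \<nu>) (\<lambda>y. indicator (-?I) y * (\<phi> y - \<phi> x))"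
    by (rule integrable_bounded_pmf[where B="2*B"]) (use B2 B2[of x] in \<open>auto simp: indicator_def\<close>)
  have "(\<integral>y. \<phi> y \<partial>\<nu>) - \<phi> x = (\<integral>y. \<phi> y - \<phi> x \<partial>\<nu>)" using i by simp
  also have "\<dots> = (\<integral>y. indicator ?I y * (\<phi> y - \<phi> x) + indicator (-?I) y * (\<phi> y - \<phi> x) \<partial>\<nu>)"
    by (intro Bochner_Integration.integral_cong) (auto simp: indicator_def)
  also have "\<dots> = (\<Sum>y\<in>A. pmf \<nu> y * (\<phi> y - \<phi> x)) + (\<integral>y. indicator (-?I) y * (\<phi> y - \<phi> x) \<partial>\<nu>)"
    using ii ij iI by simp
  finally have "\<bar>(\<integral>y. \<phi> y \<partial>\<nu>) - \<phi> x - (\<Sum>y\<in>A. pmf \<nu> y * (\<phi> y - \<phi> x))\<bar>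
      = \<bar>\<integral>y. indicator (-?I) y * (\<phi> y - \<phi> x) \<partial>\<nu>\<bar>" by simp
  also have "\<dots> \<le> (\<integral>y. \<bar>indicator (-?I) y * (\<phi> y - \<phi> x)\<bar> \<partial>\<nu>)" by (rule integral_abs_bound)
  also have "\<dots> \<le> (\<integral>y. 2 * B * indicator (-?I) y \<partial>\<nu>)"
  proof (intro integral_mono integrable_abs ij)
    show "integrable \<nu> (\<lambda>y. 2 * B * indicator (-?I) y)"
      by (rule integrable_bounded_pmf[where B="2*B"]) (use B2[of x] in \<open>auto simp: indicator_def\<close>)
  qed (use B2 B2[of x] in \<open>auto simp: indicator_def\<close>)
  also have "\<dots> = 2 * B * measure \<nu> (-?I)" by simp
  also have "measure \<nu> (-?I) = 1 - measure \<nu> ?I"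
    using measure_pmf.prob_compl[of ?I \<nu>] by (simp add: Compl_eq_Diff_UNIV)
  also have "measure \<nu> ?I = pmf \<nu> x + (\<Sum>y\<in>A. pmf \<nu> y)"
    using A by (simp add: measure_measure_pmf_finite)
  finally show ?thesis by (simp add: algebra_simps)
qed

section \<open>Jump processes with bounded rates\<close>

text \<open>
  From each state \<open>x\<close> only the finitely many states in \<open>F x\<close> can be reached by one jump, and the total
  jump rate is bounded by \<open>q\<close> uniformly in \<open>x\<close>. The uniform bound makes the time derivative of
  expectations at 0 dominated.
\<close>

locale bounded_rate_jump_semigroup =
  fixes S :: "'s set" and p :: "real \<Rightarrow> 's \<Rightarrow> 's pmf" and r :: "'s \<Rightarrow> 's \<Rightarrow> real"
    and F :: "'s \<Rightarrow> 's set" and q :: real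
  assumes transition: "transition_function S p"
    and rates: "has_jump_rates S p r"
    and finite_targets: "\<And>x. x \<in> S \<Longrightarrow> finite (F x)"
    and targets: "\<And>x. x \<in> S \<Longrightarrow> F x \<subseteq> S - {x}"
    and no_other_target: "\<And>x y. x \<in> S \<Longrightarrow> y \<in> S - {x} - F x \<Longrightarrow> r x y = 0"
    and exit_rate_le: "\<And>x. x \<in> S \<Longrightarrow> (\<Sum>y\<in>F x. r x y) \<le> q"
begin

definition generator :: "('s \<Rightarrow> real) \<Rightarrow> 's \<Rightarrow> real" where
  "generator \<phi> x = (\<Sum>y\<in>F x. r x y * (\<phi> y - \<phi> x))"

lemma exit_rate_eq: "x \<in> S \<Longrightarrow> infsum (r x) (S - {x}) = (\<Sum>y\<in>F x. r x y)"
  using finite_targets[of x] targets[of x] no_other_target[of x]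
  by (subst infsum_cong_neutral[where T="F x" and g="r x"]) auto

lemma stay_rate:
  assumes "x \<in> S"
  shows "((\<lambda>h. (1 - pmf (p h x) x) / h) \<longlongrightarrow> (\<Sum>y\<in>F x. r x y)) (at_right 0)"
proof -
  have "((\<lambda>h. (pmf (p h x) x - 1) / h) \<longlongrightarrow> - (\<Sum>y\<in>F x. r x y)) (at_right 0)"
    using rates assms unfolding has_jump_rates_def by (auto simp: exit_rate_eq dest!: bspec[of _ _ x])
  from tendsto_minus[OF this] show ?thesis
    by (simp add: minus_divide_left)
qed

lemma jump_rate:
  assumes "x \<in> S" "y \<in> F x"
  shows "((\<lambda>h. pmf (p h x) y / h) \<longlongrightarrow> r x y) (at_right 0)"
proof -
  have "y \<in> S" "y \<noteq> x" using targets assms by auto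
  then show ?thesis
    using rates[unfolded has_jump_rates_def, rule_format, of x y] assms by simp
qed

text \<open>
  Being at \<open>x\<close> at times \<open>s\<close> and \<open>s + t\<close> is one of the ways of being at \<open>x\<close> at time \<open>s + t\<close>.
\<close>

lemma stay_supermultiplicative:
  assumes "x \<in> S" "0 \<le> s" "0 \<le> t"
  shows "pmf (p s x) x * pmf (p t x) x \<le> pmf (p (s + t) x) x"
proof -
  have "pmf (p s x) x * pmf (p t x) x = (\<integral>y. indicator {x} y * pmf (p t x) x \<partial>p s x)"
    by (simp add: measure_pmf_single)
  also have "\<dots> \<le> (\<integral>y. pmf (p t y) x \<partial>p s x)"
    by (intro integral_mono measure_pmf.integrable_const_bound[where B=1])
       (auto simp: pmf_le_1 indicator_def)
  also have "\<dots> = pmf (p (s + t) x) x"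
    using transition assms by (simp add: transition_function_def pmf_bind)
  finally show ?thesis .
qed

lemma stay_power:
  assumes "x \<in> S" "0 \<le> h"
  shows "pmf (p h x) x ^ n \<le> pmf (p (real n * h) x) x"
proof (induction n)
  case 0
  then show ?case using transition assms by (simp add: transition_function_def)
next
  case (Suc n)
  have "pmf (p h x) x ^ Suc n \<le> pmf (p h x) x * pmf (p (real n * h) x) x"
    using Suc by (simp add: mult_left_mono)
  also have "\<dots> \<le> pmf (p (h + real n * h) x) x"
    using assms by (intro stay_supermultiplicative) auto
  finally show ?case by (simp add: algebra_simps)
qed

text \<open>
  The rates only describe the limit of \<open>(1 - p\<^sub>h(x, x)) / h\<close> at 0; this bound holds for every \<open>h\<close>. Splitting
  \<open>[0, h]\<close> into \<open>n\<close> parts, supermultiplicativity and Bernoulli's inequality give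
  \<open>1 - p\<^sub>h(x, x) \<le> n (1 - p\<^sub>h\<^sub>/\<^sub>n(x, x))\<close>, and the right-hand side tends to \<open>h\<close> times the exit rate.
\<close>

lemma leave_prob_le:
  assumes x: "x \<in> S" and "0 \<le> h"
  shows "1 - pmf (p h x) x \<le> q * h"
proof (cases "h = 0")
  case True
  then show ?thesis using transition x by (simp add: transition_function_def)
next
  case False
  then have h: "h > 0" using assms by simp
  have lim: "filterlim (\<lambda>n. h / real (Suc n)) (at_right 0) sequentially"
    unfolding filterlim_at using h
    by (auto intro!: always_eventually real_tendsto_divide_at_top[OF tendsto_const] filterlim_compose[OF filterlim_real_sequentially filterlim_Suc] simp del: of_nat_Suc)
  have "(\<lambda>n. (1 - pmf (p (h / real (Suc n)) x) x) / (h / real (Suc n))) \<longlonglongrightarrow> (\<Sum>y\<in>F x. r x y)"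
    using filterlim_compose[OF stay_rate[OF x] lim] by simp
  then have "(\<lambda>n. h * ((1 - pmf (p (h / real (Suc n)) x) x) / (h / real (Suc n)))) \<longlonglongrightarrow> h * (\<Sum>y\<in>F x. r x y)"
    by (intro tendsto_intros)
  moreover have "1 - pmf (p h x) x \<le> h * ((1 - pmf (p (h / real (Suc n)) x) x) / (h / real (Suc n)))" for n
  proof -
    let ?s = "pmf (p (h / real (Suc n)) x) x"
    have "1 + real (Suc n) * (?s - 1) \<le> (1 + (?s - 1)) ^ Suc n"
      by (rule Bernoulli_inequality) simp
    also have "\<dots> \<le> pmf (p (real (Suc n) * (h / real (Suc n))) x) x"
      using stay_power[OF x, of "h / real (Suc n)" "Suc n"] h by simp
    also have "\<dots> = pmf (p h x) x" by simp
    finally have "1 - pmf (p h x) x \<le> real (Suc n) * (1 - ?s)" by (simp add: algebra_simps)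
    also have "\<dots> = h * ((1 - ?s) / (h / real (Suc n)))" using h by (simp del: of_nat_Suc)
    finally show ?thesis .
  qed
  ultimately have "1 - pmf (p h x) x \<le> h * (\<Sum>y\<in>F x. r x y)"
    by (intro LIMSEQ_le_const) auto
  also have "\<dots> \<le> h * q" using exit_rate_le[OF x] h by simp
  finally show ?thesis by (simp add: mult.commute)
qed

lemma semigroup_increment_le:
  assumes "x \<in> S" "0 \<le> h" and B: "\<And>y. \<bar>\<phi> y\<bar> \<le> B"
  shows "\<bar>(\<integral>y. \<phi> y \<partial>p h x) - \<phi> x\<bar> \<le> 2 * B * q * h"
proof -
  have "0 \<le> B" using B[of undefined] by linarith
  have "\<bar>(\<integral>y. \<phi> y \<partial>p h x) - \<phi> x\<bar> \<le> 2 * B * (1 - pmf (p h x) x)"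
    using expectation_minus_finite_part[OF B, where A="{}"] by simp
  also have "\<dots> \<le> 2 * B * (q * h)"
    using leave_prob_le[OF assms(1,2)] \<open>0 \<le> B\<close> by (intro mult_left_mono) auto
  finally show ?thesis by (simp add: mult_ac)
qed

text \<open>
  The rates out of \<open>x\<close> sum to the exit rate, so the probability of having moved to a state outside of \<open>F x\<close>
  is \<open>o(h)\<close>. This is where conservativity of the rate matrix enters.
\<close>

lemma semigroup_derivative_at_0:
  assumes x: "x \<in> S" and B: "\<And>y. \<bar>\<phi> y\<bar> \<le> B"
  shows "((\<lambda>h. ((\<integral>y. \<phi> y \<partial>p h x) - \<phi> x) / h) \<longlongrightarrow> generator \<phi> x) (at_right 0)"
proof -
  let ?A = "F x"
  let ?rem = "\<lambda>h. ((\<integral>y. \<phi> y \<partial>p h x) - \<phi> x) / h - (\<Sum>y\<in>?A. pmf (p h x) y / h * (\<phi> y - \<phi> x))"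
  have A: "finite ?A" "x \<notin> ?A" using finite_targets targets x by auto
  have 1: "((\<lambda>h. \<Sum>y\<in>?A. pmf (p h x) y / h * (\<phi> y - \<phi> x)) \<longlongrightarrow> generator \<phi> x) (at_right 0)"
    unfolding generator_def by (intro tendsto_intros jump_rate x)
  have "((\<lambda>h. 2 * B * ((1 - pmf (p h x) x) / h - (\<Sum>y\<in>?A. pmf (p h x) y / h)))
      \<longlongrightarrow> 2 * B * ((\<Sum>y\<in>?A. r x y) - (\<Sum>y\<in>?A. r x y))) (at_right 0)"
    by (intro tendsto_intros jump_rate stay_rate x)
  then have 2: "(?rem \<longlongrightarrow> 0) (at_right 0)"
  proof (rule Lim_null_comparison[rotated, OF tendsto_eq_rhs])
    show "\<forall>\<^sub>F h in at_right 0. norm (?rem h) \<le> 2 * B * ((1 - pmf (p h x) x) / h - (\<Sum>y\<in>?A. pmf (p h x) y / h))"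
      using eventually_at_right_less[of "0::real"]
    proof eventually_elim
      case (elim h)
      have "?rem h = ((\<integral>y. \<phi> y \<partial>p h x) - \<phi> x - (\<Sum>y\<in>?A. pmf (p h x) y * (\<phi> y - \<phi> x))) / h"
        by (simp add: diff_divide_distrib sum_divide_distrib)
      then have "norm (?rem h) = \<bar>(\<integral>y. \<phi> y \<partial>p h x) - \<phi> x - (\<Sum>y\<in>?A. pmf (p h x) y * (\<phi> y - \<phi> x))\<bar> / h"
        using elim by simp
      also have "\<dots> \<le> 2 * B * (1 - pmf (p h x) x - (\<Sum>y\<in>?A. pmf (p h x) y)) / h"
        using elim by (intro divide_right_mono expectation_minus_finite_part[OF B A]) auto
      also have "\<dots> = 2 * B * ((1 - pmf (p h x) x) / h - (\<Sum>y\<in>?A. pmf (p h x) y / h))"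
        by (simp add: diff_divide_distrib sum_divide_distrib[symmetric] right_diff_distrib)
      finally show ?case .
    qed
  qed simp
  show ?thesis using tendsto_add[OF 2 1] by simp
qed

text \<open>
  Conditioning on the state at time \<open>t\<close> expresses the difference quotient as the mean of
  \<open>(P\<^sub>h \<phi> - \<phi>) / h\<close> under \<open>\<mu> t\<close>; it converges pointwise and is bounded by \<open>2 B q\<close>.
\<close>

lemma forward_equation:
  fixes \<mu> :: "real \<Rightarrow> 's pmf"
  assumes \<mu>: "\<And>s t. 0 \<le> s \<Longrightarrow> s < t \<Longrightarrow> t \<le> T \<Longrightarrow> \<mu> t = bind_pmf (\<mu> s) (p (t - s))"
    and S: "\<And>t. 0 \<le> t \<Longrightarrow> t \<le> T \<Longrightarrow> set_pmf (\<mu> t) \<subseteq> S"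
    and B: "\<And>y. \<bar>\<phi> y\<bar> \<le> B"
  shows expectation_continuous: "continuous_on {0..T} (\<lambda>t. \<integral>y. \<phi> y \<partial>\<mu> t)"
    and expectation_right_derivative: "\<And>t. 0 \<le> t \<Longrightarrow> t < T \<Longrightarrow>
      ((\<lambda>t. \<integral>y. \<phi> y \<partial>\<mu> t) has_real_derivative (\<integral>y. generator \<phi> y \<partial>\<mu> t)) (at_right t)"
proof -
  have "0 \<le> B" using B[of undefined] by linarith
  have PB: "\<bar>\<integral>y. \<phi> y \<partial>p h x\<bar> \<le> B" for h x
  proof -
    have "\<bar>\<integral>y. \<phi> y \<partial>p h x\<bar> \<le> (\<integral>y. \<bar>\<phi> y\<bar> \<partial>p h x)" by (rule integral_abs_bound)
    also have "\<dots> \<le> (\<integral>y. B \<partial>p h x)" by (intro integral_mono integrable_abs integrable_bounded_pmf[OF B] B) auto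
    finally show ?thesis by simp
  qed
  have eq: "(\<integral>y. \<phi> y \<partial>\<mu> t) - (\<integral>y. \<phi> y \<partial>\<mu> s) = (\<integral>x. (\<integral>y. \<phi> y \<partial>p (t - s) x) - \<phi> x \<partial>\<mu> s)"
    if "0 \<le> s" "s < t" "t \<le> T" for s t
  proof -
    have "(\<integral>y. \<phi> y \<partial>\<mu> t) = (\<integral>x. (\<integral>y. \<phi> y \<partial>p (t - s) x) \<partial>\<mu> s)"
      unfolding \<mu>[OF that] by (rule integral_bind_pmf_bounded[OF B])
    then show ?thesis
      using integrable_bounded_pmf[OF B, of "\<mu> s"] integrable_bounded_pmf[OF PB, of "\<mu> s"] by simp
  qed
  have lip: "\<bar>(\<integral>y. \<phi> y \<partial>\<mu> t) - (\<integral>y. \<phi> y \<partial>\<mu> s)\<bar> \<le> 2 * B * q * (t - s)"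
    if "0 \<le> s" "s < t" "t \<le> T" for s t
  proof -
    have "\<bar>\<integral>x. (\<integral>y. \<phi> y \<partial>p (t - s) x) - \<phi> x \<partial>\<mu> s\<bar> \<le> (\<integral>x. \<bar>(\<integral>y. \<phi> y \<partial>p (t - s) x) - \<phi> x\<bar> \<partial>\<mu> s)"
      by (rule integral_abs_bound)
    also have "\<dots> \<le> (\<integral>x. 2 * B * q * (t - s) \<partial>\<mu> s)"
      by (intro integral_mono_AE integrable_abs Bochner_Integration.integrable_diff integrable_bounded_pmf[OF B] integrable_bounded_pmf[OF PB])
         (use S[of s] that in \<open>auto simp: AE_measure_pmf_iff intro!: semigroup_increment_le B\<close>)
    finally show ?thesis using eq[OF that] by simp
  qed
  have "0 \<le> q" if "0 \<le> T"
  proof -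
    obtain x where "x \<in> set_pmf (\<mu> 0)" using set_pmf_not_empty[of "\<mu> 0"] by fast
    then have "x \<in> S" using S[of 0] that by auto
    from leave_prob_le[OF this, of 1] pmf_le_1[of "p 1 x" x] show "0 \<le> q" by simp
  qed
  then have "0 \<le> 2 * B * q" if "0 \<le> T" using \<open>0 \<le> B\<close> that by simp
  then have "(2 * B * q)-lipschitz_on {0..T} (\<lambda>t. \<integral>y. \<phi> y \<partial>\<mu> t)" if "0 \<le> T"
  proof (intro lipschitz_onI)
    fix s t assume st: "s \<in> {0..T}" "t \<in> {0..T}"
    show "dist (\<integral>y. \<phi> y \<partial>\<mu> s) (\<integral>y. \<phi> y \<partial>\<mu> t) \<le> 2 * B * q * dist s t"
      using lip[of s t] lip[of t s] st by (cases s t rule: linorder_cases) (auto simp: dist_real_def abs_minus_commute)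
  qed (use that in blast)
  then show "continuous_on {0..T} (\<lambda>t. \<integral>y. \<phi> y \<partial>\<mu> t)"
    by (cases "0 \<le> T") (blast intro: lipschitz_on_continuous_on, simp)
  fix t assume t: "0 \<le> t" "t < T"
  let ?d = "\<lambda>h x. ((\<integral>y. \<phi> y \<partial>p h x) - \<phi> x) / h"
  have AES: "AE x in \<mu> t. x \<in> S" using S[of t] t by (auto simp: AE_measure_pmf_iff)
  have "((\<lambda>h. \<integral>x. ?d h x \<partial>\<mu> t) \<longlongrightarrow> (\<integral>x. generator \<phi> x \<partial>\<mu> t)) (at_right 0)"
    unfolding filterlim_at_right_to_top
  proof (rule integral_dominated_convergence_at_top[where w="\<lambda>_. 2 * B * q"])
    show "AE x in \<mu> t. ((\<lambda>s. ?d (inverse s) x) \<longlongrightarrow> generator \<phi> x) at_top"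
      using AES
    proof eventually_elim
      case (elim x)
      show ?case using semigroup_derivative_at_0[OF elim B] unfolding filterlim_at_right_to_top .
    qed
    show "\<forall>\<^sub>F s in at_top. AE x in \<mu> t. norm (?d (inverse s) x) \<le> 2 * B * q"
      using eventually_gt_at_top[of "0::real"]
    proof eventually_elim
      case (elim s)
      show ?case using AES
      proof eventually_elim
        case (elim x)
        have "norm (?d (inverse s) x) = \<bar>(\<integral>y. \<phi> y \<partial>p (inverse s) x) - \<phi> x\<bar> * s"
          using \<open>s > 0\<close> by (simp add: abs_mult divide_inverse)
        also have "\<dots> \<le> (2 * B * q * inverse s) * s"
          using elim \<open>s > 0\<close> by (intro mult_right_mono semigroup_increment_le B) auto
        also have "\<dots> = 2 * B * q" using \<open>s > 0\<close> by simp
        finally show ?case .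
      qed
    qed
  qed auto
  moreover have "\<forall>\<^sub>F h in at_right 0. (\<integral>x. ?d h x \<partial>\<mu> t) = ((\<integral>y. \<phi> y \<partial>\<mu> (t + h)) - (\<integral>y. \<phi> y \<partial>\<mu> t)) / h"
  proof -
    have "\<forall>\<^sub>F h in at_right 0. h \<in> {0<..<T - t}" using t by (intro eventually_at_right_real) auto
    then show ?thesis
    proof eventually_elim
      case (elim h)
      then show ?case using eq[of t "t + h"] t by simp
    qed
  qed
  ultimately have "((\<lambda>h. ((\<integral>y. \<phi> y \<partial>\<mu> (t + h)) - (\<integral>y. \<phi> y \<partial>\<mu> t)) / h) \<longlongrightarrow> (\<integral>x. generator \<phi> x \<partial>\<mu> t)) (at_right 0)"
    by (rule Lim_transform_eventually)
  then show "((\<lambda>t. \<integral>y. \<phi> y \<partial>\<mu> t) has_real_derivative (\<integral>y. generator \<phi> y \<partial>\<mu> t)) (at_right t)"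
    unfolding has_field_derivative_iff
    by (subst at_right_to_0) (simp add: filterlim_filtermap add.commute)
qed

end

text \<open>
  Two-dimensional distributions are enough: they identify the joint law of \<open>X s\<close> and \<open>X t\<close>, and
  its second marginal is the Chapman-Kolmogorov equation for the one-dimensional laws.
\<close>

lemma markov_jump_process_law:
  fixes X :: "real \<Rightarrow> 'w \<Rightarrow> 's"
  assumes mjp: "markov_jump_process M T S r X" and "countable S"
  obtains p \<mu> where "transition_function S p" "has_jump_rates S p r"
    "\<And>t. 0 \<le> t \<Longrightarrow> t \<le> T \<Longrightarrow> distr M (count_space UNIV) (X t) = measure_pmf (\<mu> t)"
    "\<And>t. 0 \<le> t \<Longrightarrow> t \<le> T \<Longrightarrow> set_pmf (\<mu> t) \<subseteq> S"
    "\<And>s t. 0 \<le> s \<Longrightarrow> s < t \<Longrightarrow> t \<le> T \<Longrightarrow> \<mu> t = bind_pmf (\<mu> s) (p (t - s))"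
proof -
  interpret prob_space M using mjp by (simp add: markov_jump_process_def)
  from mjp obtain p where p: "transition_function S p" "has_jump_rates S p r"
    and fdd: "\<And>n t x. 0 \<le> t 0 \<Longrightarrow> (\<forall>i\<le>n. t i < t (Suc i)) \<Longrightarrow> t (Suc n) \<le> T \<Longrightarrow>
           measure M {\<omega>\<in>space M. \<forall>i\<le>Suc n. X (t i) \<omega> = x i} =
           measure M {\<omega>\<in>space M. \<forall>i\<le>n. X (t i) \<omega> = x i} *
             pmf (p (t (Suc n) - t n) (x n)) (x (Suc n))"
    unfolding markov_jump_process_def by blast
  have X[measurable]: "X t \<in> M \<rightarrow>\<^sub>M count_space UNIV" if "0 \<le> t" "t \<le> T" for t
    using mjp that by (auto simp: markov_jump_process_def)
  have XS: "X t \<omega> \<in> S" if "0 \<le> t" "t \<le> T" "\<omega> \<in> space M" for t \<omega>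
    using mjp that by (auto simp: markov_jump_process_def)
  have "\<exists>\<mu>. distr M (count_space UNIV) (X t) = measure_pmf \<mu>" if "0 \<le> t" "t \<le> T" for t
    using countable_valued_law_pmf[OF prob_space_axioms X[OF that] XS[OF that] \<open>countable S\<close>] by metis
  then obtain \<mu> where \<mu>: "\<And>t. 0 \<le> t \<Longrightarrow> t \<le> T \<Longrightarrow> distr M (count_space UNIV) (X t) = measure_pmf (\<mu> t)"
    by metis
  have pmf\<mu>: "pmf (\<mu> t) x = measure M {\<omega>\<in>space M. X t \<omega> = x}" if "0 \<le> t" "t \<le> T" for t x
  proof -
    have "pmf (\<mu> t) x = measure (distr M (count_space UNIV) (X t)) {x}"
      by (simp add: \<mu>[OF that] measure_pmf_single)
    also have "\<dots> = measure M {\<omega>\<in>space M. X t \<omega> = x}"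
      using X[OF that] by (subst measure_distr) (auto intro!: arg_cong[of _ _ "measure M"])
    finally show ?thesis .
  qed
  have \<mu>S: "set_pmf (\<mu> t) \<subseteq> S" if "0 \<le> t" "t \<le> T" for t
  proof
    fix x assume "x \<in> set_pmf (\<mu> t)"
    then have "measure M {\<omega>\<in>space M. X t \<omega> = x} \<noteq> 0" by (simp add: pmf\<mu>[OF that, symmetric] set_pmf_iff)
    then have "{\<omega>\<in>space M. X t \<omega> = x} \<noteq> {}" by (metis measure_empty)
    then show "x \<in> S" using XS[OF that] by auto
  qed
  have \<mu>_bind: "\<mu> t = bind_pmf (\<mu> s) (p (t - s))" if st: "0 \<le> s" "s < t" "t \<le> T" for s t
  proof -
    have [measurable]: "X s \<in> M \<rightarrow>\<^sub>M count_space UNIV" "X t \<in> M \<rightarrow>\<^sub>M count_space UNIV"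
      using X st by auto
    have cS: "countable (S \<times> S)" using \<open>countable S\<close> by simp
    have meas: "(\<lambda>\<omega>. (X s \<omega>, X t \<omega>)) \<in> M \<rightarrow>\<^sub>M count_space UNIV"
    proof (rule measurable_compose[where N="count_space (S \<times> S)"])
      have "(\<lambda>\<omega>. (X s \<omega>, X t \<omega>)) -` {z} \<inter> space M \<in> sets M" for z
      proof -
        have "(\<lambda>\<omega>. (X s \<omega>, X t \<omega>)) -` {z} \<inter> space M = {\<omega>\<in>space M. X s \<omega> = fst z \<and> X t \<omega> = snd z}"
          by (cases z) auto
        also have "\<dots> \<in> sets M" by measurable
        finally show ?thesis .
      qed
      then show "(\<lambda>\<omega>. (X s \<omega>, X t \<omega>)) \<in> M \<rightarrow>\<^sub>M count_space (S \<times> S)"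
        using XS st by (auto simp: measurable_count_space_eq_countable[OF cS])
    qed auto
    have "(X s \<omega>, X t \<omega>) \<in> S \<times> S" if "\<omega> \<in> space M" for \<omega> using XS st that by auto
    from countable_valued_law_pmf[OF prob_space_axioms meas this cS]
    obtain \<nu> where \<nu>: "distr M (count_space UNIV) (\<lambda>\<omega>. (X s \<omega>, X t \<omega>)) = measure_pmf \<nu>" .
    have pmf\<nu>: "pmf \<nu> (x, y) = measure M {\<omega>\<in>space M. X s \<omega> = x \<and> X t \<omega> = y}" for x y
    proof -
      have "pmf \<nu> (x, y) = measure (distr M (count_space UNIV) (\<lambda>\<omega>. (X s \<omega>, X t \<omega>))) {(x, y)}"
        by (simp add: \<nu> measure_pmf_single)
      also have "\<dots> = measure M {\<omega>\<in>space M. X s \<omega> = x \<and> X t \<omega> = y}"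
        using meas by (subst measure_distr) (auto intro!: arg_cong[of _ _ "measure M"])
      finally show ?thesis .
    qed
    have "\<nu> = bind_pmf (\<mu> s) (\<lambda>x. map_pmf (Pair x) (p (t - s) x))"
    proof (rule pmf_eqI, clarify)
      fix x y :: 's
      have all1: "(\<forall>i\<le>Suc 0. P i) \<longleftrightarrow> P 0 \<and> P (Suc 0)" for P by (auto simp: le_Suc_eq)
      define tt where "tt = (\<lambda>i::nat. if i = 0 then s else t)"
      define xx where "xx = (\<lambda>i::nat. if i = 0 then x else y)"
      have tt: "tt 0 = s" "tt (Suc 0) = t" and xx: "xx 0 = x" "xx (Suc 0) = y"
        by (auto simp: tt_def xx_def)
      have "0 \<le> tt 0" "\<forall>i\<le>0. tt i < tt (Suc i)" "tt (Suc 0) \<le> T"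
        using st by (auto simp: tt)
      from fdd[of tt 0 xx, OF this] have "measure M {\<omega>\<in>space M. X s \<omega> = x \<and> X t \<omega> = y} =
          measure M {\<omega>\<in>space M. X s \<omega> = x} * pmf (p (t - s) x) y"
        by (simp only: all1 tt xx le_0_eq simp_thms)
      then show "pmf \<nu> (x, y) = pmf (bind_pmf (\<mu> s) (\<lambda>x. map_pmf (Pair x) (p (t - s) x))) (x, y)"
        using st by (simp add: pmf\<nu> pmf\<mu> pmf_bind_map_Pair)
    qed
    then have "map_pmf snd \<nu> = bind_pmf (\<mu> s) (p (t - s))"
      by (simp add: map_bind_pmf map_pmf_comp)
    moreover have "measure_pmf (map_pmf snd \<nu>) = measure_pmf (\<mu> t)"
      using meas st by (simp add: map_pmf_rep_eq \<nu>[symmetric] \<mu>[symmetric] distr_distr comp_def)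
    then have "map_pmf snd \<nu> = \<mu> t" by (simp only: measure_pmf_inject)
    ultimately show ?thesis by simp
  qed
  show ?thesis by (rule that[of p \<mu>]) (fact p \<mu> \<mu>S \<mu>_bind)+
qed

section \<open>The generator of the power-of-two-choices model\<close>

text \<open>
  The upper tail of the empirical measure. In these coordinates the model is nearest-neighbour:
  an arrival or a departure changes the tail at a single level \<open>k\<close>, by \<open>1/N\<close>.
\<close>

definition tail_fraction :: "nat \<Rightarrow> (nat \<Rightarrow> nat) \<Rightarrow> nat \<Rightarrow> real" where
  "tail_fraction N x k = (\<Sum>i<N. of_bool (k \<le> x i)) / real N"

lemma tail_fraction_nonneg: "0 \<le> tail_fraction N x k"
  by (simp add: tail_fraction_def sum_nonneg)

lemma tail_fraction_le_1: "tail_fraction N x k \<le> 1"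
proof -
  have "(\<Sum>i<N. of_bool (k \<le> x i)) \<le> (\<Sum>i<N. 1::real)" by (intro sum_mono) auto
  then show ?thesis by (auto simp: tail_fraction_def divide_le_eq)
qed

lemma tail_fraction_0: "N > 0 \<Longrightarrow> tail_fraction N x 0 = 1"
  by (simp add: tail_fraction_def)

lemma tail_fraction_diff_Suc: "tail_fraction N x k - tail_fraction N x (Suc k) = empirical N x k"
  unfolding tail_fraction_def empirical_def diff_divide_distrib[symmetric] sum_subtractf[symmetric]
  by (intro arg_cong2[of _ _ _ _ "(/)"] sum.cong) auto

lemma tail_fraction_arrival:
  assumes "i < N" "k > 0"
  shows "tail_fraction N (x(i := x i + 1)) k = tail_fraction N x k + of_bool (x i = k - 1) / real N"
proof -
  have "(\<Sum>j<N. of_bool (k \<le> (x(i := x i + 1)) j)) =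
      (\<Sum>j<N. of_bool (k \<le> x j) + (if j = i then of_bool (x i = k - 1) else 0 :: real))"
    by (intro sum.cong) (use assms in auto)
  also have "\<dots> = (\<Sum>j<N. of_bool (k \<le> x j)) + of_bool (x i = k - 1)"
    using assms by (simp add: sum.distrib)
  finally show ?thesis by (simp add: tail_fraction_def add_divide_distrib)
qed

lemma tail_fraction_departure:
  assumes "i < N" "k > 0" "0 < x i"
  shows "tail_fraction N (x(i := x i - 1)) k = tail_fraction N x k - of_bool (x i = k) / real N"
proof -
  have "(\<Sum>j<N. of_bool (k \<le> (x(i := x i - 1)) j)) =
      (\<Sum>j<N. of_bool (k \<le> x j) - (if j = i then of_bool (x i = k) else 0 :: real))"
    by (intro sum.cong) (use assms in auto)
  also have "\<dots> = (\<Sum>j<N. of_bool (k \<le> x j)) - of_bool (x i = k)"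
    using assms by (simp add: sum_subtractf)
  finally show ?thesis by (simp add: tail_fraction_def diff_divide_distrib)
qed

text \<open>
  The rule for breaking ties affects which queue is joined but not its length.
\<close>

lemma joined_queue_length:
  assumes "N > 0"
  shows "map_pmf x (joined_queue_pmf N x) =
         map_pmf (\<lambda>(a, b). min (x a) (x b)) (pmf_of_set ({..<N} \<times> {..<N}))"
proof -
  have *: "map_pmf x (pmf_of_set {i\<in>{a, b}. x i = min (x a) (x b)}) = return_pmf (min (x a) (x b))" for a b
  proof -
    let ?A = "{i\<in>{a, b}. x i = min (x a) (x b)}"
    have A: "finite ?A" "?A \<noteq> {}" by (auto simp: min_def)
    have "map_pmf x (pmf_of_set ?A) = map_pmf (\<lambda>_. min (x a) (x b)) (pmf_of_set ?A)"
      by (intro map_pmf_cong refl) (use A in auto)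
    then show ?thesis by (simp add: map_pmf_const)
  qed
  show ?thesis
    unfolding joined_queue_pmf_def map_bind_pmf map_pmf_def[of "\<lambda>(a, b). min (x a) (x b)"]
  proof (intro bind_pmf_cong refl)
    fix z
    show "map_pmf x (case z of (a, b) \<Rightarrow> pmf_of_set {i\<in>{a, b}. x i = min (x a) (x b)}) =
        return_pmf (case z of (a, b) \<Rightarrow> min (x a) (x b))"
      by (cases z) (simp only: prod.case *)
  qed
qed

lemma card_tail_fraction: "real (card {i. i < N \<and> k \<le> x i}) = real N * tail_fraction N x k"
proof -
  have "(\<Sum>i<N. of_bool (k \<le> x i) :: real) = real (card {i. i < N \<and> k \<le> x i})"
    by (simp add: of_bool_def sum.If_cases Int_def)
  then show ?thesis by (cases "N = 0") (auto simp: tail_fraction_def)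
qed

lemma set_joined_queue_pmf:
  assumes "N > 0"
  shows "set_pmf (joined_queue_pmf N x) \<subseteq> {..<N}"
proof -
  have "set_pmf (pmf_of_set {i\<in>{a, b}. x i = min (x a) (x b)}) \<subseteq> {a, b}" for a b
    by (subst set_pmf_of_set) (auto simp: min_def)
  then have "set_pmf (case z of (a, b) \<Rightarrow> pmf_of_set {i\<in>{a, b}. x i = min (x a) (x b)}) \<subseteq> {fst z, snd z}" for z
    by (cases z) (simp only: prod.case fst_conv snd_conv)
  moreover have "set_pmf (pmf_of_set ({..<N} \<times> {..<N})) = {..<N} \<times> {..<N}"
    using assms by (intro set_pmf_of_set) auto
  ultimately show ?thesis
    unfolding joined_queue_pmf_def set_bind_pmf by fastforce
qed

lemma sum_joined_queue_pmf:
  assumes "N > 0"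
  shows "(\<Sum>i<N. pmf (joined_queue_pmf N x) i) = 1"
  using set_joined_queue_pmf[OF assms] by (intro sum_pmf_eq_1) auto

text \<open>
  The shorter of two independently sampled queues has length at least \<open>l\<close> exactly if both have, which has
  probability \<open>(tail_fraction N x l)\<^sup>2\<close>.
\<close>

lemma joined_queue_has_length:
  assumes "N > 0"
  shows "(\<Sum>i<N. pmf (joined_queue_pmf N x) i * of_bool (x i = l)) = (tail_fraction N x l)\<^sup>2 - (tail_fraction N x (Suc l))\<^sup>2"
proof -
  let ?P = "pmf_of_set ({..<N} \<times> {..<N})"
  let ?C = "\<lambda>k. {i. i < N \<and> k \<le> x i}"
  have "(\<Sum>i<N. pmf (joined_queue_pmf N x) i * of_bool (x i = l)) = (\<integral>i. of_bool (x i = l) \<partial>joined_queue_pmf N x)"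
    using set_joined_queue_pmf[OF assms, of x]
    by (subst integral_measure_pmf_real[where A="{..<N}"]) (auto simp: mult.commute)
  also have "\<dots> = (\<integral>k. of_bool (k = l) \<partial>map_pmf x (joined_queue_pmf N x))" by simp
  also have "\<dots> = (\<integral>z. of_bool (min (x (fst z)) (x (snd z)) = l) \<partial>?P)"
    unfolding joined_queue_length[OF assms] by (simp add: case_prod_beta)
  also have "\<dots> = (\<Sum>z\<in>{..<N} \<times> {..<N}. of_bool (min (x (fst z)) (x (snd z)) = l)) / real (card ({..<N} \<times> {..<N}))"
    using assms by (subst integral_pmf_of_set) auto
  also have "(\<Sum>z\<in>{..<N} \<times> {..<N}. of_bool (min (x (fst z)) (x (snd z)) = l)) =
      (\<Sum>z\<in>{..<N} \<times> {..<N}. indicator (?C l \<times> ?C l) z - indicator (?C (Suc l) \<times> ?C (Suc l)) z :: real)"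
    by (intro sum.cong refl) (auto simp: indicator_def min_def)
  also have "\<dots> = real (card (?C l \<times> ?C l)) - real (card (?C (Suc l) \<times> ?C (Suc l)))"
  proof -
    have "(\<Sum>z\<in>{..<N} \<times> {..<N}. indicator (?C k \<times> ?C k) z :: real) = real (card (?C k \<times> ?C k))" for k
    proof -
      have "(\<Sum>z\<in>{..<N} \<times> {..<N}. indicator (?C k \<times> ?C k) z :: real) =
          real (card (({..<N} \<times> {..<N}) \<inter> (?C k \<times> ?C k)))"
        by (simp add: indicator_def of_bool_def sum.If_cases)
      also have "({..<N} \<times> {..<N}) \<inter> (?C k \<times> ?C k) = ?C k \<times> ?C k" by auto
      finally show ?thesis .
    qed
    then show ?thesis by (simp add: sum_subtractf)
  qed
  also have "\<dots> = (real N)\<^sup>2 * ((tail_fraction N x l)\<^sup>2 - (tail_fraction N x (Suc l))\<^sup>2)"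
    by (simp add: card_cartesian_product card_tail_fraction power2_eq_square algebra_simps)
  finally show ?thesis using assms by (simp add: power2_eq_square)
qed

lemma countable_queue_states: "countable (queue_states N)"
proof (rule countableI')
  show "inj_on (\<lambda>x. to_nat (map x [0..<N])) (queue_states N)"
  proof (rule inj_onI)
    fix x y :: "nat \<Rightarrow> nat"
    assume "x \<in> queue_states N" "y \<in> queue_states N" "to_nat (map x [0..<N]) = to_nat (map y [0..<N])"
    then have "i \<ge> N \<Longrightarrow> x i = y i" "i < N \<Longrightarrow> x i = y i" for i
      by (auto simp: queue_states_def)
    then show "x = y" by (metis ext linorder_not_less)
  qed
qed

definition jump_targets :: "nat \<Rightarrow> (nat \<Rightarrow> nat) \<Rightarrow> (nat \<Rightarrow> nat) set" where
  "jump_targets N x = (\<lambda>i. x(i := x i + 1)) ` {..<N} \<union> (\<lambda>i. x(i := x i - 1)) ` {i. i < N \<and> 0 < x i}"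

lemma finite_jump_targets: "finite (jump_targets N x)"
  by (simp add: jump_targets_def)

text \<open>
  The rate of a transition is a sum over the queues whose change produces it; exchanging the two
  sums turns a sum over target states into a sum over queues.
\<close>

lemma sum_two_choices_rate:
  "(\<Sum>y\<in>jump_targets N x. two_choices_rate N lam nu x y * c y) =
   (\<Sum>i<N. real N * lam * pmf (joined_queue_pmf N x) i * c (x(i := x i + 1)) +
           (if 0 < x i then nu * c (x(i := x i - 1)) else 0))"
proof -
  let ?F = "jump_targets N x"
  have "(\<Sum>y\<in>?F. two_choices_rate N lam nu x y * c y) =
     (\<Sum>i<N. \<Sum>y\<in>?F. (if y = x(i := x i + 1) then real N * lam * pmf (joined_queue_pmf N x) i * c y else 0) +
             (if y = x(i := x i - 1) then (if 0 < x i then nu * c y else 0) else 0))"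
    unfolding two_choices_rate_def sum_distrib_right
    by (subst sum.swap) (intro sum.cong refl, auto simp: distrib_right)
  also have "\<dots> = (\<Sum>i<N. real N * lam * pmf (joined_queue_pmf N x) i * c (x(i := x i + 1)) +
           (if 0 < x i then nu * c (x(i := x i - 1)) else 0))"
  proof (intro sum.cong refl)
    fix i assume "i \<in> {..<N}"
    then have "x(i := x i + 1) \<in> ?F" "0 < x i \<Longrightarrow> x(i := x i - 1) \<in> ?F"
      by (auto simp: jump_targets_def)
    then show "(\<Sum>y\<in>?F. (if y = x(i := x i + 1) then real N * lam * pmf (joined_queue_pmf N x) i * c y else 0) +
             (if y = x(i := x i - 1) then (if 0 < x i then nu * c y else 0) else 0)) =
         real N * lam * pmf (joined_queue_pmf N x) i * c (x(i := x i + 1)) +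
           (if 0 < x i then nu * c (x(i := x i - 1)) else 0)"
      using finite_jump_targets[of N x] by (auto simp: sum.distrib)
  qed
  finally show ?thesis .
qed

lemma two_choices_semigroup:
  assumes "N > 0" "0 \<le> lam" "0 \<le> nu"
    and "transition_function (queue_states N) p"
    and "has_jump_rates (queue_states N) p (two_choices_rate N lam nu)"
  shows "bounded_rate_jump_semigroup (queue_states N) p (two_choices_rate N lam nu) (jump_targets N)
           (real N * lam + real N * nu)"
proof
  fix x assume x: "x \<in> queue_states N"
  have ne: "x(i := v) \<noteq> x" if "v \<noteq> x i" for i v
    using that by (metis fun_upd_same)
  show "jump_targets N x \<subseteq> queue_states N - {x}"
    using x by (auto simp: jump_targets_def queue_states_def) (metis fun_upd_same n_not_Suc_n, metis fun_upd_same n_not_Suc_n One_nat_def Suc_pred)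
  show "two_choices_rate N lam nu x y = 0" if "y \<in> queue_states N - {x} - jump_targets N x" for y
    unfolding two_choices_rate_def using that by (intro sum.neutral ballI) (auto simp: jump_targets_def)
  have "(\<Sum>y\<in>jump_targets N x. two_choices_rate N lam nu x y) =
     (\<Sum>i<N. real N * lam * pmf (joined_queue_pmf N x) i + (if 0 < x i then nu else 0))"
    using sum_two_choices_rate[of N lam nu x "\<lambda>_. 1"] by (simp only: mult_1_right)
  also have "\<dots> \<le> (\<Sum>i<N. real N * lam * pmf (joined_queue_pmf N x) i + nu)"
    using assms by (intro sum_mono) auto
  also have "\<dots> = real N * lam + real N * nu"
    using sum_joined_queue_pmf[OF \<open>N > 0\<close>] by (simp add: sum.distrib sum_distrib_left[symmetric])
  finally show "(\<Sum>y\<in>jump_targets N x. two_choices_rate N lam nu x y) \<le> real N * lam + real N * nu" .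
qed (use assms finite_jump_targets in auto)

text \<open>
  Arrivals raise the tail at level \<open>k\<close> when the joined queue has length \<open>k - 1\<close>, departures from queues of
  length \<open>k\<close> lower it. That both rates are functions of the tails alone closes the equations.
\<close>

lemma two_choices_generator_tail_fraction:
  fixes g :: "real \<Rightarrow> real"
  assumes "N > 0" "k > 0"
  shows "(\<Sum>y\<in>jump_targets N x. two_choices_rate N lam nu x y * (g (tail_fraction N y k) - g (tail_fraction N x k))) =
    real N * lam * ((tail_fraction N x (k - 1))\<^sup>2 - (tail_fraction N x k)\<^sup>2) * (g (tail_fraction N x k + 1 / real N) - g (tail_fraction N x k)) +
    real N * nu * (tail_fraction N x k - tail_fraction N x (Suc k)) * (g (tail_fraction N x k - 1 / real N) - g (tail_fraction N x k))"
proof -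
  let ?J = "pmf (joined_queue_pmf N x)"
  let ?up = "g (tail_fraction N x k + 1 / real N) - g (tail_fraction N x k)"
  let ?dn = "g (tail_fraction N x k - 1 / real N) - g (tail_fraction N x k)"
  have "(\<Sum>y\<in>jump_targets N x. two_choices_rate N lam nu x y * (g (tail_fraction N y k) - g (tail_fraction N x k))) =
    (\<Sum>i<N. real N * lam * ?J i * (g (tail_fraction N (x(i := x i + 1)) k) - g (tail_fraction N x k)) +
           (if 0 < x i then nu * (g (tail_fraction N (x(i := x i - 1)) k) - g (tail_fraction N x k)) else 0))"
    by (rule sum_two_choices_rate)
  also have "\<dots> = (\<Sum>i<N. real N * lam * ?up * (?J i * of_bool (x i = k - 1)) + nu * ?dn * of_bool (x i = k))"
    using \<open>k > 0\<close> by (intro sum.cong refl) (auto simp: tail_fraction_arrival tail_fraction_departure simp del: One_nat_def)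
  also have "\<dots> = real N * lam * ?up * (\<Sum>i<N. ?J i * of_bool (x i = k - 1)) + nu * ?dn * (\<Sum>i<N. of_bool (x i = k))"
    by (simp only: sum.distrib sum_distrib_left)
  also have "(\<Sum>i<N. of_bool (x i = k)) = real N * (tail_fraction N x k - tail_fraction N x (Suc k))"
    using \<open>N > 0\<close> by (simp add: tail_fraction_diff_Suc empirical_def)
  finally show ?thesis
    using joined_queue_has_length[OF \<open>N > 0\<close>, of x "k - 1"] \<open>k > 0\<close> by (simp add: mult_ac)
qed

section \<open>Mean-square distance to the limit equation\<close>

text \<open>
  The weights \<open>2\<^sup>-\<^sup>k\<close> tolerate a shift of the index by one in either direction at the cost of a constant
  factor. The cut-off at \<open>K\<close> leaves a boundary term that vanishes as \<open>K\<close> grows.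
\<close>

lemma weighted_neighbour_sum_le:
  fixes g :: "nat \<Rightarrow> real"
  assumes "g 0 = 0" and nonneg: "\<And>k. 0 \<le> g k" and le1: "\<And>k. g k \<le> 1"
  shows "(\<Sum>k=1..K. (1/2)^k * (g (k - 1) + 3 * g k + g (k + 1))) \<le> 6 * (\<Sum>k=1..K. (1/2)^k * g k) + (1/2)^K"
proof -
  let ?f = "\<Sum>k=1..K. (1/2)^k * g k"
  have prev: "(\<Sum>k=1..K. (1/2)^k * g (k - 1)) + (1/2)^(K + 1) * g K = ?f / 2"
    using \<open>g 0 = 0\<close> by (induction K) (auto simp: field_simps)
  have nxt: "(\<Sum>k=1..K. (1/2)^k * g (k + 1)) = 2 * ?f - g 1 + (1/2)^K * g (K + 1)"
    by (induction K) (auto simp: field_simps)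
  have "(1/2)^K * g (K + 1) \<le> (1/2)^K * 1" by (intro mult_left_mono le1) auto
  moreover have "0 \<le> (1/2)^(K + 1) * g K" using nonneg by simp
  moreover have "0 \<le> ?f" using nonneg by (intro sum_nonneg) auto
  moreover have "(\<Sum>k=1..K. (1/2)^k * (g (k - 1) + 3 * g k + g (k + 1))) =
     (\<Sum>k=1..K. (1/2)^k * g (k - 1)) + 3 * ?f + (\<Sum>k=1..K. (1/2)^k * g (k + 1))"
    by (simp add: sum.distrib sum_distrib_left algebra_simps)
  ultimately show ?thesis using prev nxt nonneg[of 1] by linarith
qed

text \<open>
  The drift at level \<open>k\<close> as a function of the tails at levels \<open>k - 1\<close>, \<open>k\<close>, \<open>k + 1\<close>. Since tails lie in
  \<open>[0, 1]\<close>, \<open>x\<^sup>2 - y\<^sup>2 = (x + y) (x - y)\<close> makes it Lipschitz, and the products of differences are split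
  by \<open>2 a b \<le> a\<^sup>2 + b\<^sup>2\<close>.
\<close>

lemma drift_cross_term_le:
  fixes x0 x1 x2 y0 y1 y2 lam nu :: real
  assumes lam: "0 \<le> lam" and nu: "0 \<le> nu"
    and "x0 \<in> {0..1}" "x1 \<in> {0..1}" "x2 \<in> {0..1}" "y0 \<in> {0..1}" "y1 \<in> {0..1}" "y2 \<in> {0..1}"
  shows "2 * (x1 - y1) * ((lam * (x0\<^sup>2 - x1\<^sup>2) - nu * (x1 - x2)) - (lam * (y0\<^sup>2 - y1\<^sup>2) - nu * (y1 - y2)))
     \<le> (2 * lam + nu) * ((x0 - y0)\<^sup>2 + 3 * (x1 - y1)\<^sup>2 + (x2 - y2)\<^sup>2)"
proof -
  define d0 d1 d2 where "d0 = x0 - y0" and "d1 = x1 - y1" and "d2 = x2 - y2"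
  have young: "2 * d1 * (c * d) \<le> 2 * (d1\<^sup>2 + d\<^sup>2)" if "\<bar>c\<bar> \<le> 2" for c d
  proof -
    have "2 * d1 * (c * d) \<le> \<bar>c\<bar> * (2 * \<bar>d1\<bar> * \<bar>d\<bar>)"
      using abs_ge_self[of "2 * d1 * (c * d)"] by (simp add: abs_mult mult_ac)
    also have "\<dots> \<le> 2 * (2 * \<bar>d1\<bar> * \<bar>d\<bar>)" using that by (intro mult_right_mono) auto
    also have "\<dots> \<le> 2 * (d1\<^sup>2 + d\<^sup>2)" using sum_squares_bound[of "\<bar>d1\<bar>" "\<bar>d\<bar>"] by simp
    finally show ?thesis .
  qed
  have 1: "2 * d1 * ((x0\<^sup>2 - y0\<^sup>2) - (x1\<^sup>2 - y1\<^sup>2)) \<le> 2 * (d0\<^sup>2 + 3 * d1\<^sup>2)"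
  proof -
    have "2 * d1 * ((x0 + y0) * d0) \<le> 2 * (d1\<^sup>2 + d0\<^sup>2)" using assms by (intro young) auto
    moreover have "2 * d1 * ((- (x1 + y1)) * d1) \<le> 2 * (d1\<^sup>2 + d1\<^sup>2)" using assms by (intro young) auto
    moreover have "x0\<^sup>2 - y0\<^sup>2 = (x0 + y0) * d0" "x1\<^sup>2 - y1\<^sup>2 = (x1 + y1) * d1"
      by (simp_all add: d0_def d1_def power2_eq_square algebra_simps)
    ultimately show ?thesis by (simp add: algebra_simps)
  qed
  have 2: "2 * d1 * (d2 - d1) \<le> 3 * d1\<^sup>2 + d2\<^sup>2"
  proof -
    have "2 * d1 * (d2 - d1) = 2 * d1 * d2 - 2 * d1\<^sup>2" by (simp add: power2_eq_square algebra_simps)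
    then show ?thesis using sum_squares_bound[of d1 d2] zero_le_power2[of d1] by linarith
  qed
  have "2 * (x1 - y1) * ((lam * (x0\<^sup>2 - x1\<^sup>2) - nu * (x1 - x2)) - (lam * (y0\<^sup>2 - y1\<^sup>2) - nu * (y1 - y2)))
      = lam * (2 * d1 * ((x0\<^sup>2 - y0\<^sup>2) - (x1\<^sup>2 - y1\<^sup>2))) + nu * (2 * d1 * (d2 - d1))"
    by (simp add: d1_def d2_def algebra_simps)
  also have "\<dots> \<le> lam * (2 * (d0\<^sup>2 + 3 * d1\<^sup>2)) + nu * (3 * d1\<^sup>2 + d2\<^sup>2)"
    using assms by (intro add_mono mult_left_mono 1 2) auto
  also have "\<dots> \<le> lam * (2 * (d0\<^sup>2 + 3 * d1\<^sup>2 + d2\<^sup>2)) + nu * (d0\<^sup>2 + 3 * d1\<^sup>2 + d2\<^sup>2)"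
  proof -
    have "2 * (d0\<^sup>2 + 3 * d1\<^sup>2) \<le> 2 * (d0\<^sup>2 + 3 * d1\<^sup>2 + d2\<^sup>2)" by simp
    moreover have "3 * d1\<^sup>2 + d2\<^sup>2 \<le> d0\<^sup>2 + 3 * d1\<^sup>2 + d2\<^sup>2" by simp
    ultimately show ?thesis using lam nu by (meson add_mono mult_left_mono)
  qed
  finally show ?thesis by (simp add: d0_def d1_def d2_def algebra_simps)
qed

text \<open>
  The equation for \<open>a\<close> is the limit equation written for tails. The difference quotient of
  \<open>g k t = E (Q k - a t k)\<^sup>2\<close> produces the cross term of the drifts, estimated by \<open>drift_cross_term_le\<close>, and
  the variance created by the jumps, which is of order \<open>1/N\<close>. The resulting system of differential
  inequalities couples neighbouring levels; the finite weighted sums \<open>f K\<close> satisfy a scalar inequality up to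
  the boundary term, to which Gronwall's lemma applies, and finally \<open>K\<close> tends to infinity.
\<close>

lemma two_choices_mean_square:
  fixes a :: "real \<Rightarrow> nat \<Rightarrow> real"
  assumes proc: "two_choices_process M T N lam nu X" and N: "N > 0" and lam: "0 \<le> lam" and nu: "0 \<le> nu"
    and a01: "\<And>t k. 0 \<le> t \<Longrightarrow> t \<le> T \<Longrightarrow> a t k \<in> {0..1}" and a0: "\<And>t. 0 \<le> t \<Longrightarrow> t \<le> T \<Longrightarrow> a t 0 = 1"
    and ader: "\<And>t k. 0 \<le> t \<Longrightarrow> t \<le> T \<Longrightarrow> k > 0 \<Longrightarrow> ((\<lambda>s. a s k) has_real_derivative
        (lam * ((a t (k - 1))\<^sup>2 - (a t k)\<^sup>2) - nu * (a t k - a t (Suc k)))) (at t within {0..T})"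
    and init: "\<And>k. (\<integral>\<omega>. (tail_fraction N (X 0 \<omega>) k - a 0 k)\<^sup>2 \<partial>M) \<le> B"
    and t: "0 \<le> t" "t \<le> T" and "k > 0"
  shows "(\<integral>\<omega>. (tail_fraction N (X t \<omega>) k - a t k)\<^sup>2 \<partial>M)
           \<le> 2 ^ k * ((B + (2 * lam + nu) / real N * t) * exp (6 * (2 * lam + nu) * t))"
proof -
  define L where "L = 2 * lam + nu"
  have L: "0 \<le> L" using lam nu by (simp add: L_def)
  from proc have mjp: "markov_jump_process M T (queue_states N) (two_choices_rate N lam nu) X"
    by (simp add: two_choices_process_def)
  from markov_jump_process_law[OF mjp countable_queue_states] obtain p \<mu>
    where p: "transition_function (queue_states N) p" "has_jump_rates (queue_states N) p (two_choices_rate N lam nu)"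
      and law: "\<And>t. 0 \<le> t \<Longrightarrow> t \<le> T \<Longrightarrow> distr M (count_space UNIV) (X t) = measure_pmf (\<mu> t)"
      and supp: "\<And>t. 0 \<le> t \<Longrightarrow> t \<le> T \<Longrightarrow> set_pmf (\<mu> t) \<subseteq> queue_states N"
      and step: "\<And>s t. 0 \<le> s \<Longrightarrow> s < t \<Longrightarrow> t \<le> T \<Longrightarrow> \<mu> t = bind_pmf (\<mu> s) (p (t - s))"
    by blast
  interpret bounded_rate_jump_semigroup "queue_states N" p "two_choices_rate N lam nu" "jump_targets N"
      "real N * lam + real N * nu"
    by (rule two_choices_semigroup[OF N lam nu p])
  have meas: "X t \<in> M \<rightarrow>\<^sub>M count_space UNIV" if "0 \<le> t" "t \<le> T" for t
    using mjp that by (auto simp: markov_jump_process_def)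
  define Q where "Q = (\<lambda>k y. tail_fraction N y k)"
  have Q01: "Q k y \<in> {0..1}" for k y using tail_fraction_nonneg[of N y k] tail_fraction_le_1[of N y k] by (simp add: Q_def)
  have QB: "\<bar>Q k y\<bar> \<le> 1" and Q2B: "\<bar>(Q k y)\<^sup>2\<bar> \<le> 1" for k y
    using Q01[of k y] by (auto simp: power_le_one)
  have iQ [simp]: "integrable (measure_pmf \<nu>) (Q k)" "integrable (measure_pmf \<nu>) (\<lambda>y. (Q k y)\<^sup>2)" for \<nu> k
    by (rule integrable_bounded_pmf[OF QB], rule integrable_bounded_pmf[OF Q2B])
  \<comment> \<open>\<open>D k\<close> is the generator applied to \<open>Q k\<close>, the drift; \<open>S k\<close> is the squared jump size \<open>1/N\<^sup>2\<close> times the total rate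
    of jumps at level \<open>k\<close>.\<close>
  define D where "D = (\<lambda>k y. lam * ((Q (k - 1) y)\<^sup>2 - (Q k y)\<^sup>2) - nu * (Q k y - Q (Suc k) y))"
  define S where "S = (\<lambda>k y. (lam * ((Q (k - 1) y)\<^sup>2 - (Q k y)\<^sup>2) + nu * (Q k y - Q (Suc k) y)) / real N)"
  have iD [simp]: "integrable (measure_pmf \<nu>) (D k)" for \<nu> k by (simp add: D_def)
  have iS [simp]: "integrable (measure_pmf \<nu>) (S k)" for \<nu> k by (simp add: S_def)
  have QDB: "\<bar>Q k y * D k y\<bar> \<le> lam + nu" for k y
  proof -
    have diff: "\<bar>u - v\<bar> \<le> 1" if "u \<in> {0..1}" "v \<in> {0..1}" for u v :: real
      using that by (auto simp: abs_le_iff)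
    have "(Q j y)\<^sup>2 \<in> {0..1}" for j using Q2B[of j y] by simp
    then have "\<bar>(Q (k - 1) y)\<^sup>2 - (Q k y)\<^sup>2\<bar> \<le> 1" "\<bar>Q k y - Q (Suc k) y\<bar> \<le> 1"
      using Q01 by (auto intro!: diff)
    then have "\<bar>lam * ((Q (k - 1) y)\<^sup>2 - (Q k y)\<^sup>2)\<bar> \<le> lam * 1" "\<bar>nu * (Q k y - Q (Suc k) y)\<bar> \<le> nu * 1"
      unfolding abs_mult using lam nu by (auto simp: mult_left_le)
    then have "\<bar>D k y\<bar> \<le> lam + nu" unfolding D_def by linarith
    then have "\<bar>Q k y\<bar> * \<bar>D k y\<bar> \<le> 1 * (lam + nu)" using QB[of k y] by (intro mult_mono) auto
    then show ?thesis by (simp add: abs_mult)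
  qed
  have iQD [simp]: "integrable (measure_pmf \<nu>) (\<lambda>y. Q k y * D k y)" for \<nu> k
    by (rule integrable_bounded_pmf[OF QDB])
  have gen1: "generator (Q k) y = D k y" if "k > 0" for k y
    using two_choices_generator_tail_fraction[OF N that, of lam nu y "\<lambda>x. x"] N
    by (simp add: generator_def D_def Q_def)
  have gen2: "generator (\<lambda>y. (Q k y)\<^sup>2) y = 2 * (Q k y * D k y) + S k y" if "k > 0" for k y
  proof -
    have "generator (\<lambda>y. (Q k y)\<^sup>2) y =
      real N * lam * ((Q (k - 1) y)\<^sup>2 - (Q k y)\<^sup>2) * ((Q k y + 1 / real N)\<^sup>2 - (Q k y)\<^sup>2) +
      real N * nu * (Q k y - Q (Suc k) y) * ((Q k y - 1 / real N)\<^sup>2 - (Q k y)\<^sup>2)"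
      using two_choices_generator_tail_fraction[OF N that, of lam nu y "\<lambda>x. x\<^sup>2"] by (simp add: generator_def Q_def)
    also have "(Q k y + 1 / real N)\<^sup>2 - (Q k y)\<^sup>2 = (2 * Q k y + 1 / real N) / real N"
      using N by (simp add: power2_eq_square field_simps)
    also have "(Q k y - 1 / real N)\<^sup>2 - (Q k y)\<^sup>2 = - ((2 * Q k y - 1 / real N) / real N)"
      using N by (simp add: power2_eq_square field_simps)
    also have "real N * lam * ((Q (k - 1) y)\<^sup>2 - (Q k y)\<^sup>2) * ((2 * Q k y + 1 / real N) / real N) +
        real N * nu * (Q k y - Q (Suc k) y) * (- ((2 * Q k y - 1 / real N) / real N)) = 2 * (Q k y * D k y) + S k y"
      using N by (simp add: D_def S_def field_simps)
    finally show ?thesis .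
  qed
  define m1 m2 where "m1 = (\<lambda>k t. \<integral>y. Q k y \<partial>\<mu> t)" and "m2 = (\<lambda>k t. \<integral>y. (Q k y)\<^sup>2 \<partial>\<mu> t)"
  define g where "g = (\<lambda>k t. \<integral>y. (Q k y - a t k)\<^sup>2 \<partial>\<mu> t)"
  define g' where "g' = (\<lambda>k t. \<integral>y. 2 * (Q k y - a t k) * (D k y - (lam * ((a t (k - 1))\<^sup>2 - (a t k)\<^sup>2) - nu * (a t k - a t (Suc k)))) + S k y \<partial>\<mu> t)"
  have g_eq: "g k t = m2 k t - 2 * a t k * m1 k t + (a t k)\<^sup>2" for k t
  proof -
    have "g k t = (\<integral>y. (Q k y)\<^sup>2 - 2 * a t k * Q k y + (a t k)\<^sup>2 \<partial>\<mu> t)"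
      unfolding g_def by (intro Bochner_Integration.integral_cong refl) (simp add: power2_eq_square algebra_simps)
    then show ?thesis by (simp add: m1_def m2_def)
  qed
  have g_M: "(\<integral>\<omega>. (tail_fraction N (X t \<omega>) k - a t k)\<^sup>2 \<partial>M) = g k t" if "0 \<le> t" "t \<le> T" for k t
    unfolding g_def law[OF that, symmetric] Q_def using meas[OF that] by (subst integral_distr) auto
  have diff1: "\<bar>Q k y - a t k\<bar> \<le> 1" if "0 \<le> t" "t \<le> T" for k t y
    using Q01[of k y] a01[OF that, of k] by (auto simp: abs_le_iff)
  have diff2: "\<bar>(Q k y - a t k)\<^sup>2\<bar> \<le> 1" if "0 \<le> t" "t \<le> T" for k t y
    using diff1[OF that, of k y] by (simp add: abs_square_le_1)
  have idiff2: "integrable (measure_pmf \<nu>) (\<lambda>y. (Q k y - a t k)\<^sup>2)" if "0 \<le> t" "t \<le> T" for k t \<nu>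
    by (rule integrable_bounded_pmf[OF diff2[OF that]])
  have g_nonneg: "0 \<le> g k t" for k t unfolding g_def by (intro Bochner_Integration.integral_nonneg) auto
  have g_le1: "g k t \<le> 1" if "0 \<le> t" "t \<le> T" for k t
  proof -
    have "g k t \<le> (\<integral>y. 1 \<partial>\<mu> t)"
      unfolding g_def by (intro integral_mono idiff2[OF that]) (use diff2[OF that] in auto)
    then show ?thesis by simp
  qed
  have g_0: "g 0 t = 0" if "0 \<le> t" "t \<le> T" for t
    unfolding g_def Q_def by (simp add: a0[OF that] tail_fraction_0[OF N])
  have a_cont: "continuous_on {0..T} (\<lambda>s. a s k)" for k
  proof (cases "k = 0")
    case True
    have "continuous_on {0..T} (\<lambda>_. 1 :: real)" by (rule continuous_on_const)
    then show ?thesis by (rule continuous_on_eq) (simp add: True a0)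
  next
    case False
    then show ?thesis
      by (intro continuous_on_eq_continuous_within[THEN iffD2] ballI)
         (rule DERIV_continuous, rule ader, auto)
  qed
  have a_der: "((\<lambda>s. a s k) has_real_derivative
        (lam * ((a s (k - 1))\<^sup>2 - (a s k)\<^sup>2) - nu * (a s k - a s (Suc k)))) (at_right s)"
    if "0 \<le> s" "s < T" "k > 0" for s k
  proof -
    have "((\<lambda>s. a s k) has_real_derivative
        (lam * ((a s (k - 1))\<^sup>2 - (a s k)\<^sup>2) - nu * (a s k - a s (Suc k)))) (at s within {s<..<T})"
      by (rule DERIV_subset[OF ader]) (use that in auto)
    moreover have "at s within {s<..<T} = at_right s"
      using that by (intro at_within_nhd[of _ "{..<T}"]) auto
    ultimately show ?thesis by simp
  qed
  have m_cont: "continuous_on {0..T} (m1 k)" "continuous_on {0..T} (m2 k)" for k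
    unfolding m1_def m2_def
    by (rule expectation_continuous[OF step supp QB]; assumption)
       (rule expectation_continuous[OF step supp Q2B]; assumption)
  have m1_der: "(m1 k has_real_derivative (\<integral>y. D k y \<partial>\<mu> s)) (at_right s)" if "0 \<le> s" "s < T" "k > 0" for k s
  proof -
    have "generator (Q k) = D k" using gen1[OF that(3)] by auto
    then show ?thesis
      using expectation_right_derivative[where \<phi>="Q k", OF step supp QB that(1,2)] by (simp add: m1_def)
  qed
  have m2_der: "(m2 k has_real_derivative (\<integral>y. 2 * (Q k y * D k y) + S k y \<partial>\<mu> s)) (at_right s)" if "0 \<le> s" "s < T" "k > 0" for k s
  proof -
    have "generator (\<lambda>y. (Q k y)\<^sup>2) = (\<lambda>y. 2 * (Q k y * D k y) + S k y)" using gen2[OF that(3)] by auto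
    then show ?thesis
      using expectation_right_derivative[where \<phi>="\<lambda>y. (Q k y)\<^sup>2", OF step supp Q2B that(1,2)] by (simp only: m2_def)
  qed
  have g_cont: "continuous_on {0..T} (g k)" for k
    unfolding g_eq by (intro continuous_intros m_cont a_cont)
  have g_der: "(g k has_real_derivative g' k s) (at_right s)" if s: "0 \<le> s" "s < T" "k > 0" for k s
  proof -
    let ?a' = "lam * ((a s (k - 1))\<^sup>2 - (a s k)\<^sup>2) - nu * (a s k - a s (Suc k))"
    have "(g k has_real_derivative
       ((\<integral>y. 2 * (Q k y * D k y) + S k y \<partial>\<mu> s) - (2 * ?a' * m1 k s + 2 * a s k * (\<integral>y. D k y \<partial>\<mu> s)) + 2 * a s k * ?a')) (at_right s)"
      unfolding g_eq by (auto intro!: derivative_eq_intros m1_der m2_der a_der s)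
    also have "((\<integral>y. 2 * (Q k y * D k y) + S k y \<partial>\<mu> s) - (2 * ?a' * m1 k s + 2 * a s k * (\<integral>y. D k y \<partial>\<mu> s)) + 2 * a s k * ?a') =
       (\<integral>y. 2 * (Q k y * D k y) + S k y - (2 * ?a' * Q k y + 2 * a s k * D k y) + 2 * a s k * ?a' \<partial>\<mu> s)"
      by (simp add: m1_def)
    also have "\<dots> = g' k s"
      unfolding g'_def by (intro Bochner_Integration.integral_cong refl) (simp add: algebra_simps)
    finally show ?thesis .
  qed
  have g'_le: "g' k s \<le> L * (g (k - 1) s + 3 * g k s + g (k + 1) s) + L / real N"
    if s: "0 \<le> s" "s < T" "k > 0" for k s
  proof -
    have sT: "s \<le> T" using s by simp
    have "g' k s \<le> (\<integral>y. L * ((Q (k - 1) y - a s (k - 1))\<^sup>2 + 3 * (Q k y - a s k)\<^sup>2 + (Q (k + 1) y - a s (k + 1))\<^sup>2) + L / real N \<partial>\<mu> s)"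
      unfolding g'_def
    proof (intro integral_mono)
      let ?a' = "lam * ((a s (k - 1))\<^sup>2 - (a s k)\<^sup>2) - nu * (a s k - a s (Suc k))"
      have "integrable (\<mu> s) (\<lambda>y. 2 * (Q k y * D k y) + S k y - (2 * ?a' * Q k y + 2 * a s k * D k y) + 2 * a s k * ?a')"
        by simp
      then show "integrable (\<mu> s) (\<lambda>y. 2 * (Q k y - a s k) * (D k y - ?a') + S k y)"
        by (simp add: algebra_simps)
      show "integrable (\<mu> s) (\<lambda>y. L * ((Q (k - 1) y - a s (k - 1))\<^sup>2 + 3 * (Q k y - a s k)\<^sup>2 + (Q (k + 1) y - a s (k + 1))\<^sup>2) + L / real N)"
        using idiff2[OF s(1) sT] by simp
      fix y
      have "2 * (Q k y - a s k) * (D k y - ?a') \<le> L * ((Q (k - 1) y - a s (k - 1))\<^sup>2 + 3 * (Q k y - a s k)\<^sup>2 + (Q (k + 1) y - a s (k + 1))\<^sup>2)"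
        unfolding D_def L_def using drift_cross_term_le[OF lam nu Q01 Q01 Q01 a01 a01 a01, OF s(1) sT s(1) sT s(1) sT]
        by simp
      moreover have "S k y \<le> L / real N"
      proof -
        have "(Q (k - 1) y)\<^sup>2 - (Q k y)\<^sup>2 \<le> 1" "Q k y - Q (Suc k) y \<le> 1"
          using Q2B[of "k - 1" y] zero_le_power2[of "Q k y"] Q01[of k y] Q01[of "Suc k" y]
          unfolding atLeastAtMost_iff by linarith+
        then have "lam * ((Q (k - 1) y)\<^sup>2 - (Q k y)\<^sup>2) + nu * (Q k y - Q (Suc k) y) \<le> lam * 1 + nu * 1"
          using lam nu by (intro add_mono mult_left_mono) auto
        also have "\<dots> \<le> L" using lam by (simp add: L_def)
        finally show ?thesis by (simp add: S_def divide_right_mono)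
      qed
      ultimately show "2 * (Q k y - a s k) * (D k y - ?a') + S k y \<le>
         L * ((Q (k - 1) y - a s (k - 1))\<^sup>2 + 3 * (Q k y - a s k)\<^sup>2 + (Q (k + 1) y - a s (k + 1))\<^sup>2) + L / real N"
        by linarith
    qed
    also have "\<dots> = L * (g (k - 1) s + 3 * g k s + g (k + 1) s) + L / real N"
      using idiff2[OF s(1) sT] by (simp add: g_def)
    finally show ?thesis .
  qed
  \<comment> \<open>Level 0 is left out: both tails are 1 there, so \<open>g 0 = 0\<close>.\<close>
  define f where "f = (\<lambda>K t. \<Sum>k=1..K. (1/2)^k * g k t)"
  have geom: "(\<Sum>k=1..K. (1/2::real)^k) \<le> 1" for K
  proof -
    have "(\<Sum>k=1..K. (1/2::real)^k) = 1 - (1/2)^K" by (induction K) auto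
    then show ?thesis by simp
  qed
  have B: "0 \<le> B" using init[of 0] g_M[of 0 0] g_nonneg[of 0 0] t by simp
  have f_le: "f K t \<le> (B + (L / real N + L * (1/2)^K) * t) * exp (6 * L * t)" for K
  proof -
    have "f K t \<le> (f K 0 + (L / real N + L * (1/2)^K) * t) * exp (6 * L * t)"
    proof (rule gronwall_right_derivative[where f' = "\<lambda>s. \<Sum>k=1..K. (1/2)^k * g' k s"])
      show "continuous_on {0..t} (f K)"
        unfolding f_def by (intro continuous_intros continuous_on_subset[OF g_cont]) (use t in auto)
      fix s assume s: "0 \<le> s" "s < t"
      then have sT: "s < T" using t by simp
      show "(f K has_real_derivative (\<Sum>k=1..K. (1/2)^k * g' k s)) (at_right s)"
        unfolding f_def by (intro DERIV_sum DERIV_cmult g_der s sT) auto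
      have "(\<Sum>k=1..K. (1/2)^k * g' k s) \<le>
          (\<Sum>k=1..K. (1/2)^k * (L * (g (k - 1) s + 3 * g k s + g (k + 1) s) + L / real N))"
        by (intro sum_mono mult_left_mono g'_le s sT) auto
      also have "\<dots> = L * (\<Sum>k=1..K. (1/2)^k * (g (k - 1) s + 3 * g k s + g (k + 1) s)) + L / real N * (\<Sum>k=1..K. (1/2)^k)"
        by (simp add: sum.distrib sum_distrib_left algebra_simps)
      also have "\<dots> \<le> L * (6 * f K s + (1/2)^K) + L / real N * 1"
        unfolding f_def
        by (intro add_mono mult_left_mono weighted_neighbour_sum_le geom g_0 g_nonneg g_le1) (use L s sT in auto)
      finally show "(\<Sum>k=1..K. (1/2)^k * g' k s) \<le> 6 * L * f K s + (L / real N + L * (1/2)^K)"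
        by (simp add: algebra_simps)
    qed (use L t in auto)
    also have "\<dots> \<le> (B + (L / real N + L * (1/2)^K) * t) * exp (6 * L * t)"
    proof (intro mult_right_mono add_right_mono)
      have "f K 0 \<le> (\<Sum>k=1..K. (1/2)^k * B)"
        unfolding f_def using init g_M[of 0] t by (intro sum_mono mult_left_mono) auto
      also have "\<dots> = B * (\<Sum>k=1..K. (1/2)^k)" by (simp add: sum_distrib_left mult.commute)
      also have "\<dots> \<le> B * 1" by (intro mult_left_mono geom B)
      finally show "f K 0 \<le> B" by simp
    qed auto
    finally show ?thesis .
  qed
  have "(\<lambda>K. (B + (L / real N + L * (1/2)^K) * t) * exp (6 * L * t)) \<longlonglongrightarrow> (B + (L / real N + L * 0) * t) * exp (6 * L * t)"
    by (intro tendsto_intros LIMSEQ_power_zero) simp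
  moreover have "\<exists>n. \<forall>K\<ge>n. (1/2)^k * g k t \<le> (B + (L / real N + L * (1/2)^K) * t) * exp (6 * L * t)"
  proof (intro exI[of _ k] allI impI)
    fix K assume "k \<le> K"
    have "(1/2)^k * g k t \<le> f K t"
      unfolding f_def by (rule member_le_sum) (use \<open>k \<le> K\<close> \<open>k > 0\<close> g_nonneg in auto)
    then show "(1/2)^k * g k t \<le> (B + (L / real N + L * (1/2)^K) * t) * exp (6 * L * t)"
      using f_le[of K] by linarith
  qed
  ultimately have "(1/2)^k * g k t \<le> (B + (L / real N + L * 0) * t) * exp (6 * L * t)"
    by (rule LIMSEQ_le_const)
  then have "2 ^ k * ((1/2)^k * g k t) \<le> 2 ^ k * ((B + L / real N * t) * exp (6 * L * t))"
    by (intro mult_left_mono) auto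
  moreover have "2 ^ k * ((1/2)^k * g k t) = g k t" by (simp add: power_divide)
  ultimately show ?thesis using g_M[OF t] by (simp add: L_def)
qed

section \<open>Bounds on the summable norm\<close>

text \<open>
  A bound on the summable norm, stated through partial sums: this contains summability and is stable under
  limits, sums and integrals without side conditions.
\<close>

definition l1_le :: "(nat \<Rightarrow> real) \<Rightarrow> real \<Rightarrow> bool" where
  "l1_le z c \<longleftrightarrow> (\<forall>n. (\<Sum>j<n. \<bar>z j\<bar>) \<le> c)"

lemma l1_leI: "(\<And>n. (\<Sum>j<n. \<bar>z j\<bar>) \<le> c) \<Longrightarrow> l1_le z c"
  by (simp add: l1_le_def)

lemma l1_leD: "l1_le z c \<Longrightarrow> (\<Sum>j<n. \<bar>z j\<bar>) \<le> c"
  by (simp add: l1_le_def)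

lemma l1_le_nonneg: "l1_le z c \<Longrightarrow> 0 \<le> c"
  using l1_leD[of z c 0] by simp

lemma l1_le_mono: "l1_le z c \<Longrightarrow> c \<le> d \<Longrightarrow> l1_le z d"
  unfolding l1_le_def by (meson order_trans)

lemma l1_le_dominated: "l1_le z c \<Longrightarrow> (\<And>j. \<bar>w j\<bar> \<le> \<bar>z j\<bar>) \<Longrightarrow> l1_le w c"
  unfolding l1_le_def by (meson order_trans sum_mono)

lemma l1_le_add: "l1_le z c \<Longrightarrow> l1_le w d \<Longrightarrow> l1_le (\<lambda>j. z j + w j) (c + d)"
proof (rule l1_leI)
  fix n assume "l1_le z c" "l1_le w d"
  have "(\<Sum>j<n. \<bar>z j + w j\<bar>) \<le> (\<Sum>j<n. \<bar>z j\<bar> + \<bar>w j\<bar>)" by (intro sum_mono) auto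
  also have "\<dots> \<le> c + d"
    using l1_leD[OF \<open>l1_le z c\<close>, of n] l1_leD[OF \<open>l1_le w d\<close>, of n] by (simp add: sum.distrib)
  finally show "(\<Sum>j<n. \<bar>z j + w j\<bar>) \<le> c + d" .
qed

lemma l1_le_minus: "l1_le z c \<Longrightarrow> l1_le (\<lambda>j. - z j) c"
  by (simp add: l1_le_def)

lemma l1_le_diff: "l1_le z c \<Longrightarrow> l1_le w d \<Longrightarrow> l1_le (\<lambda>j. z j - w j) (c + d)"
  using l1_le_add[OF _ l1_le_minus] by fastforce

lemma l1_le_cmult: "l1_le z c \<Longrightarrow> l1_le (\<lambda>j. a * z j) (\<bar>a\<bar> * c)"
  by (auto simp: l1_le_def abs_mult sum_distrib_left[symmetric] intro: mult_left_mono)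

lemma l1_le_sum: "(\<And>k. k \<in> A \<Longrightarrow> l1_le (z k) (c k)) \<Longrightarrow> l1_le (\<lambda>j. \<Sum>k\<in>A. z k j) (\<Sum>k\<in>A. c k)"
proof (induction A rule: infinite_finite_induct)
  case (insert a A)
  then show ?case using l1_le_add[of "z a" "c a"] by simp
qed (auto simp: l1_le_def)

lemma l1_le_Suc: "l1_le z c \<Longrightarrow> l1_le (\<lambda>j. z (Suc j)) c"
proof (rule l1_leI)
  fix n assume "l1_le z c"
  have "(\<Sum>j<n. \<bar>z (Suc j)\<bar>) \<le> (\<Sum>j<Suc n. \<bar>z j\<bar>)"
    unfolding sum.lessThan_Suc_shift by simp
  also have "\<dots> \<le> c" by (rule l1_leD[OF \<open>l1_le z c\<close>])
  finally show "(\<Sum>j<n. \<bar>z (Suc j)\<bar>) \<le> c" .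
qed

lemma l1_le_pred_term: "l1_le z c \<Longrightarrow> l1_le (pred_term z) c"
proof (rule l1_leI)
  fix n assume z: "l1_le z c"
  show "(\<Sum>j<n. \<bar>pred_term z j\<bar>) \<le> c"
  proof (cases n)
    case 0
    then show ?thesis using l1_le_nonneg[OF z] by simp
  next
    case (Suc m)
    then show ?thesis using l1_leD[OF z, of m] by (simp add: sum.lessThan_Suc_shift pred_term_def del: sum.lessThan_Suc)
  qed
qed

lemma l1_le_abs: "l1_le z c \<Longrightarrow> \<bar>z j\<bar> \<le> c"
proof -
  assume z: "l1_le z c"
  have "\<bar>z j\<bar> \<le> (\<Sum>i<Suc j. \<bar>z i\<bar>)" by (intro member_le_sum) auto
  then show ?thesis using l1_leD[OF z, of "Suc j"] by linarith
qed

lemma l1_le_signed_sum: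
  assumes "l1_le z c" "\<And>j. \<bar>\<sigma> j\<bar> \<le> 1"
  shows "\<bar>\<Sum>j<n. \<sigma> j * z j\<bar> \<le> c"
proof -
  have "\<bar>\<Sum>j<n. \<sigma> j * z j\<bar> \<le> (\<Sum>j<n. \<bar>\<sigma> j * z j\<bar>)" by (rule sum_abs)
  also have "\<dots> \<le> (\<Sum>j<n. \<bar>z j\<bar>)"
    using assms(2) by (intro sum_mono) (simp add: abs_mult mult_left_le_one_le)
  finally show ?thesis using l1_leD[OF assms(1), of n] by linarith
qed

text \<open>
  The norm as a supremum of linear functionals. It reduces bounds on derivatives, integrals and Riemann
  sums of sequence-valued functions to the real-valued case.
\<close>

lemma l1_le_of_signed_sums:
  assumes "\<And>n \<sigma>. (\<And>j. \<bar>\<sigma> j\<bar> \<le> 1) \<Longrightarrow> (\<Sum>j<n. \<sigma> j * z j) \<le> c"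
  shows "l1_le z c"
proof (rule l1_leI)
  fix n
  have "(\<Sum>j<n. sgn (z j) * z j) \<le> c" by (rule assms) (simp add: abs_sgn_eq)
  then show "(\<Sum>j<n. \<bar>z j\<bar>) \<le> c" by (simp add: abs_sgn mult.commute)
qed

lemma l1_le_summable: "l1_le z c \<Longrightarrow> summable (\<lambda>j. \<bar>z j\<bar>)"
  by (rule bounded_imp_summable[of _ c])
     (auto simp: l1_leD lessThan_Suc_atMost[symmetric] simp del: sum.lessThan_Suc)

lemma l1_le_suminf: "l1_le z c \<Longrightarrow> (\<Sum>j. \<bar>z j\<bar>) \<le> c"
  by (rule suminf_le_const[OF l1_le_summable]) (auto simp: l1_le_def)

lemma l1_le_summable_mult:
  assumes "l1_le x B" "l1_le y C"
  shows "summable (\<lambda>j. x j * y j)"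
proof -
  have "l1_le (\<lambda>j. x j * y j) (\<bar>C\<bar> * B)"
    by (rule l1_le_dominated[OF l1_le_cmult[OF assms(1)]])
       (use l1_le_abs[OF assms(2)] l1_le_nonneg[OF assms(2)] in \<open>auto simp: abs_mult mult.commute[of C] intro!: mult_left_mono\<close>)
  then show ?thesis by (rule summable_rabs_cancel[OF l1_le_summable])
qed

text \<open>
  Continuity of the inner product, from \<open>x y - x' y' = x (y - y') + y' (x - x')\<close>.
\<close>

lemma l1_le_inner_diff:
  assumes x: "l1_le x B" and y: "l1_le y B" and x': "l1_le x' B" and y': "l1_le y' B"
    and dx: "l1_le (\<lambda>j. x j - x' j) e" and dy: "l1_le (\<lambda>j. y j - y' j) e"
  shows "\<bar>(\<Sum>j. x j * y j) - (\<Sum>j. x' j * y' j)\<bar> \<le> 2 * B * e"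
proof -
  note B = l1_le_nonneg[OF x]
  have "l1_le (\<lambda>j. B * \<bar>y j - y' j\<bar> + B * \<bar>x j - x' j\<bar>) (\<bar>B\<bar> * e + \<bar>B\<bar> * e)"
    by (intro l1_le_add l1_le_cmult l1_le_dominated[OF dx] l1_le_dominated[OF dy]) auto
  then have z: "l1_le (\<lambda>j. x j * y j - x' j * y' j) (\<bar>B\<bar> * e + \<bar>B\<bar> * e)"
  proof (rule l1_le_dominated)
    fix j
    have "x j * y j - x' j * y' j = x j * (y j - y' j) + y' j * (x j - x' j)" by (simp add: algebra_simps)
    then have "\<bar>x j * y j - x' j * y' j\<bar> \<le> \<bar>x j\<bar> * \<bar>y j - y' j\<bar> + \<bar>y' j\<bar> * \<bar>x j - x' j\<bar>"
      by (metis abs_mult abs_triangle_ineq)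
    also have "\<dots> \<le> B * \<bar>y j - y' j\<bar> + B * \<bar>x j - x' j\<bar>"
      by (intro add_mono mult_right_mono l1_le_abs[OF x] l1_le_abs[OF y']) auto
    finally show "\<bar>x j * y j - x' j * y' j\<bar> \<le> \<bar>B * \<bar>y j - y' j\<bar> + B * \<bar>x j - x' j\<bar>\<bar>" by linarith
  qed
  have "(\<Sum>j. x j * y j) - (\<Sum>j. x' j * y' j) = (\<Sum>j. x j * y j - x' j * y' j)"
    by (intro suminf_diff l1_le_summable_mult[OF x y] l1_le_summable_mult[OF x' y'])
  also have "\<bar>\<dots>\<bar> \<le> (\<Sum>j. \<bar>x j * y j - x' j * y' j\<bar>)" by (rule summable_rabs[OF l1_le_summable[OF z]])
  also have "\<dots> \<le> \<bar>B\<bar> * e + \<bar>B\<bar> * e" by (rule l1_le_suminf[OF z])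
  finally show ?thesis using B by simp
qed

section \<open>Tails of probability sequences and the drift\<close>

text \<open>
  For a probability sequence this is \<open>\<Sum>i. x (k + i)\<close>. Defined by a finite sum, it can be differentiated
  term by term.
\<close>

definition tail :: "(nat \<Rightarrow> real) \<Rightarrow> nat \<Rightarrow> real" where
  "tail x k = 1 - (\<Sum>j<k. x j)"

lemma tail_0 [simp]: "tail x 0 = 1"
  by (simp add: tail_def)

lemma tail_Suc: "tail x (Suc k) = tail x k - x k"
  by (simp add: tail_def)

lemma prob_seqs_nonneg: "x \<in> prob_seqs \<Longrightarrow> 0 \<le> x j"
  by (simp add: prob_seqs_def)

lemma prob_seqs_tail_sums: "x \<in> prob_seqs \<Longrightarrow> (\<lambda>i. x (i + k)) sums tail x k"
  using sums_split_initial_segment[of x 1 k] by (simp add: prob_seqs_def tail_def)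

lemma tail_nonneg: "x \<in> prob_seqs \<Longrightarrow> 0 \<le> tail x k"
  using sums_le[OF _ sums_zero prob_seqs_tail_sums, of x k] prob_seqs_nonneg by auto

lemma tail_antimono: "x \<in> prob_seqs \<Longrightarrow> k \<le> l \<Longrightarrow> tail x l \<le> tail x k"
  unfolding tail_def using prob_seqs_nonneg by (intro diff_left_mono sum_mono2) auto

lemma tail_le_1: "x \<in> prob_seqs \<Longrightarrow> tail x k \<le> 1"
  using tail_antimono[of x 0 k] by simp

lemma tail_tendsto_0: "x \<in> prob_seqs \<Longrightarrow> tail x \<longlonglongrightarrow> 0"
proof -
  assume "x \<in> prob_seqs"
  then have "(\<lambda>k. \<Sum>j<k. x j) \<longlonglongrightarrow> 1" by (simp add: prob_seqs_def sums_def)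
  then have "(\<lambda>k. 1 - (\<Sum>j<k. x j)) \<longlonglongrightarrow> 1 - 1" by (intro tendsto_intros)
  then show ?thesis by (simp add: tail_def[abs_def])
qed

lemma prob_seqs_l1_le: "x \<in> prob_seqs \<Longrightarrow> l1_le x 1"
  using tail_nonneg[of x] prob_seqs_nonneg[of x] by (auto simp: l1_le_def tail_def)

lemma tail_diff_le: "l1_le (\<lambda>j. x j - y j) d \<Longrightarrow> \<bar>tail x k - tail y k\<bar> \<le> d"
proof -
  assume d: "l1_le (\<lambda>j. x j - y j) d"
  have "tail x k - tail y k = - (\<Sum>j<k. x j - y j)" by (simp add: tail_def sum_subtractf)
  then have "\<bar>tail x k - tail y k\<bar> \<le> (\<Sum>j<k. \<bar>x j - y j\<bar>)" using sum_abs[of "\<lambda>j. x j - y j" "{..<k}"] by simp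
  then show ?thesis using l1_leD[OF d, of k] by linarith
qed

lemma l1_le_l1_dist:
  assumes "x \<in> prob_seqs" "y \<in> prob_seqs"
  shows "l1_le (\<lambda>j. x j - y j) (l1_dist x y)"
proof (rule l1_leI)
  have "summable (\<lambda>j. \<bar>x j - y j\<bar>)"
    by (rule l1_le_summable[OF l1_le_diff[OF prob_seqs_l1_le prob_seqs_l1_le]]) (use assms in auto)
  then show "(\<Sum>j<n. \<bar>x j - y j\<bar>) \<le> l1_dist x y" for n
    unfolding l1_dist_def by (rule sum_le_suminf) auto
qed

lemma l1_dist_le_2: "x \<in> prob_seqs \<Longrightarrow> y \<in> prob_seqs \<Longrightarrow> l1_dist x y \<le> 2"
  unfolding l1_dist_def using l1_le_suminf[OF l1_le_diff[OF prob_seqs_l1_le prob_seqs_l1_le], of x y] by simp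

text \<open>
  The quantitative form of Scheffe's lemma: closeness of finitely many coordinates to those of \<open>y\<close> already
  controls the tail of \<open>x\<close>, because both have total mass 1.
\<close>

lemma l1_dist_le_head_tail:
  assumes x: "x \<in> prob_seqs" and y: "y \<in> prob_seqs"
  shows "l1_dist x y \<le> 2 * (\<Sum>j<J. \<bar>x j - y j\<bar>) + 2 * tail y J"
proof -
  let ?H = "\<Sum>j<J. \<bar>x j - y j\<bar>"
  have "l1_le (\<lambda>j. x j - y j) (2 * ?H + 2 * tail y J)"
  proof (rule l1_leI)
    fix n
    have "(\<Sum>j<n. \<bar>x j - y j\<bar>) \<le> (\<Sum>j<max n J. \<bar>x j - y j\<bar>)" by (intro sum_mono2) auto
    also have "\<dots> = ?H + (\<Sum>j\<in>{J..<max n J}. \<bar>x j - y j\<bar>)"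
      by (subst sum.atLeastLessThan_concat[of 0 J "max n J", symmetric, simplified atLeast0LessThan]) auto
    also have "(\<Sum>j\<in>{J..<max n J}. \<bar>x j - y j\<bar>) \<le> (\<Sum>j\<in>{J..<max n J}. x j + y j)"
      using prob_seqs_nonneg[OF x] prob_seqs_nonneg[OF y] by (intro sum_mono) (simp add: abs_le_iff)
    also have "\<dots> = (tail x J - tail x (max n J)) + (tail y J - tail y (max n J))"
      unfolding tail_def sum.distrib
      using sum.atLeastLessThan_concat[of 0 J "max n J" x] sum.atLeastLessThan_concat[of 0 J "max n J" y]
      by (simp add: atLeast0LessThan)
    also have "\<dots> \<le> tail x J + tail y J" using tail_nonneg[OF x, of "max n J"] tail_nonneg[OF y, of "max n J"] by linarith
    also have "tail x J \<le> tail y J + ?H"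
    proof -
      have "tail x J - tail y J = - (\<Sum>j<J. x j - y j)" by (simp add: tail_def sum_subtractf)
      also have "\<dots> \<le> ?H" using sum_abs[of "\<lambda>j. x j - y j" "{..<J}"] by linarith
      finally show ?thesis by simp
    qed
    finally show "(\<Sum>j<n. \<bar>x j - y j\<bar>) \<le> 2 * ?H + 2 * tail y J" by simp
  qed
  then show ?thesis unfolding l1_dist_def by (rule l1_le_suminf)
qed

text \<open>
  The flow of mass from \<open>j\<close> to \<open>j + 1\<close> caused by arrivals, at unit arrival rate; it is the
  probability that the shorter of two sampled queues has length \<open>j\<close>.
\<close>

definition arrival_flux :: "(nat \<Rightarrow> real) \<Rightarrow> nat \<Rightarrow> real" where
  "arrival_flux x j = x j * (tail x j + tail x (Suc j))"

lemma arrival_flux_eq: "arrival_flux x j = (tail x j)\<^sup>2 - (tail x (Suc j))\<^sup>2"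
  by (simp add: arrival_flux_def tail_Suc power2_eq_square algebra_simps)

lemma U_eq_flux:
  assumes "x \<in> prob_seqs"
  shows "U x j = pred_term (arrival_flux x) j - arrival_flux x j"
proof -
  have s: "(\<Sum>i. x (k + i)) = tail x k" for k
    using prob_seqs_tail_sums[OF assms, of k] by (simp add: sums_iff add.commute)
  show ?thesis
    unfolding U_def s by (cases j) (simp_all add: pred_term_def arrival_flux_def tail_Suc power2_eq_square algebra_simps)
qed

lemma sum_U: "x \<in> prob_seqs \<Longrightarrow> (\<Sum>j<Suc k. U x j) = - arrival_flux x k"
  by (induction k) (simp_all add: U_eq_flux pred_term_def)

lemma sum_V: "(\<Sum>j<Suc k. V idle x j) = x (Suc k) - (if idle then 0 else x 0)"
  by (induction k) (auto simp: V_def)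

lemma l1_le_arrival_flux: "x \<in> prob_seqs \<Longrightarrow> l1_le (arrival_flux x) 2"
proof -
  assume x: "x \<in> prob_seqs"
  have "\<bar>arrival_flux x j\<bar> \<le> \<bar>2 * x j\<bar>" for j
    using tail_nonneg[OF x, of j] tail_nonneg[OF x, of "Suc j"] tail_le_1[OF x, of j] tail_le_1[OF x, of "Suc j"] prob_seqs_nonneg[OF x, of j]
    by (simp add: arrival_flux_def abs_mult mult_left_mono mult.commute)
  then show ?thesis using l1_le_dominated[OF l1_le_cmult[OF prob_seqs_l1_le[OF x], of 2]] by simp
qed

lemma l1_le_U: "x \<in> prob_seqs \<Longrightarrow> l1_le (U x) 4"
proof -
  assume x: "x \<in> prob_seqs"
  have "U x = (\<lambda>j. pred_term (arrival_flux x) j - arrival_flux x j)" using x by (auto simp: U_eq_flux)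
  then show ?thesis
    using l1_le_diff[OF l1_le_pred_term[OF l1_le_arrival_flux[OF x]] l1_le_arrival_flux[OF x]] by simp
qed

lemma l1_le_V: "x \<in> prob_seqs \<Longrightarrow> l1_le (V idle x) 2"
proof -
  assume x: "x \<in> prob_seqs"
  have "l1_le (\<lambda>j. if idle \<and> j = 0 then 0 else x j) 1"
    by (rule l1_le_dominated[OF prob_seqs_l1_le[OF x]]) auto
  from l1_le_diff[OF l1_le_Suc[OF prob_seqs_l1_le[OF x]] this] show ?thesis
    by (simp add: V_def[abs_def])
qed

text \<open>
  The difference of the tails need not be summable over \<open>j\<close>, but it comes multiplied by \<open>y j\<close>.
\<close>

lemma l1_le_arrival_flux_diff:
  assumes x: "x \<in> prob_seqs" and y: "y \<in> prob_seqs" and d: "l1_le (\<lambda>j. x j - y j) d"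
  shows "l1_le (\<lambda>j. arrival_flux x j - arrival_flux y j) (4 * d)"
proof -
  have "l1_le (\<lambda>j. 2 * \<bar>x j - y j\<bar> + 2 * d * y j) (\<bar>2\<bar> * d + \<bar>2 * d\<bar> * 1)"
    by (intro l1_le_add l1_le_cmult prob_seqs_l1_le y l1_le_dominated[OF d]) auto
  then have "l1_le (\<lambda>j. 2 * \<bar>x j - y j\<bar> + 2 * d * y j) (4 * d)"
    using l1_le_nonneg[OF d] by simp
  then show ?thesis
  proof (rule l1_le_dominated)
    fix j
    let ?sx = "tail x j + tail x (Suc j)" and ?sy = "tail y j + tail y (Suc j)"
    have "arrival_flux x j - arrival_flux y j = (x j - y j) * ?sx + y j * (?sx - ?sy)"
      by (simp add: arrival_flux_def algebra_simps)
    then have "\<bar>arrival_flux x j - arrival_flux y j\<bar> \<le> \<bar>(x j - y j) * ?sx\<bar> + \<bar>y j * (?sx - ?sy)\<bar>"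
      by linarith
    also have "\<bar>(x j - y j) * ?sx\<bar> \<le> \<bar>x j - y j\<bar> * 2"
      unfolding abs_mult
      using tail_nonneg[OF x, of j] tail_nonneg[OF x, of "Suc j"] tail_le_1[OF x, of j] tail_le_1[OF x, of "Suc j"]
      by (intro mult_left_mono) auto
    also have "\<bar>y j * (?sx - ?sy)\<bar> \<le> y j * (2 * d)"
      unfolding abs_mult using tail_diff_le[OF d, of j] tail_diff_le[OF d, of "Suc j"] prob_seqs_nonneg[OF y, of j]
      by (simp add: mult_left_mono)
    finally show "\<bar>arrival_flux x j - arrival_flux y j\<bar> \<le> \<bar>2 * \<bar>x j - y j\<bar> + 2 * d * y j\<bar>"
      using l1_le_nonneg[OF d] prob_seqs_nonneg[OF y, of j] by (simp add: mult_ac)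
  qed
qed

lemma l1_le_U_diff:
  assumes x: "x \<in> prob_seqs" and y: "y \<in> prob_seqs" and d: "l1_le (\<lambda>j. x j - y j) d"
  shows "l1_le (\<lambda>j. U x j - U y j) (8 * d)"
proof -
  note W = l1_le_arrival_flux_diff[OF assms]
  have "(\<lambda>j. U x j - U y j) = (\<lambda>j. pred_term (\<lambda>j. arrival_flux x j - arrival_flux y j) j - (arrival_flux x j - arrival_flux y j))"
    using x y by (auto simp: U_eq_flux pred_term_def)
  then show ?thesis using l1_le_diff[OF l1_le_pred_term[OF W] W] by simp
qed

lemma l1_le_V_diff:
  assumes d: "l1_le (\<lambda>j. x j - y j) d"
  shows "l1_le (\<lambda>j. V idle x j - V idle y j) (2 * d)"
proof -
  have "l1_le (\<lambda>j. if idle \<and> j = 0 then 0 else x j - y j) d"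
    by (rule l1_le_dominated[OF d]) auto
  from l1_le_diff[OF l1_le_Suc[OF d] this]
  have "l1_le (\<lambda>j. x (Suc j) - y (Suc j) - (if idle \<and> j = 0 then 0 else x j - y j)) (2 * d)" by simp
  then show ?thesis by (rule l1_le_dominated) (auto simp: V_def)
qed

section \<open>Riemann sums of Lipschitz functions\<close>

text \<open>
  On each subinterval the antiderivative minus the linear function with slope \<open>\<phi>\<close> at the right end point has a
  derivative of size at most \<open>C T / m\<close>.
\<close>

lemma riemann_sum_error:
  fixes \<phi> :: "real \<Rightarrow> real"
  assumes T: "0 \<le> T" and m: "m > 0" and "0 \<le> C"
    and lip: "\<And>s t. 0 \<le> s \<Longrightarrow> s \<le> T \<Longrightarrow> 0 \<le> t \<Longrightarrow> t \<le> T \<Longrightarrow> \<bar>\<phi> s - \<phi> t\<bar> \<le> C * \<bar>s - t\<bar>"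
  shows "\<bar>T / real m * (\<Sum>k=1..m. \<phi> (real k * T / real m)) - integral {0..T} \<phi>\<bar> \<le> C * T\<^sup>2 / real m"
proof -
  have "C-lipschitz_on {0..T} \<phi>"
    by (rule lipschitz_onI) (use lip \<open>0 \<le> C\<close> in \<open>auto simp: dist_real_def\<close>)
  then have cont: "continuous_on {0..T} \<phi>" by (rule lipschitz_on_continuous_on)
  define F where "F = (\<lambda>t. integral {0..t} \<phi>)"
  define \<tau> where "\<tau> = (\<lambda>k. real k * T / real m)"
  have \<tau>_range: "0 \<le> \<tau> k" "\<tau> k \<le> T" if "k \<le> m" for k
    using T m that by (auto simp: \<tau>_def divide_le_eq mult.commute mult_left_mono)
  have \<tau>_step: "\<tau> (Suc k) - \<tau> k = T / real m" for k
    by (simp add: \<tau>_def field_simps diff_divide_distrib[symmetric])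
  have F: "(F has_real_derivative \<phi> t) (at t within {0..T})" if "t \<in> {0..T}" for t
    unfolding F_def by (rule integral_has_real_derivative[OF cont that])
  have piece: "\<bar>F (\<tau> (Suc k)) - F (\<tau> k) - \<phi> (\<tau> (Suc k)) * (T / real m)\<bar> \<le> C * (T / real m)\<^sup>2"
    if k: "k < m" for k
  proof -
    let ?I = "{\<tau> k..\<tau> (Suc k)}"
    have sub: "?I \<subseteq> {0..T}" using \<tau>_range[of k] \<tau>_range[of "Suc k"] k by auto
    have le: "\<tau> k \<le> \<tau> (Suc k)" using \<tau>_step[of k] divide_nonneg_nonneg[OF T of_nat_0_le_iff[of m]] by linarith
    have "norm ((F (\<tau> (Suc k)) - \<phi> (\<tau> (Suc k)) * \<tau> (Suc k)) - (F (\<tau> k) - \<phi> (\<tau> (Suc k)) * \<tau> k))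
        \<le> (C * (T / real m)) * norm (\<tau> (Suc k) - \<tau> k)"
    proof (rule field_differentiable_bound[where S="?I" and f'="\<lambda>s. \<phi> s - \<phi> (\<tau> (Suc k))"])
      fix s assume s: "s \<in> ?I"
      show "((\<lambda>s. F s - \<phi> (\<tau> (Suc k)) * s) has_field_derivative \<phi> s - \<phi> (\<tau> (Suc k))) (at s within ?I)"
        using s sub by (auto intro!: derivative_eq_intros DERIV_subset[OF F])
      have "\<bar>\<phi> s - \<phi> (\<tau> (Suc k))\<bar> \<le> C * \<bar>s - \<tau> (Suc k)\<bar>"
        using s sub le by (intro lip) auto
      also have "\<dots> \<le> C * (T / real m)"
        using s \<tau>_step[of k] \<open>0 \<le> C\<close> by (intro mult_left_mono) auto
      finally show "norm (\<phi> s - \<phi> (\<tau> (Suc k))) \<le> C * (T / real m)" by simp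
    qed (use le in auto)
    moreover have "norm (\<tau> (Suc k) - \<tau> k) = T / real m" using \<tau>_step[of k] T by simp
    moreover have "(F (\<tau> (Suc k)) - \<phi> (\<tau> (Suc k)) * \<tau> (Suc k)) - (F (\<tau> k) - \<phi> (\<tau> (Suc k)) * \<tau> k)
       = F (\<tau> (Suc k)) - F (\<tau> k) - \<phi> (\<tau> (Suc k)) * (T / real m)"
      by (simp add: \<tau>_step[of k, symmetric] algebra_simps)
    ultimately show ?thesis by (simp add: power2_eq_square mult_ac)
  qed
  have "integral {0..T} \<phi> = (\<Sum>k<m. F (\<tau> (Suc k)) - F (\<tau> k))"
  proof -
    have "(\<Sum>k<m. F (\<tau> (Suc k)) - F (\<tau> k)) = F (\<tau> m) - F (\<tau> 0)" by (rule sum_lessThan_telescope)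
    then show ?thesis using m by (simp add: F_def \<tau>_def)
  qed
  moreover have "T / real m * (\<Sum>k=1..m. \<phi> (real k * T / real m)) = (\<Sum>k<m. \<phi> (\<tau> (Suc k)) * (T / real m))"
  proof -
    have "(\<Sum>k=1..m. \<phi> (\<tau> k)) = (\<Sum>k<m. \<phi> (\<tau> (Suc k)))"
      by (simp add: sum.atLeast1_atMost_eq)
    then show ?thesis by (simp add: \<tau>_def sum_distrib_left mult.commute)
  qed
  ultimately have "\<bar>T / real m * (\<Sum>k=1..m. \<phi> (real k * T / real m)) - integral {0..T} \<phi>\<bar> =
      \<bar>\<Sum>k<m. F (\<tau> (Suc k)) - F (\<tau> k) - \<phi> (\<tau> (Suc k)) * (T / real m)\<bar>"
    by (simp only: sum_subtractf abs_minus_commute)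
  also have "\<dots> \<le> (\<Sum>k<m. \<bar>F (\<tau> (Suc k)) - F (\<tau> k) - \<phi> (\<tau> (Suc k)) * (T / real m)\<bar>)"
    by (rule sum_abs)
  also have "\<dots> \<le> (\<Sum>k<m. C * (T / real m)\<^sup>2)" by (intro sum_mono piece) auto
  also have "\<dots> = C * T\<^sup>2 / real m" using m by (simp add: power2_eq_square field_simps)
  finally show ?thesis .
qed

lemma l1_lipschitz_integrable:
  fixes f :: "real \<Rightarrow> nat \<Rightarrow> real"
  assumes "0 \<le> C"
    and "\<And>s t. 0 \<le> s \<Longrightarrow> s \<le> T \<Longrightarrow> 0 \<le> t \<Longrightarrow> t \<le> T \<Longrightarrow> l1_le (\<lambda>j. f s j - f t j) (C * \<bar>s - t\<bar>)"
  shows "(\<lambda>s. f s j) integrable_on {0..T}"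
proof (rule integrable_continuous_real, rule lipschitz_on_continuous_on)
  show "C-lipschitz_on {0..T} (\<lambda>s. f s j)"
    using l1_le_abs[OF assms(2), of _ _ j] \<open>0 \<le> C\<close> by (intro lipschitz_onI) (auto simp: dist_real_def)
qed

lemma l1_riemann_sum_error:
  fixes f :: "real \<Rightarrow> nat \<Rightarrow> real"
  assumes T: "0 \<le> T" and m: "m > 0" and "0 \<le> C"
    and lip: "\<And>s t. 0 \<le> s \<Longrightarrow> s \<le> T \<Longrightarrow> 0 \<le> t \<Longrightarrow> t \<le> T \<Longrightarrow> l1_le (\<lambda>j. f s j - f t j) (C * \<bar>s - t\<bar>)"
  shows "l1_le (\<lambda>j. T / real m * (\<Sum>k=1..m. f (real k * T / real m) j) - integral {0..T} (\<lambda>s. f s j)) (C * T\<^sup>2 / real m)"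
proof (rule l1_le_of_signed_sums)
  fix n and \<sigma> :: "nat \<Rightarrow> real" assume \<sigma>: "\<And>j. \<bar>\<sigma> j\<bar> \<le> 1"
  have int: "(\<lambda>s. f s j) integrable_on {0..T}" for j
    by (rule l1_lipschitz_integrable[OF \<open>0 \<le> C\<close> lip])
  let ?\<phi> = "\<lambda>s. \<Sum>j<n. \<sigma> j * f s j"
  have "\<bar>?\<phi> s - ?\<phi> t\<bar> \<le> C * \<bar>s - t\<bar>" if "0 \<le> s" "s \<le> T" "0 \<le> t" "t \<le> T" for s t
    using l1_le_signed_sum[OF lip[OF that] \<sigma>, where n=n] by (simp add: sum_subtractf right_diff_distrib)
  from riemann_sum_error[OF T m \<open>0 \<le> C\<close> this]
  have "T / real m * (\<Sum>k=1..m. ?\<phi> (real k * T / real m)) - integral {0..T} ?\<phi> \<le> C * T\<^sup>2 / real m"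
    by (simp add: abs_le_iff)
  moreover have "integral {0..T} ?\<phi> = (\<Sum>j<n. \<sigma> j * integral {0..T} (\<lambda>s. f s j))"
    using int by (subst integral_sum) (auto intro!: integrable_on_mult_right)
  moreover have "T / real m * (\<Sum>k=1..m. ?\<phi> (real k * T / real m)) =
      (\<Sum>j<n. \<sigma> j * (T / real m * (\<Sum>k=1..m. f (real k * T / real m) j)))"
    by (subst sum.swap) (simp add: sum_distrib_left mult_ac)
  ultimately show "(\<Sum>j<n. \<sigma> j * (T / real m * (\<Sum>k=1..m. f (real k * T / real m) j) - integral {0..T} (\<lambda>s. f s j))) \<le> C * T\<^sup>2 / real m"
    by (simp add: right_diff_distrib sum_subtractf)
qed

section \<open>Solutions of the limit equation\<close>

lemma mean_field_prob_seqs: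
  "mean_field_solution idle T lam nu rho0 rho \<Longrightarrow> 0 \<le> t \<Longrightarrow> t \<le> T \<Longrightarrow> rho t \<in> prob_seqs"
  by (simp add: mean_field_solution_def)

lemma mean_field_derivative:
  "mean_field_solution idle T lam nu rho0 rho \<Longrightarrow> 0 \<le> t \<Longrightarrow> t \<le> T \<Longrightarrow>
    ((\<lambda>s. rho s j) has_real_derivative (lam * U (rho t) j + nu * V idle (rho t) j)) (at t within {0..T})"
  by (simp add: mean_field_solution_def)

text \<open>
  The drift is bounded in the summable norm by \<open>4 lam + 2 nu\<close>, and the mean value theorem applies to signed sums
  of finitely many coordinates.
\<close>

lemma mean_field_lipschitz:
  assumes mf: "mean_field_solution idle T lam nu rho0 rho" and lam: "0 \<le> lam" and nu: "0 \<le> nu"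
    and s: "0 \<le> s" "s \<le> T" and t: "0 \<le> t" "t \<le> T"
  shows "l1_le (\<lambda>j. rho s j - rho t j) ((4 * lam + 2 * nu) * \<bar>s - t\<bar>)"
proof (rule l1_le_of_signed_sums)
  fix n and \<sigma> :: "nat \<Rightarrow> real" assume \<sigma>: "\<And>j. \<bar>\<sigma> j\<bar> \<le> 1"
  let ?\<phi> = "\<lambda>s. \<Sum>j<n. \<sigma> j * rho s j"
  let ?\<phi>' = "\<lambda>s. \<Sum>j<n. \<sigma> j * (lam * U (rho s) j + nu * V idle (rho s) j)"
  have "norm (?\<phi> s - ?\<phi> t) \<le> (4 * lam + 2 * nu) * norm (s - t)"
  proof (rule field_differentiable_bound[where S="{0..T}" and f'="?\<phi>'"])
    fix z assume z: "z \<in> {0..T}"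
    show "(?\<phi> has_field_derivative ?\<phi>' z) (at z within {0..T})"
      using z by (intro DERIV_sum DERIV_cmult mean_field_derivative[OF mf]) auto
    have P: "rho z \<in> prob_seqs" using z mean_field_prob_seqs[OF mf] by simp
    have "l1_le (\<lambda>j. lam * U (rho z) j + nu * V idle (rho z) j) (\<bar>lam\<bar> * 4 + \<bar>nu\<bar> * 2)"
      by (intro l1_le_add l1_le_cmult l1_le_U l1_le_V P)
    from l1_le_signed_sum[OF this \<sigma>, where n=n] show "norm (?\<phi>' z) \<le> 4 * lam + 2 * nu"
      using lam nu by (simp add: mult.commute)
  qed (use s t in auto)
  then show "(\<Sum>j<n. \<sigma> j * (rho s j - rho t j)) \<le> (4 * lam + 2 * nu) * \<bar>s - t\<bar>"
    by (simp add: sum_subtractf right_diff_distrib abs_le_iff)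
qed

text \<open>
  Tightness of a compact curve, in the manner of Dini's theorem: the tails decrease in \<open>J\<close>
  and are continuous in \<open>t\<close>. Bad times for every \<open>J\<close> would accumulate at a time at which the tail does not
  vanish.
\<close>

lemma mean_field_uniform_tail:
  assumes mf: "mean_field_solution idle T lam nu rho0 rho" and lam: "0 \<le> lam" and nu: "0 \<le> nu"
    and "0 < e"
  shows "\<exists>J. \<forall>t\<in>{0..T}. tail (rho t) J \<le> e"
proof (rule ccontr)
  assume "\<not> ?thesis"
  then have "\<forall>J. \<exists>t. t \<in> {0..T} \<and> tail (rho t) J > e" by (meson not_le)
  then obtain \<tau> where \<tau>: "\<And>J. \<tau> J \<in> {0..T}" "\<And>J. tail (rho (\<tau> J)) J > e" by metis
  have "compact {0..T}" by simp
  then obtain l r where l: "l \<in> {0..T}" and r: "strict_mono (r :: nat \<Rightarrow> nat)" and lim: "(\<tau> \<circ> r) \<longlonglongrightarrow> l"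
    using \<tau>(1) unfolding compact_def by blast
  have Pl: "rho l \<in> prob_seqs" using l mean_field_prob_seqs[OF mf] by simp
  have "\<forall>\<^sub>F J in sequentially. tail (rho l) J < e"
    using order_tendstoD(2)[OF tail_tendsto_0[OF Pl] \<open>0 < e\<close>] .
  then obtain J where J: "tail (rho l) J < e" by (auto simp: eventually_sequentially)
  have "(\<lambda>n. tail (rho l) J + (4 * lam + 2 * nu) * \<bar>\<tau> (r n) - l\<bar>) \<longlonglongrightarrow> tail (rho l) J + (4 * lam + 2 * nu) * \<bar>l - l\<bar>"
    using lim by (intro tendsto_intros) (simp add: comp_def)
  then have "\<forall>\<^sub>F n in sequentially. tail (rho l) J + (4 * lam + 2 * nu) * \<bar>\<tau> (r n) - l\<bar> < e"
    by (rule order_tendstoD) (use J in simp)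
  moreover have "\<forall>\<^sub>F n in sequentially. J \<le> n" by (rule eventually_ge_at_top)
  ultimately have "\<forall>\<^sub>F n in sequentially. False"
  proof eventually_elim
    case (elim n)
    have P: "rho (\<tau> (r n)) \<in> prob_seqs" using \<tau>(1) mean_field_prob_seqs[OF mf] by simp
    have "l1_le (\<lambda>j. rho (\<tau> (r n)) j - rho l j) ((4 * lam + 2 * nu) * \<bar>\<tau> (r n) - l\<bar>)"
      using \<tau>(1)[of "r n"] l by (intro mean_field_lipschitz[OF mf lam nu]) auto
    from tail_diff_le[OF this, of J] have "tail (rho (\<tau> (r n))) J < e" using elim by linarith
    moreover have "tail (rho (\<tau> (r n))) (r n) \<le> tail (rho (\<tau> (r n))) J"
      using seq_suble[OF r, of n] elim by (intro tail_antimono[OF P]) simp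
    ultimately show False using \<tau>(2)[of "r n"] by simp
  qed
  then show False by simp
qed

lemma mean_field_tail_derivative:
  assumes mf: "mean_field_solution idle T lam nu rho0 rho" and t: "0 \<le> t" "t \<le> T"
  shows "((\<lambda>s. tail (rho s) (Suc k)) has_real_derivative
     (lam * arrival_flux (rho t) k - nu * (rho t (Suc k) - (if idle then 0 else rho t 0)))) (at t within {0..T})"
proof -
  have "((\<lambda>s. tail (rho s) (Suc k)) has_real_derivative
     - (\<Sum>j<Suc k. lam * U (rho t) j + nu * V idle (rho t) j)) (at t within {0..T})"
    unfolding tail_def
    by (rule derivative_eq_intros DERIV_sum mean_field_derivative[OF mf t] refl)+ simp
  also have "- (\<Sum>j<Suc k. lam * U (rho t) j + nu * V idle (rho t) j) =
     lam * arrival_flux (rho t) k - nu * (rho t (Suc k) - (if idle then 0 else rho t 0))"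
    unfolding sum.distrib sum_distrib_left[symmetric] sum_V sum_U[OF mean_field_prob_seqs[OF mf t]] by simp
  finally show ?thesis .
qed

text \<open>
  Mass leaves the sequence at the rate \<open>nu\<close> times the mass at 0, whereas the flux to infinity vanishes because the
  tails are uniformly small. As the mass stays 1, there is no mass at 0 at any time. Then the equation for
  coordinate \<open>j\<close> shows, one \<open>j\<close> after the other, that the mass at \<open>j + 1\<close> is 0 too.
\<close>

lemma no_mean_field_solution_serving_empty_queues:
  assumes mf: "mean_field_solution False T lam nu rho0 rho" and lam: "0 \<le> lam" and nu: "0 < nu" and T: "0 < T"
  shows False
proof -
  note P = mean_field_prob_seqs[OF mf]
  have nu0: "0 \<le> nu" using nu by simp
  have cont: "continuous_on {0..T} (\<lambda>s. rho s 0)"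
    by (intro continuous_on_eq_continuous_within[THEN iffD2] ballI)
       (rule DERIV_continuous, rule mean_field_derivative[OF mf], auto)
  define F where "F = (\<lambda>t. integral {0..t} (\<lambda>s. rho s 0))"
  have F: "(F has_real_derivative rho t 0) (at t within {0..T})" if "t \<in> {0..T}" for t
    unfolding F_def by (rule integral_has_real_derivative[OF cont that])
  have "nu * F T \<le> 0"
  proof (rule field_le_epsilon)
    fix e :: real assume "e > 0"
    \<comment> \<open>Chosen so that the flux past level \<open>J\<close> over \<open>[0, T]\<close> and the tail at time \<open>T\<close> together contribute at most \<open>e\<close>.\<close>
    define e' where "e' = e / ((2 * lam + nu) * T + 1)"
    have e': "e' > 0" unfolding e'_def using \<open>e > 0\<close> lam nu T by (intro divide_pos_pos add_nonneg_pos) auto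
    from mean_field_uniform_tail[OF mf lam nu0 e'] obtain J where J: "\<And>t. t \<in> {0..T} \<Longrightarrow> tail (rho t) J \<le> e'"
      by blast
    let ?g = "\<lambda>t. tail (rho t) (Suc J) - nu * F t"
    let ?g' = "\<lambda>t. lam * arrival_flux (rho t) J - nu * rho t (Suc J)"
    have "norm (?g 0 - ?g T) \<le> (2 * lam + nu) * e' * norm (0 - T)"
    proof (rule field_differentiable_bound[where S="{0..T}" and f'="?g'"])
      fix z assume z: "z \<in> {0..T}"
      have "(?g has_field_derivative (lam * arrival_flux (rho z) J - nu * (rho z (Suc J) - rho z 0)) - nu * rho z 0) (at z within {0..T})"
        using z mean_field_tail_derivative[OF mf, of z J] by (intro DERIV_diff DERIV_cmult F) auto
      then show "(?g has_field_derivative ?g' z) (at z within {0..T})" by (simp add: algebra_simps)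
      have Pz: "rho z \<in> prob_seqs" using P z by simp
      have t1: "tail (rho z) J \<le> e'" "tail (rho z) (Suc J) \<le> e'" "rho z J \<le> 1" "rho z (Suc J) \<le> e'"
        using J[OF z] tail_antimono[OF Pz, of J "Suc J"] tail_nonneg[OF Pz, of "Suc (Suc J)"] tail_Suc[of "rho z" "Suc J"]
          tail_nonneg[OF Pz, of "Suc J"] tail_Suc[of "rho z" J] tail_le_1[OF Pz, of J] by linarith+
      have t0: "0 \<le> rho z J" "0 \<le> rho z (Suc J)" "0 \<le> tail (rho z) J" "0 \<le> tail (rho z) (Suc J)"
        using prob_seqs_nonneg[OF Pz] tail_nonneg[OF Pz] by auto
      have "arrival_flux (rho z) J \<le> 1 * (e' + e')" "0 \<le> arrival_flux (rho z) J"
        unfolding arrival_flux_def using t0 t1 by (intro mult_mono, auto)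
      then have "lam * arrival_flux (rho z) J \<le> lam * (2 * e')" "0 \<le> lam * arrival_flux (rho z) J"
        using lam by (auto intro!: mult_left_mono)
      moreover have "nu * rho z (Suc J) \<le> nu * e'" "0 \<le> nu * rho z (Suc J)"
        using nu t0 t1 by (auto intro!: mult_left_mono)
      moreover have "0 \<le> lam * e'" "0 \<le> nu * e'" using lam nu e' by auto
      ultimately show "norm (?g' z) \<le> (2 * lam + nu) * e'"
        by (simp add: abs_le_iff algebra_simps)
    qed (use T in auto)
    moreover have "F 0 = 0" by (simp add: F_def)
    moreover have "0 \<le> tail (rho 0) (Suc J)" "tail (rho T) (Suc J) \<le> e'"
      using J[of T] T tail_antimono[OF P, of T J "Suc J"] tail_nonneg[OF P, of 0] by auto
    ultimately have "nu * F T \<le> (2 * lam + nu) * e' * T + e'"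
      using T by (simp add: abs_le_iff)
    also have "\<dots> = e' * ((2 * lam + nu) * T + 1)" by (simp add: algebra_simps)
    also have "\<dots> = e"
    proof -
      have "(2 * lam + nu) * T + 1 > 0" using lam nu T by (intro add_nonneg_pos) auto
      then show ?thesis by (simp add: e'_def)
    qed
    finally show "nu * F T \<le> 0 + e" by simp
  qed
  then have "F T \<le> 0" using nu by (simp add: mult_le_0_iff)
  moreover have "0 \<le> F T"
    unfolding F_def using P prob_seqs_nonneg by (intro Henstock_Kurzweil_Integration.integral_nonneg integrable_continuous_real cont) auto
  ultimately have "integral {0..T} (\<lambda>s. rho s 0) = 0" by (simp add: F_def)
  then have z0: "rho t 0 = 0" if "t \<in> {0..T}" for t
    using integral_eq_0_iff[OF cont T] P prob_seqs_nonneg that by auto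
  have z: "\<forall>i\<le>j. \<forall>t\<in>{0..T}. rho t i = 0" for j
  proof (induction j)
    case 0
    then show ?case using z0 by simp
  next
    case (Suc j)
    have "rho t (Suc j) = 0" if t: "t \<in> {0..T}" for t
    proof -
      have "((\<lambda>s. rho s j) has_real_derivative (lam * U (rho t) j + nu * V False (rho t) j)) (at t within {0..T})"
        using t by (intro mean_field_derivative[OF mf]) auto
      moreover have "((\<lambda>s. rho s j) has_real_derivative 0) (at t within {0..T})"
        by (rule has_field_derivative_transform_within[where f="\<lambda>_. 0" and d=1]) (use t Suc in auto)
      ultimately have "lam * U (rho t) j + nu * V False (rho t) j = 0"
        unfolding has_real_derivative_iff_has_vector_derivative
        by (rule vector_derivative_unique_within_closed_interval[of 0 T t, unfolded cbox_interval, OF T t])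
      moreover have "U (rho t) j = 0"
        using Suc t by (auto simp: U_def pred_term_def)
      moreover have "V False (rho t) j = rho t (Suc j)" using Suc t by (simp add: V_def)
      ultimately show ?thesis using nu by simp
    qed
    then show ?case using Suc by (auto simp: le_Suc_eq)
  qed
  have "rho 0 j = 0" for j using spec[OF z[of j], of j] T by simp
  then have "(\<lambda>j. rho 0 j) sums 0" by simp
  moreover have "(\<lambda>j. rho 0 j) sums 1" using P[of 0] T by (simp add: prob_seqs_def)
  ultimately show False using sums_unique2 by fastforce
qed

section \<open>Convergence of the empirical measure\<close>

lemma empirical_prob_seqs:
  assumes "N > 0"
  shows "empirical N x \<in> prob_seqs"
proof -
  have "(\<lambda>j. of_bool (x i = j)) sums (1 :: real)" for i
    using sums_single[of "x i" "\<lambda>_. 1 :: real"] by (simp add: of_bool_def eq_commute)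
  then have "(\<lambda>j. (\<Sum>i<N. of_bool (x i = j)) / real N) sums ((\<Sum>i<N. 1) / real N)"
    by (intro sums_divide sums_sum) auto
  then show ?thesis
    using assms by (auto simp: prob_seqs_def empirical_def[abs_def] sum_nonneg)
qed

lemma tail_fraction_eq_tail: "N > 0 \<Longrightarrow> tail_fraction N x k = tail (empirical N x) k"
proof (induction k)
  case (Suc k)
  then show ?case using tail_fraction_diff_Suc[of N x k] by (simp add: tail_Suc)
qed (simp add: tail_fraction_0)

context
  fixes T lam nu :: real and M :: "nat \<Rightarrow> 'w measure" and X :: "nat \<Rightarrow> real \<Rightarrow> 'w \<Rightarrow> nat \<Rightarrow> nat"
    and rho0 :: "nat \<Rightarrow> real" and rho :: "real \<Rightarrow> nat \<Rightarrow> real"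
  assumes T: "0 < T" and lam: "0 \<le> lam" and nu: "0 \<le> nu"
    and proc: "\<And>N. N \<ge> 2 \<Longrightarrow> two_choices_process (M N) T N lam nu (X N)"
    and mf: "mean_field_solution True T lam nu rho0 rho"
    and init: "\<And>\<epsilon>. \<epsilon> > 0 \<Longrightarrow>
      (\<lambda>N. measure (M N) {\<omega>\<in>space (M N). l1_dist (empirical N (X N 0 \<omega>)) rho0 > \<epsilon>}) \<longlonglongrightarrow> 0"
begin

lemma process_prob_space: "N \<ge> 2 \<Longrightarrow> prob_space (M N)"
  using proc by (simp add: two_choices_process_def markov_jump_process_def)

lemma process_measurable: "N \<ge> 2 \<Longrightarrow> 0 \<le> t \<Longrightarrow> t \<le> T \<Longrightarrow> X N t \<in> M N \<rightarrow>\<^sub>M count_space UNIV"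
  using proc[of N] by (auto simp: two_choices_process_def markov_jump_process_def)

lemma process_integrable:
  fixes \<phi> :: "(nat \<Rightarrow> nat) \<Rightarrow> real"
  assumes "N \<ge> 2" "0 \<le> t" "t \<le> T" and B: "\<And>x. \<bar>\<phi> x\<bar> \<le> B"
  shows "integrable (M N) (\<lambda>\<omega>. \<phi> (X N t \<omega>))"
proof -
  interpret prob_space "M N" by (rule process_prob_space[OF assms(1)])
  show ?thesis
    by (rule integrable_const_bound[where B=B])
       (use B measurable_compose[OF process_measurable[OF assms(1-3)], of \<phi> borel] in auto)
qed

text \<open>
  The initial mean square error is at most \<open>h\<close> plus the probability that the initial distance exceeds \<open>h\<close>, at
  every level \<open>k\<close>, since differences of tails are bounded both by 1 and by the distance. The bound from
  \<open>two_choices_mean_square\<close> at time \<open>T\<close> serves all earlier times.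
\<close>

lemma tail_fraction_mean_square_tendsto_0:
  assumes "0 < e"
  shows "\<forall>\<^sub>F N in sequentially. \<forall>t\<in>{0..T}. (\<integral>\<omega>. (tail_fraction N (X N t \<omega>) k - tail (rho t) k)\<^sup>2 \<partial>M N) \<le> e"
proof (cases "k = 0")
  case True
  have "\<forall>\<^sub>F N in sequentially. N \<ge> (1 :: nat)" by (rule eventually_ge_at_top)
  then show ?thesis
  proof eventually_elim
    case (elim N)
    then show ?case using \<open>0 < e\<close> by (simp add: True tail_fraction_0)
  qed
next
  case False
  define L where "L = 2 * lam + nu"
  define G where "G = 2 ^ k * exp (6 * L * T)"
  have L: "0 \<le> L" using lam nu by (simp add: L_def)
  have G: "0 < G" by (simp add: G_def)
  \<comment> \<open>\<open>G\<close> is the factor by which \<open>two_choices_mean_square\<close> may amplify the initial error up to time \<open>T\<close>; the error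
    \<open>h\<close> then contributes \<open>e / 2\<close>.\<close>
  define h where "h = e / (2 * G)"
  have h: "0 < h" using \<open>0 < e\<close> G by (simp add: h_def)
  let ?P = "\<lambda>N. measure (M N) {\<omega>\<in>space (M N). l1_dist (empirical N (X N 0 \<omega>)) rho0 > h}"
  have "(\<lambda>N. (h + ?P N + L / real N * T) * G) \<longlonglongrightarrow> (h + 0 + 0 * T) * G"
    by (intro tendsto_intros init h real_tendsto_divide_at_top[OF tendsto_const filterlim_real_sequentially])
  moreover have "(h + 0 + 0 * T) * G < e" using \<open>0 < e\<close> G by (simp add: h_def)
  ultimately have "\<forall>\<^sub>F N in sequentially. (h + ?P N + L / real N * T) * G < e"
    by (rule order_tendstoD)
  moreover have "\<forall>\<^sub>F N in sequentially. N \<ge> (2 :: nat)" by (rule eventually_ge_at_top)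
  ultimately show ?thesis
  proof eventually_elim
    case (elim N)
    then have N: "N \<ge> 2" "N > 0" by auto
    interpret prob_space "M N" by (rule process_prob_space[OF N(1)])
    have r0: "rho 0 = rho0" using mf by (simp add: mean_field_solution_def)
    have P0: "rho0 \<in> prob_seqs" using mean_field_prob_seqs[OF mf, of 0] T r0 by simp
    have sq1: "(tail_fraction N x j - tail (rho 0) j)\<^sup>2 \<le> 1" for x j
    proof -
      have "\<bar>tail_fraction N x j - tail (rho 0) j\<bar> \<le> 1"
        using tail_fraction_nonneg[of N x j] tail_fraction_le_1[of N x j] tail_nonneg[OF P0, of j] tail_le_1[OF P0, of j]
        by (simp add: r0 abs_le_iff)
      then show ?thesis by (simp add: abs_square_le_1)
    qed
    have init_le: "(\<integral>\<omega>. (tail_fraction N (X N 0 \<omega>) j - tail (rho 0) j)\<^sup>2 \<partial>M N) \<le> h + ?P N" for j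
    proof -
      let ?A = "{\<omega>\<in>space (M N). l1_dist (empirical N (X N 0 \<omega>)) rho0 > h}"
      have A: "?A \<in> sets (M N)"
        using measurable_compose[OF process_measurable[OF N(1), of 0], of "\<lambda>x. l1_dist (empirical N x) rho0" borel] T
        by simp
      have "(\<integral>\<omega>. (tail_fraction N (X N 0 \<omega>) j - tail (rho 0) j)\<^sup>2 \<partial>M N) \<le> (\<integral>\<omega>. h + indicator ?A \<omega> \<partial>M N)"
      proof (rule integral_mono)
        show "integrable (M N) (\<lambda>\<omega>. (tail_fraction N (X N 0 \<omega>) j - tail (rho 0) j)\<^sup>2)"
          using T sq1 by (intro process_integrable[OF N(1), where B=1]) auto
        show "integrable (M N) (\<lambda>\<omega>. h + indicator ?A \<omega>)"
          using A by (intro Bochner_Integration.integrable_add integrable_real_indicator) (auto simp: emeasure_eq_measure)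
        fix \<omega> assume \<omega>: "\<omega> \<in> space (M N)"
        let ?d = "tail_fraction N (X N 0 \<omega>) j - tail (rho 0) j"
        have P: "empirical N (X N 0 \<omega>) \<in> prob_seqs" by (rule empirical_prob_seqs[OF N(2)])
        have "\<bar>?d\<bar> \<le> l1_dist (empirical N (X N 0 \<omega>)) rho0"
          unfolding tail_fraction_eq_tail[OF N(2)] r0 by (rule tail_diff_le[OF l1_le_l1_dist[OF P P0]])
        moreover have "?d\<^sup>2 \<le> \<bar>?d\<bar>"
        proof -
          have "\<bar>?d\<bar> \<le> 1" using sq1[of "X N 0 \<omega>" j] by (simp add: abs_square_le_1)
          then have "\<bar>?d\<bar> * \<bar>?d\<bar> \<le> \<bar>?d\<bar> * 1" by (intro mult_left_mono) auto
          then show ?thesis by (simp add: power2_eq_square)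
        qed
        ultimately show "?d\<^sup>2 \<le> h + indicator ?A \<omega>"
          using sq1[of "X N 0 \<omega>" j] h \<omega> by (cases "\<omega> \<in> ?A") auto
      qed
      also have "\<dots> = (\<integral>\<omega>. h \<partial>M N) + (\<integral>\<omega>. indicator ?A \<omega> \<partial>M N)"
        using A by (intro Bochner_Integration.integral_add integrable_real_indicator) (auto simp: emeasure_eq_measure)
      also have "\<dots> = h + ?P N" using A sets.sets_into_space[OF A] by (simp add: prob_space Int_absorb2)
      finally show ?thesis .
    qed
    show ?case
    proof
      fix t assume t: "t \<in> {0..T}"
      have "(\<integral>\<omega>. (tail_fraction N (X N t \<omega>) k - tail (rho t) k)\<^sup>2 \<partial>M N)
           \<le> 2 ^ k * ((h + ?P N + (2 * lam + nu) / real N * t) * exp (6 * (2 * lam + nu) * t))"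
      proof (rule two_choices_mean_square[where a="\<lambda>t. tail (rho t)", OF proc[OF N(1)] N(2) lam nu _ _ _ init_le])
        fix s :: real and j :: nat assume s: "0 \<le> s" "s \<le> T"
        note P = mean_field_prob_seqs[OF mf s]
        show "tail (rho s) j \<in> {0..1}" using tail_nonneg[OF P] tail_le_1[OF P] by simp
        show "tail (rho s) 0 = 1" by simp
        assume "j > 0"
        then obtain i where j: "j = Suc i" by (cases j) auto
        show "((\<lambda>s. tail (rho s) j) has_real_derivative
          (lam * ((tail (rho s) (j - 1))\<^sup>2 - (tail (rho s) j)\<^sup>2) - nu * (tail (rho s) j - tail (rho s) (Suc j)))) (at s within {0..T})"
          using mean_field_tail_derivative[OF mf s, of i] by (simp add: j arrival_flux_eq tail_Suc)
      qed (use t False in auto)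
      also have "\<dots> \<le> 2 ^ k * ((h + ?P N + L / real N * T) * exp (6 * L * T))"
        unfolding L_def[symmetric] using t L h by (intro mult_left_mono mult_mono add_mono) (auto intro: mult_left_mono)
      also have "\<dots> = (h + ?P N + L / real N * T) * G" by (simp add: G_def)
      finally show "(\<integral>\<omega>. (tail_fraction N (X N t \<omega>) k - tail (rho t) k)\<^sup>2 \<partial>M N) \<le> e" using elim by linarith
    qed
  qed
qed

text \<open>
  A coordinate is a difference of two consecutive tails, and \<open>\<bar>d\<bar> \<le> h + d\<^sup>2 / h\<close> passes from the second moment
  to the first.
\<close>

lemma empirical_mean_error_tendsto_0:
  assumes "0 < e"
  shows "\<forall>\<^sub>F N in sequentially. \<forall>t\<in>{0..T}. (\<integral>\<omega>. \<bar>empirical N (X N t \<omega>) k - rho t k\<bar> \<partial>M N) \<le> e"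
proof -
  define h where "h = e / 4"
  have h: "0 < h" using assms by (simp add: h_def)
  then have "0 < h\<^sup>2" by simp
  note ev = tail_fraction_mean_square_tendsto_0[OF this]
  have "\<forall>\<^sub>F N in sequentially. N \<ge> (2 :: nat)" by (rule eventually_ge_at_top)
  then show ?thesis using ev[of k] ev[of "Suc k"]
  proof eventually_elim
    case (elim N)
    then have N: "N \<ge> 2" "N > 0" by auto
    interpret prob_space "M N" by (rule process_prob_space[OF N(1)])
    show ?case
    proof
      fix t assume t: "t \<in> {0..T}"
      then have t': "0 \<le> t" "t \<le> T" by auto
      note P = mean_field_prob_seqs[OF mf t']
      let ?d = "\<lambda>j \<omega>. tail_fraction N (X N t \<omega>) j - tail (rho t) j"
      have d1: "\<bar>tail_fraction N x j - tail (rho t) j\<bar> \<le> 1" for x j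
        using tail_fraction_nonneg[of N x j] tail_fraction_le_1[of N x j] tail_nonneg[OF P, of j] tail_le_1[OF P, of j]
        by (simp add: abs_le_iff)
      have int1: "integrable (M N) (\<lambda>\<omega>. \<bar>?d j \<omega>\<bar>)" for j
        using d1 by (intro process_integrable[OF N(1) t', where B=1]) auto
      have int2: "integrable (M N) (\<lambda>\<omega>. (?d j \<omega>)\<^sup>2)" for j
        using d1 by (intro process_integrable[OF N(1) t', where B=1]) (auto simp: abs_square_le_1)
      have young: "\<bar>d\<bar> \<le> h + d\<^sup>2 / h" for d :: real
      proof -
        have "\<bar>d\<bar> * h \<le> h\<^sup>2 + d\<^sup>2"
        proof -
          have "0 \<le> \<bar>d\<bar> * h" using h by simp
          then show ?thesis using sum_squares_bound[of "\<bar>d\<bar>" h] unfolding power2_abs by linarith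
        qed
        then show ?thesis using h by (simp add: field_simps power2_eq_square)
      qed
      have half: "(\<integral>\<omega>. \<bar>?d j \<omega>\<bar> \<partial>M N) \<le> 2 * h" if "(\<integral>\<omega>. (?d j \<omega>)\<^sup>2 \<partial>M N) \<le> h\<^sup>2" for j
      proof -
        have "(\<integral>\<omega>. \<bar>?d j \<omega>\<bar> \<partial>M N) \<le> (\<integral>\<omega>. h + (?d j \<omega>)\<^sup>2 / h \<partial>M N)"
          using int2[of j] by (intro integral_mono int1 young) auto
        also have "\<dots> = h + (\<integral>\<omega>. (?d j \<omega>)\<^sup>2 \<partial>M N) / h" using int2[of j] by (simp add: prob_space)
        also have "\<dots> \<le> h + h\<^sup>2 / h" using that h by (intro add_left_mono divide_right_mono) auto
        finally show ?thesis using h by (simp add: power2_eq_square)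
      qed
      have "(\<integral>\<omega>. \<bar>empirical N (X N t \<omega>) k - rho t k\<bar> \<partial>M N) \<le> (\<integral>\<omega>. \<bar>?d k \<omega>\<bar> + \<bar>?d (Suc k) \<omega>\<bar> \<partial>M N)"
      proof (rule integral_mono)
        have eq: "empirical N x k - rho t k = (tail_fraction N x k - tail (rho t) k) - (tail_fraction N x (Suc k) - tail (rho t) (Suc k))" for x
          using tail_fraction_diff_Suc[of N x k] by (simp add: tail_Suc)
        show "integrable (M N) (\<lambda>\<omega>. \<bar>empirical N (X N t \<omega>) k - rho t k\<bar>)"
          unfolding eq
        proof (intro process_integrable[OF N(1) t', where B=2])
          fix x show "\<bar>\<bar>(tail_fraction N x k - tail (rho t) k) - (tail_fraction N x (Suc k) - tail (rho t) (Suc k))\<bar>\<bar> \<le> 2"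
            using d1[of x k] d1[of x "Suc k"] by linarith
        qed
        show "integrable (M N) (\<lambda>\<omega>. \<bar>?d k \<omega>\<bar> + \<bar>?d (Suc k) \<omega>\<bar>)" using int1 by simp
        show "\<bar>empirical N (X N t \<omega>) k - rho t k\<bar> \<le> \<bar>?d k \<omega>\<bar> + \<bar>?d (Suc k) \<omega>\<bar>" for \<omega>
          unfolding eq by linarith
      qed
      also have "\<dots> = (\<integral>\<omega>. \<bar>?d k \<omega>\<bar> \<partial>M N) + (\<integral>\<omega>. \<bar>?d (Suc k) \<omega>\<bar> \<partial>M N)" using int1 by simp
      also have "\<dots> \<le> 2 * h + 2 * h" using elim t by (intro add_mono half) auto
      finally show "(\<integral>\<omega>. \<bar>empirical N (X N t \<omega>) k - rho t k\<bar> \<partial>M N) \<le> e" by (simp add: h_def)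
    qed
  qed
qed

text \<open>
  The uniform tail bound of the limit makes the number \<open>J\<close> of coordinates to be controlled independent of \<open>t\<close>.
\<close>

lemma empirical_mean_l1_error_tendsto_0:
  assumes "0 < e"
  shows "\<forall>\<^sub>F N in sequentially. \<forall>t\<in>{0..T}. (\<integral>\<omega>. l1_dist (empirical N (X N t \<omega>)) (rho t) \<partial>M N) \<le> e"
proof -
  have "0 < e / 4" using assms by simp
  from mean_field_uniform_tail[OF mf lam nu this]
  obtain J where J: "\<And>t. t \<in> {0..T} \<Longrightarrow> tail (rho t) J \<le> e / 4" by blast
  define h where "h = e / (4 * real (Suc J))"
  have h: "0 < h" using assms by (simp add: h_def)
  have "\<forall>\<^sub>F N in sequentially. \<forall>j\<in>{..<J}. \<forall>t\<in>{0..T}. (\<integral>\<omega>. \<bar>empirical N (X N t \<omega>) j - rho t j\<bar> \<partial>M N) \<le> h"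
    by (intro eventually_ball_finite ballI empirical_mean_error_tendsto_0[OF h]) auto
  moreover have "\<forall>\<^sub>F N in sequentially. N \<ge> (2 :: nat)" by (rule eventually_ge_at_top)
  ultimately show ?thesis
  proof eventually_elim
    case (elim N)
    then have N: "N \<ge> 2" "N > 0" by auto
    interpret prob_space "M N" by (rule process_prob_space[OF N(1)])
    show ?case
    proof
      fix t assume t: "t \<in> {0..T}"
      then have t': "0 \<le> t" "t \<le> T" by auto
      note P = mean_field_prob_seqs[OF mf t'] and E = empirical_prob_seqs[OF N(2)]
      have int: "integrable (M N) (\<lambda>\<omega>. \<bar>empirical N (X N t \<omega>) j - rho t j\<bar>)" for j
      proof (intro process_integrable[OF N(1) t', where B=2])
        fix x show "\<bar>\<bar>empirical N x j - rho t j\<bar>\<bar> \<le> 2"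
          using l1_le_abs[OF l1_le_l1_dist[OF E P], of x j] l1_dist_le_2[OF E P, of x] by simp
      qed
      have "(\<integral>\<omega>. l1_dist (empirical N (X N t \<omega>)) (rho t) \<partial>M N)
          \<le> (\<integral>\<omega>. 2 * (\<Sum>j<J. \<bar>empirical N (X N t \<omega>) j - rho t j\<bar>) + 2 * tail (rho t) J \<partial>M N)"
      proof (rule integral_mono)
        show "integrable (M N) (\<lambda>\<omega>. l1_dist (empirical N (X N t \<omega>)) (rho t))"
        proof (intro process_integrable[OF N(1) t', where B=2])
          fix x show "\<bar>l1_dist (empirical N x) (rho t)\<bar> \<le> 2"
            using l1_dist_le_2[OF E P, of x] l1_le_nonneg[OF l1_le_l1_dist[OF E P], of x] by simp
        qed
      qed (use int l1_dist_le_head_tail[OF E P] in auto)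
      also have "\<dots> = 2 * (\<Sum>j<J. (\<integral>\<omega>. \<bar>empirical N (X N t \<omega>) j - rho t j\<bar> \<partial>M N)) + 2 * tail (rho t) J"
        using int by (simp add: prob_space)
      also have "\<dots> \<le> 2 * (\<Sum>j<J. h) + 2 * (e / 4)"
        using elim t by (intro add_mono mult_left_mono sum_mono J) auto
      also have "\<dots> \<le> e"
      proof -
        have "real J * h \<le> real (Suc J) * h" using h by simp
        also have "\<dots> = e / 4" by (simp add: h_def del: of_nat_Suc)
        finally show ?thesis by simp
      qed
      finally show "(\<integral>\<omega>. l1_dist (empirical N (X N t \<omega>)) (rho t) \<partial>M N) \<le> e" .
    qed
  qed
qed

end

section \<open>The estimator near the true parameter\<close>

text \<open>
  Cramer's rule for \<open>a x + b y = p\<close>, \<open>b x + c y = q\<close>, the normal equations of a regression on two regressors.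
\<close>

definition ls_solution :: "real \<Rightarrow> real \<Rightarrow> real \<Rightarrow> real \<Rightarrow> real \<Rightarrow> real \<times> real" where
  "ls_solution a b c p q = ((c * p - b * q) / (a * c - b\<^sup>2), (- b * p + a * q) / (a * c - b\<^sup>2))"

lemma alse_eq_ls_solution:
  "alse idle T m r = ls_solution (\<Sum>j. U_bar T m r j * U_bar T m r j) (\<Sum>j. U_bar T m r j * V_bar idle T m r j)
     (\<Sum>j. V_bar idle T m r j * V_bar idle T m r j)
     (\<Sum>j. (r T j - r 0 j) * U_bar T m r j) (\<Sum>j. (r T j - r 0 j) * V_bar idle T m r j)"
  by (simp add: alse_def ls_solution_def Let_def power2_eq_square)

lemma ls_solution_normal_equations:
  assumes "a * c - b\<^sup>2 \<noteq> 0"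
  shows "ls_solution a b c (x * a + y * b) (x * b + y * c) = (x, y)"
proof -
  have "c * (x * a + y * b) - b * (x * b + y * c) = x * (a * c - b\<^sup>2)"
    "- b * (x * a + y * b) + a * (x * b + y * c) = y * (a * c - b\<^sup>2)"
    by (simp_all add: algebra_simps power2_eq_square)
  then show ?thesis using assms by (simp add: ls_solution_def)
qed

text \<open>
  Rational functions are continuous where the denominator does not vanish. The radius is divided by 5 because the
  distance in the fivefold product is at most the sum of the five coordinate distances.
\<close>

lemma ls_solution_continuous:
  assumes det: "A * C - B\<^sup>2 \<noteq> 0" and "0 < \<epsilon>"
  obtains h where "0 < h"
    "\<And>a b c p q. \<bar>a - A\<bar> < h \<Longrightarrow> \<bar>b - B\<bar> < h \<Longrightarrow> \<bar>c - C\<bar> < h \<Longrightarrow> \<bar>p - P\<bar> < h \<Longrightarrow> \<bar>q - Q\<bar> < h \<Longrightarrow>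
      dist (ls_solution a b c p q) (ls_solution A B C P Q) < \<epsilon>"
proof -
  let ?F = "\<lambda>z :: real \<times> real \<times> real \<times> real \<times> real.
    ls_solution (fst z) (fst (snd z)) (fst (snd (snd z))) (fst (snd (snd (snd z)))) (snd (snd (snd (snd z))))"
  have "isCont ?F (A, B, C, P, Q)"
    unfolding ls_solution_def using det by (intro continuous_intros) auto
  then obtain d where d: "0 < d" and F: "\<And>z. dist z (A, B, C, P, Q) < d \<Longrightarrow> dist (?F z) (?F (A, B, C, P, Q)) < \<epsilon>"
    using \<open>0 < \<epsilon>\<close> unfolding continuous_at_eps_delta by blast
  show thesis
  proof (rule that[of "d / 5"])
    fix a b c p q
    assume *: "\<bar>a - A\<bar> < d / 5" "\<bar>b - B\<bar> < d / 5" "\<bar>c - C\<bar> < d / 5" "\<bar>p - P\<bar> < d / 5" "\<bar>q - Q\<bar> < d / 5"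
    have pair: "dist (u, v) (u', v') \<le> \<bar>u - u'\<bar> + dist v v'" for u u' :: real and v v' :: "'a :: metric_space"
      using sqrt_sum_squares_le_sum[of "dist u u'" "dist v v'"] by (simp add: dist_Pair_Pair dist_real_def)
    have "dist (a, b, c, p, q) (A, B, C, P, Q) \<le> \<bar>a - A\<bar> + (\<bar>b - B\<bar> + (\<bar>c - C\<bar> + (\<bar>p - P\<bar> + \<bar>q - Q\<bar>)))"
      by (rule order_trans[OF pair add_left_mono])+ (simp add: dist_real_def)
    also have "\<dots> < d" using * by simp
    finally show "dist (ls_solution a b c p q) (ls_solution A B C P Q) < \<epsilon>" using F[of "(a, b, c, p, q)"] by simp
  qed (use d in simp)
qed

lemma sample_time_range:
  assumes "0 \<le> T" "k \<le> m"
  shows "0 \<le> real k * T / real m" "real k * T / real m \<le> T"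
proof -
  have "real k * T \<le> real m * T" using assms by (intro mult_right_mono) auto
  then show "real k * T / real m \<le> T" using assms by (cases "m = 0") (auto simp: divide_le_eq mult.commute)
qed (use assms in simp)

lemma l1_le_time_average:
  assumes "0 \<le> T" and "\<And>k. k \<in> {1..m} \<Longrightarrow> l1_le (z k) (c k)"
  shows "l1_le (\<lambda>j. T / real m * (\<Sum>k=1..m. z k j)) (T / real m * (\<Sum>k=1..m. c k))"
proof -
  have "l1_le (\<lambda>j. \<Sum>k=1..m. z k j) (\<Sum>k=1..m. c k)" by (rule l1_le_sum) (rule assms(2))
  from l1_le_cmult[OF this, of "T / real m"] show ?thesis using assms(1) by simp
qed

lemma l1_le_time_average_const:
  assumes "0 \<le> T" "0 \<le> c" and "\<And>k. k \<in> {1..m} \<Longrightarrow> l1_le (z k) c"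
  shows "l1_le (\<lambda>j. T / real m * (\<Sum>k=1..m. z k j)) (T * c)"
proof (rule l1_le_mono[OF l1_le_time_average[OF assms(1)]])
  show "l1_le (z k) c" if "k \<in> {1..m}" for k by (rule assms(3)[OF that])
  show "T / real m * (\<Sum>k=1..m. c) \<le> T * c" using assms(1,2) by (cases "m = 0") auto
qed

definition sampling_error :: "real \<Rightarrow> nat \<Rightarrow> (real \<Rightarrow> nat \<Rightarrow> real) \<Rightarrow> (real \<Rightarrow> nat \<Rightarrow> real) \<Rightarrow> real" where
  "sampling_error T m r rho =
     T / real m * (\<Sum>k=1..m. l1_dist (r (real k * T / real m)) (rho (real k * T / real m)))
     + l1_dist (r T) (rho T) + l1_dist (r 0) (rho 0)"

text \<open>
  The integrated limit equation: the increment of the limit is the regression with the true coefficients, without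
  error.
\<close>

lemma mean_field_increment:
  assumes mf: "mean_field_solution idle T lam nu rho0 rho" and T: "0 \<le> T"
    and "(\<lambda>s. U (rho s) j) integrable_on {0..T}" "(\<lambda>s. V idle (rho s) j) integrable_on {0..T}"
  shows "rho T j - rho 0 j = lam * integral {0..T} (\<lambda>s. U (rho s) j) + nu * integral {0..T} (\<lambda>s. V idle (rho s) j)"
proof -
  have "((\<lambda>s. lam * U (rho s) j + nu * V idle (rho s) j) has_integral (rho T j - rho 0 j)) {0..T}"
    using T by (intro fundamental_theorem_of_calculus)
      (auto simp: has_real_derivative_iff_has_vector_derivative[symmetric] intro!: mean_field_derivative[OF mf])
  then have "rho T j - rho 0 j = integral {0..T} (\<lambda>s. lam * U (rho s) j + nu * V idle (rho s) j)"
    by (simp add: integral_unique)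
  also have "\<dots> = lam * integral {0..T} (\<lambda>s. U (rho s) j) + nu * integral {0..T} (\<lambda>s. V idle (rho s) j)"
    using assms(3,4) by (subst Henstock_Kurzweil_Integration.integral_add) (auto intro: integrable_on_mult_right)
  finally show ?thesis .
qed

text \<open>
  A deterministic statement about an arbitrary path \<open>r\<close> that is close to the limit at the sampling times. The
  regressors and the response of \<open>r\<close> differ from \<open>u\<close>, \<open>v\<close>, \<open>w\<close> by at most 8 times the sampling error, by the Lipschitz
  bound on the drift, plus the error of the Riemann sums. So the inner products are close to those of
  the limit, whose normal equations are solved by the true parameter.
\<close>

lemma alse_near_true_parameter:
  assumes mf: "mean_field_solution idle T lam nu rho0 rho" and T: "0 < T" and lam: "0 \<le> lam" and nu: "0 \<le> nu"
    and det: "a11 T rho * a22 idle T rho > (a12 idle T rho)\<^sup>2" and "0 < \<epsilon>"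
  obtains \<delta> where "0 < \<delta>"
    "\<forall>\<^sub>F m in sequentially. m > 0 \<and> (\<forall>r. (\<forall>t\<in>{0..T}. r t \<in> prob_seqs) \<longrightarrow> sampling_error T m r rho < \<delta> \<longrightarrow>
        dist (alse idle T m r) (lam, nu) < \<epsilon>)"
proof -
  define L where "L = 4 * lam + 2 * nu"
  \<comment> \<open>\<open>B\<close> bounds all six sequences in the summable norm: \<open>4 T\<close> for the sampled averages, the Riemann error with \<open>m = 1\<close>
    in addition for \<open>u\<close> and \<open>v\<close>, and 2 for the increments.\<close>
  define B where "B = 4 * T + 8 * L * T\<^sup>2 + 2"
  define u where "u = (\<lambda>j. integral {0..T} (\<lambda>s. U (rho s) j))"
  define v where "v = (\<lambda>j. integral {0..T} (\<lambda>s. V idle (rho s) j))"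
  define w where "w = (\<lambda>j. rho T j - rho 0 j)"
  have T0: "0 \<le> T" and L: "0 \<le> L" using T lam nu by (auto simp: L_def)
  have B: "2 \<le> B" "4 * T \<le> B" "8 * L * T\<^sup>2 \<le> B" using T L by (auto simp: B_def)
  note P = mean_field_prob_seqs[OF mf]
  have lipU: "l1_le (\<lambda>j. U (rho s) j - U (rho t) j) ((8 * L) * \<bar>s - t\<bar>)"
    if st: "0 \<le> s" "s \<le> T" "0 \<le> t" "t \<le> T" for s t
    using l1_le_U_diff[OF P[OF st(1,2)] P[OF st(3,4)] mean_field_lipschitz[OF mf lam nu st]]
    unfolding L_def mult.assoc .
  have lipV: "l1_le (\<lambda>j. V idle (rho s) j - V idle (rho t) j) ((8 * L) * \<bar>s - t\<bar>)"
    if st: "0 \<le> s" "s \<le> T" "0 \<le> t" "t \<le> T" for s t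
  proof (rule l1_le_mono[OF l1_le_V_diff[OF mean_field_lipschitz[OF mf lam nu st]]])
    show "2 * ((4 * lam + 2 * nu) * \<bar>s - t\<bar>) \<le> 8 * L * \<bar>s - t\<bar>"
      using mult_nonneg_nonneg[OF L abs_ge_zero[of "s - t"]] by (simp add: L_def[symmetric])
  qed
  have L8: "0 \<le> 8 * L" using L by simp
  have riemU: "l1_le (\<lambda>j. U_bar T m rho j - u j) (8 * L * T\<^sup>2 / real m)" if "m > 0" for m
    unfolding U_bar_def u_def by (rule l1_riemann_sum_error[OF T0 that L8 lipU])
  have riemV: "l1_le (\<lambda>j. V_bar idle T m rho j - v j) (8 * L * T\<^sup>2 / real m)" if "m > 0" for m
    unfolding V_bar_def v_def by (rule l1_riemann_sum_error[OF T0 that L8 lipV])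
  have barU: "l1_le (U_bar T m r) (4 * T)" if r: "\<forall>t\<in>{0..T}. r t \<in> prob_seqs" for m r
  proof -
    have "l1_le (\<lambda>j. T / real m * (\<Sum>k=1..m. U (r (real k * T / real m)) j)) (T * 4)"
      by (rule l1_le_time_average_const[OF T0]) (use r sample_time_range[OF T0, of _ m] in \<open>auto intro!: l1_le_U\<close>)
    then show ?thesis unfolding U_bar_def[abs_def] mult.commute[of 4] .
  qed
  have barV: "l1_le (V_bar idle T m r) (4 * T)" if r: "\<forall>t\<in>{0..T}. r t \<in> prob_seqs" for m r
  proof -
    have "l1_le (\<lambda>j. T / real m * (\<Sum>k=1..m. V idle (r (real k * T / real m)) j)) (T * 2)"
      by (rule l1_le_time_average_const[OF T0]) (use r sample_time_range[OF T0, of _ m] in \<open>auto intro!: l1_le_V\<close>)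
    then have "l1_le (V_bar idle T m r) (T * 2)" unfolding V_bar_def[abs_def] .
    then show ?thesis by (rule l1_le_mono) (use T in simp)
  qed
  have Prho: "\<forall>t\<in>{0..T}. rho t \<in> prob_seqs" using P by simp
  have uB: "l1_le u B"
  proof -
    have "l1_le u (4 * T + 8 * L * T\<^sup>2)" using l1_le_diff[OF barU[OF Prho, of 1] riemU[of 1]] by simp
    then show ?thesis by (rule l1_le_mono) (simp add: B_def)
  qed
  have vB: "l1_le v B"
  proof -
    have "l1_le v (4 * T + 8 * L * T\<^sup>2)" using l1_le_diff[OF barV[OF Prho, of 1] riemV[of 1]] by simp
    then show ?thesis by (rule l1_le_mono) (simp add: B_def)
  qed
  have incB: "l1_le (\<lambda>j. r T j - r 0 j) B" if r: "\<forall>t\<in>{0..T}. r t \<in> prob_seqs" for r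
    by (rule l1_le_mono[OF l1_le_diff[OF prob_seqs_l1_le prob_seqs_l1_le]]) (use r T B in auto)
  have wB: "l1_le w B" unfolding w_def by (rule incB[OF Prho])
  define A11 A12 A22 where "A11 = (\<Sum>j. u j * u j)" and "A12 = (\<Sum>j. u j * v j)" and "A22 = (\<Sum>j. v j * v j)"
  have A: "a11 T rho = A11" "a12 idle T rho = A12" "a22 idle T rho = A22"
    by (simp_all add: a11_def a12_def a22_def A11_def A12_def A22_def u_def v_def power2_eq_square)
  have w: "w j = lam * u j + nu * v j" for j
    unfolding w_def u_def v_def
    by (rule mean_field_increment[OF mf T0 l1_lipschitz_integrable[OF L8 lipU] l1_lipschitz_integrable[OF L8 lipV]])
  note sm = l1_le_summable_mult[OF uB uB] l1_le_summable_mult[OF uB vB] l1_le_summable_mult[OF vB vB]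
  have wu: "(\<Sum>j. w j * u j) = lam * A11 + nu * A12"
  proof -
    have "(\<Sum>j. w j * u j) = (\<Sum>j. lam * (u j * u j) + nu * (u j * v j))"
      by (simp add: w algebra_simps)
    also have "\<dots> = lam * A11 + nu * A12"
      unfolding A11_def A12_def using sm by (subst suminf_add[symmetric]) (auto simp: suminf_mult summable_mult)
    finally show ?thesis .
  qed
  have wv: "(\<Sum>j. w j * v j) = lam * A12 + nu * A22"
  proof -
    have "(\<Sum>j. w j * v j) = (\<Sum>j. lam * (u j * v j) + nu * (v j * v j))"
      by (simp add: w algebra_simps)
    also have "\<dots> = lam * A12 + nu * A22"
      unfolding A12_def A22_def using sm by (subst suminf_add[symmetric]) (auto simp: suminf_mult summable_mult)
    finally show ?thesis .
  qed
  have det': "A11 * A22 - A12\<^sup>2 \<noteq> 0" using det by (simp add: A)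
  obtain h where h: "0 < h"
    and near: "\<And>a b c p q. \<bar>a - A11\<bar> < h \<Longrightarrow> \<bar>b - A12\<bar> < h \<Longrightarrow> \<bar>c - A22\<bar> < h \<Longrightarrow>
      \<bar>p - (lam * A11 + nu * A12)\<bar> < h \<Longrightarrow> \<bar>q - (lam * A12 + nu * A22)\<bar> < h \<Longrightarrow>
      dist (ls_solution a b c p q) (ls_solution A11 A12 A22 (lam * A11 + nu * A12) (lam * A12 + nu * A22)) < \<epsilon>"
    using ls_solution_continuous[OF det' \<open>0 < \<epsilon>\<close>] by metis
  show thesis
  \<comment> \<open>The inner products move by at most \<open>2 B\<close> times the error of the sequences; the two parts of this error are
    given \<open>h / 2\<close> each.\<close>
  proof (rule that[of "h / (32 * B)"])
    show "0 < h / (32 * B)" using h B by simp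
    have "(\<lambda>m. 2 * B * (8 * L * T\<^sup>2 / real m)) \<longlonglongrightarrow> 2 * B * 0"
      by (intro tendsto_mult[OF tendsto_const] real_tendsto_divide_at_top[OF tendsto_const filterlim_real_sequentially])
    then have "\<forall>\<^sub>F m in sequentially. 2 * B * (8 * L * T\<^sup>2 / real m) < h / 2"
      by (rule order_tendstoD) (use h in simp)
    moreover have "\<forall>\<^sub>F m in sequentially. m > (0 :: nat)" by (rule eventually_gt_at_top)
    ultimately show "\<forall>\<^sub>F m in sequentially. m > 0 \<and> (\<forall>r. (\<forall>t\<in>{0..T}. r t \<in> prob_seqs) \<longrightarrow>
        sampling_error T m r rho < h / (32 * B) \<longrightarrow> dist (alse idle T m r) (lam, nu) < \<epsilon>)"
    proof eventually_elim
      case (elim m)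
      have "dist (alse idle T m r) (lam, nu) < \<epsilon>"
        if r: "\<forall>t\<in>{0..T}. r t \<in> prob_seqs" and small: "sampling_error T m r rho < h / (32 * B)" for r
      proof -
        let ?t = "\<lambda>k. real k * T / real m"
        let ?Z = "T / real m * (\<Sum>k=1..m. l1_dist (r (?t k)) (rho (?t k)))"
        let ?S = "sampling_error T m r rho"
        define e where "e = 8 * ?S + 8 * L * T\<^sup>2 / real m"
        have dist: "l1_le (\<lambda>j. r s j - rho s j) (l1_dist (r s) (rho s))" if "s \<in> {0..T}" for s
          using r P that by (intro l1_le_l1_dist) auto
        have tk: "?t k \<in> {0..T}" if "k \<in> {1..m}" for k using sample_time_range[OF T0, of k m] that by auto
        have ends: "0 \<le> l1_dist (r T) (rho T)" "0 \<le> l1_dist (r 0) (rho 0)"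
          using l1_le_nonneg[OF dist[of T]] l1_le_nonneg[OF dist[of 0]] T by auto
        have Z: "0 \<le> ?Z" using l1_le_nonneg[OF dist[OF tk]] T by (intro mult_nonneg_nonneg sum_nonneg) auto
        have dU: "l1_le (\<lambda>j. U_bar T m r j - u j) e"
        proof -
          have "l1_le (\<lambda>j. T / real m * (\<Sum>k=1..m. U (r (?t k)) j - U (rho (?t k)) j))
              (T / real m * (\<Sum>k=1..m. 8 * l1_dist (r (?t k)) (rho (?t k))))"
            by (rule l1_le_time_average[OF T0], rule l1_le_U_diff) (use r P tk dist in auto)
          from l1_le_add[OF this riemU[OF elim(2)]]
          have "l1_le (\<lambda>j. U_bar T m r j - u j) (8 * ?Z + 8 * L * T\<^sup>2 / real m)"
            by (simp add: U_bar_def sum_subtractf sum_distrib_left[symmetric] right_diff_distrib mult_ac)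
          then show ?thesis by (rule l1_le_mono) (use ends in \<open>simp add: e_def sampling_error_def\<close>)
        qed
        have dV: "l1_le (\<lambda>j. V_bar idle T m r j - v j) e"
        proof -
          have "l1_le (\<lambda>j. T / real m * (\<Sum>k=1..m. V idle (r (?t k)) j - V idle (rho (?t k)) j))
              (T / real m * (\<Sum>k=1..m. 2 * l1_dist (r (?t k)) (rho (?t k))))"
            by (rule l1_le_time_average[OF T0], rule l1_le_V_diff) (use tk dist in auto)
          from l1_le_add[OF this riemV[OF elim(2)]]
          have "l1_le (\<lambda>j. V_bar idle T m r j - v j) (2 * ?Z + 8 * L * T\<^sup>2 / real m)"
            by (simp add: V_bar_def sum_subtractf sum_distrib_left[symmetric] right_diff_distrib mult_ac)
          then show ?thesis
            by (rule l1_le_mono) (use ends Z in \<open>simp add: e_def sampling_error_def\<close>)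
        qed
        have dW: "l1_le (\<lambda>j. (r T j - r 0 j) - w j) e"
        proof -
          have "l1_le (\<lambda>j. (r T j - rho T j) - (r 0 j - rho 0 j)) (l1_dist (r T) (rho T) + l1_dist (r 0) (rho 0))"
            using T by (intro l1_le_diff dist) auto
          then have "l1_le (\<lambda>j. (r T j - r 0 j) - w j) (l1_dist (r T) (rho T) + l1_dist (r 0) (rho 0))"
            by (simp add: w_def algebra_simps)
          moreover have "0 \<le> 8 * L * T\<^sup>2 / real m" using L by simp
          ultimately show ?thesis
            by (rule_tac l1_le_mono) (use ends Z in \<open>auto simp: e_def sampling_error_def\<close>)
        qed
        have "2 * B * e = 16 * B * ?S + 2 * B * (8 * L * T\<^sup>2 / real m)" by (simp add: e_def algebra_simps)
        also have "16 * B * ?S < h / 2" using small B by (simp add: field_simps)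
        finally have Be: "2 * B * e < h" using elim(1) by linarith
        have bU: "l1_le (U_bar T m r) B" and bV: "l1_le (V_bar idle T m r) B"
          using barU[OF r] barV[OF r] B l1_le_mono by blast+
        note bW = incB[OF r]
        have "dist (alse idle T m r) (ls_solution A11 A12 A22 (lam * A11 + nu * A12) (lam * A12 + nu * A22)) < \<epsilon>"
          unfolding alse_eq_ls_solution
        proof (rule near)
          show "\<bar>(\<Sum>j. U_bar T m r j * U_bar T m r j) - A11\<bar> < h"
            using l1_le_inner_diff[OF bU bU uB uB dU dU] Be unfolding A11_def by linarith
          show "\<bar>(\<Sum>j. U_bar T m r j * V_bar idle T m r j) - A12\<bar> < h"
            using l1_le_inner_diff[OF bU bV uB vB dU dV] Be unfolding A12_def by linarith
          show "\<bar>(\<Sum>j. V_bar idle T m r j * V_bar idle T m r j) - A22\<bar> < h"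
            using l1_le_inner_diff[OF bV bV vB vB dV dV] Be unfolding A22_def by linarith
          show "\<bar>(\<Sum>j. (r T j - r 0 j) * U_bar T m r j) - (lam * A11 + nu * A12)\<bar> < h"
            using l1_le_inner_diff[OF bW bU wB uB dW dU] Be unfolding wu[symmetric] by linarith
          show "\<bar>(\<Sum>j. (r T j - r 0 j) * V_bar idle T m r j) - (lam * A12 + nu * A22)\<bar> < h"
            using l1_le_inner_diff[OF bW bV wB vB dW dV] Be unfolding wv[symmetric] by linarith
        qed
        then show ?thesis by (simp add: ls_solution_normal_equations[OF det'])
      qed
      then show ?case using elim(2) by blast
    qed
  qed
qed

section \<open>Consistency\<close>

text \<open>
  Markov's inequality. Bounding the mean at each single time is enough because the sampling error is an
  average over the sampling times, with total weight \<open>T\<close>, plus the two end points.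
\<close>

lemma sampling_error_probability_le:
  fixes M :: "'w measure" and R :: "real \<Rightarrow> 'w \<Rightarrow> nat \<Rightarrow> real"
  assumes T: "0 < T" and \<delta>: "0 < \<delta>" and m: "0 < m"
    and R: "\<And>t \<omega>. t \<in> {0..T} \<Longrightarrow> R t \<omega> \<in> prob_seqs" and P: "\<And>t. t \<in> {0..T} \<Longrightarrow> rho t \<in> prob_seqs"
    and int: "\<And>t. t \<in> {0..T} \<Longrightarrow> integrable M (\<lambda>\<omega>. l1_dist (R t \<omega>) (rho t))"
    and mean: "\<And>t. t \<in> {0..T} \<Longrightarrow> (\<integral>\<omega>. l1_dist (R t \<omega>) (rho t) \<partial>M) \<le> c"
  shows "{\<omega>\<in>space M. \<delta> \<le> sampling_error T m (\<lambda>t. R t \<omega>) rho} \<in> sets M" (is ?meas)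
    and "measure M {\<omega>\<in>space M. \<delta> \<le> sampling_error T m (\<lambda>t. R t \<omega>) rho} \<le> (T + 2) * c / \<delta>" (is ?bound)
proof -
  have tk: "real k * T / real m \<in> {0..T}" if "k \<in> {1..m}" for k
    using sample_time_range[of T k m] T that by auto
  have ends: "0 \<in> {0..T}" "T \<in> {0..T}" using T by auto
  have intZ: "integrable M (\<lambda>\<omega>. sampling_error T m (\<lambda>t. R t \<omega>) rho)"
    unfolding sampling_error_def
    by (intro Bochner_Integration.integrable_add integrable_mult_right Bochner_Integration.integrable_sum int tk ends)
  then have [measurable]: "(\<lambda>\<omega>. sampling_error T m (\<lambda>t. R t \<omega>) rho) \<in> borel_measurable M"
    by (rule borel_measurable_integrable)
  show ?meas by measurable
  have nonneg: "0 \<le> l1_dist (R t \<omega>) (rho t)" if "t \<in> {0..T}" for t \<omega>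
    using l1_le_nonneg[OF l1_le_l1_dist[OF R[OF that] P[OF that]]] .
  have "(\<integral>\<omega>. sampling_error T m (\<lambda>t. R t \<omega>) rho \<partial>M) =
      T / real m * (\<Sum>k=1..m. \<integral>\<omega>. l1_dist (R (real k * T / real m) \<omega>) (rho (real k * T / real m)) \<partial>M)
      + (\<integral>\<omega>. l1_dist (R T \<omega>) (rho T) \<partial>M) + (\<integral>\<omega>. l1_dist (R 0 \<omega>) (rho 0) \<partial>M)"
  proof -
    have "integrable M (\<lambda>\<omega>. T / real m * (\<Sum>k=1..m. l1_dist (R (real k * T / real m) \<omega>) (rho (real k * T / real m))))"
      by (intro integrable_mult_right Bochner_Integration.integrable_sum int tk)
    moreover have "(\<integral>\<omega>. (\<Sum>k=1..m. l1_dist (R (real k * T / real m) \<omega>) (rho (real k * T / real m))) \<partial>M) =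
        (\<Sum>k=1..m. \<integral>\<omega>. l1_dist (R (real k * T / real m) \<omega>) (rho (real k * T / real m)) \<partial>M)"
      by (intro Bochner_Integration.integral_sum int tk)
    ultimately show ?thesis
      unfolding sampling_error_def using int[OF ends(1)] int[OF ends(2)]
      by (simp only: Bochner_Integration.integral_add Bochner_Integration.integrable_add integral_mult_right_zero)
  qed
  also have "\<dots> \<le> T / real m * (\<Sum>k=1..m. c) + c + c"
    using T by (intro add_mono mult_left_mono sum_mono mean tk ends) auto
  also have "\<dots> = (T + 2) * c" using m by (simp add: algebra_simps)
  finally have E: "(\<integral>\<omega>. sampling_error T m (\<lambda>t. R t \<omega>) rho \<partial>M) \<le> (T + 2) * c" .
  have "measure M {\<omega>\<in>space M. \<delta> \<le> sampling_error T m (\<lambda>t. R t \<omega>) rho}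
      \<le> (\<integral>\<omega>. sampling_error T m (\<lambda>t. R t \<omega>) rho \<partial>M) / \<delta>"
  proof (rule integral_Markov_inequality_measure[OF intZ sets.empty_sets _ \<delta>])
    show "AE \<omega> in M. 0 \<le> sampling_error T m (\<lambda>t. R t \<omega>) rho"
      unfolding sampling_error_def using T
      by (intro AE_I2 add_nonneg_nonneg mult_nonneg_nonneg sum_nonneg nonneg tk ends) auto
  qed
  also have "\<dots> \<le> (T + 2) * c / \<delta>" using E \<delta> by (intro divide_right_mono) auto
  finally show ?bound .
qed

theorem theorem3p1:
  fixes T lam nu :: real
    and idle :: bool
    and M :: "nat \<Rightarrow> 'w measure"
    and X :: "nat \<Rightarrow> real \<Rightarrow> 'w \<Rightarrow> nat \<Rightarrow> nat"
    and rho0 :: "nat \<Rightarrow> real"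
    and rho :: "real \<Rightarrow> nat \<Rightarrow> real"
  assumes "0 < T" and "0 \<le> lam" and "0 \<le> nu"
    and "\<And>N. N \<ge> 2 \<Longrightarrow> two_choices_process (M N) T N lam nu (X N)"
    and "mean_field_solution idle T lam nu rho0 rho"
    and "\<And>\<epsilon>. \<epsilon> > 0 \<Longrightarrow>
      (\<lambda>N. measure (M N) {\<omega>\<in>space (M N). l1_dist (empirical N (X N 0 \<omega>)) rho0 > \<epsilon>}) \<longlonglongrightarrow> 0"
    and "a11 T rho * a22 idle T rho > (a12 idle T rho)\<^sup>2"
  shows "\<forall>\<epsilon>>0. ((\<lambda>(N, m). measure (M N)
      {\<omega>\<in>space (M N). dist (alse idle T m (\<lambda>t. empirical N (X N t \<omega>))) (lam, nu) > \<epsilon>})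
      \<longlongrightarrow> 0) (sequentially \<times>\<^sub>F sequentially)"
proof (intro allI impI tendstoI)
  note T = assms(1) and lam = assms(2) and nu = assms(3) and proc = assms(4) and mf = assms(5)
    and init = assms(6) and det = assms(7)
  fix \<epsilon> \<eta> :: real assume "0 < \<epsilon>" "0 < \<eta>"
  have mf': "mean_field_solution True T lam nu rho0 rho"
  proof (cases idle)
    case True
    then show ?thesis using mf by simp
  next
    case False
    then have "nu = 0"
      using no_mean_field_solution_serving_empty_queues[of T lam nu rho0 rho] mf lam nu T by fastforce
    then show ?thesis using mf by (simp add: mean_field_solution_def)
  qed
  obtain \<delta> where \<delta>: "0 < \<delta>" and close: "\<forall>\<^sub>F m in sequentially. m > 0 \<and> (\<forall>r. (\<forall>t\<in>{0..T}. r t \<in> prob_seqs) \<longrightarrow>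
      sampling_error T m r rho < \<delta> \<longrightarrow> dist (alse idle T m r) (lam, nu) < \<epsilon>)"
    by (rule alse_near_true_parameter[OF mf T lam nu det \<open>0 < \<epsilon>\<close>])
  \<comment> \<open>With this bound on the mean error, Markov's inequality gives the probability \<open>\<eta> / 2\<close>.\<close>
  define c where "c = \<delta> * \<eta> / (2 * (T + 2))"
  have c: "0 < c" using \<delta> \<open>0 < \<eta>\<close> T by (simp add: c_def)
  have "\<forall>\<^sub>F N in sequentially. \<forall>t\<in>{0..T}. (\<integral>\<omega>. l1_dist (empirical N (X N t \<omega>)) (rho t) \<partial>M N) \<le> c"
    by (rule empirical_mean_l1_error_tendsto_0[OF T lam nu proc mf' init c])
  moreover have "\<forall>\<^sub>F N in sequentially. N \<ge> (2 :: nat)" by (rule eventually_ge_at_top)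
  ultimately have mean: "\<forall>\<^sub>F N in sequentially. N \<ge> 2 \<and>
      (\<forall>t\<in>{0..T}. (\<integral>\<omega>. l1_dist (empirical N (X N t \<omega>)) (rho t) \<partial>M N) \<le> c)"
    by eventually_elim simp
  have "\<forall>\<^sub>F (N, m) in sequentially \<times>\<^sub>F sequentially. measure (M N)
      {\<omega>\<in>space (M N). dist (alse idle T m (\<lambda>t. empirical N (X N t \<omega>))) (lam, nu) > \<epsilon>} < \<eta>"
  proof (rule eventually_mono[OF eventually_prodI[OF mean close]])
    fix z :: "nat \<times> nat"
    obtain N m where z: "z = (N, m)" by (cases z)
    assume "(2 \<le> fst z \<and> (\<forall>t\<in>{0..T}. (\<integral>\<omega>. l1_dist (empirical (fst z) (X (fst z) t \<omega>)) (rho t) \<partial>M (fst z)) \<le> c)) \<and>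
      0 < snd z \<and> (\<forall>r. (\<forall>t\<in>{0..T}. r t \<in> prob_seqs) \<longrightarrow>
      sampling_error T (snd z) r rho < \<delta> \<longrightarrow> dist (alse idle T (snd z) r) (lam, nu) < \<epsilon>)"
    then have N: "2 \<le> N" "0 < N" and EN: "\<And>t. t \<in> {0..T} \<Longrightarrow> (\<integral>\<omega>. l1_dist (empirical N (X N t \<omega>)) (rho t) \<partial>M N) \<le> c"
      and m: "0 < m" and near: "\<And>r. (\<And>t. t \<in> {0..T} \<Longrightarrow> r t \<in> prob_seqs) \<Longrightarrow>
        sampling_error T m r rho < \<delta> \<Longrightarrow> dist (alse idle T m r) (lam, nu) < \<epsilon>"
      by (auto simp: z)
    interpret prob_space "M N" by (rule process_prob_space[OF T lam nu proc mf' init N(1)])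
    note E = empirical_prob_seqs[OF N(2)]
    have P: "rho t \<in> prob_seqs" if "t \<in> {0..T}" for t using mean_field_prob_seqs[OF mf] that by simp
    have int: "integrable (M N) (\<lambda>\<omega>. l1_dist (empirical N (X N t \<omega>)) (rho t))" if t: "t \<in> {0..T}" for t
    proof (rule process_integrable[OF T lam nu proc mf' init N(1)])
      show "\<bar>l1_dist (empirical N x) (rho t)\<bar> \<le> 2" for x
        using l1_dist_le_2[OF E P[OF t], of x] l1_le_nonneg[OF l1_le_l1_dist[OF E P[OF t]], of x] by simp
    qed (use t in auto)
    note Z = sampling_error_probability_le[where R="\<lambda>t \<omega>. empirical N (X N t \<omega>)", OF T \<delta> m E P int EN]
    have "measure (M N) {\<omega>\<in>space (M N). dist (alse idle T m (\<lambda>t. empirical N (X N t \<omega>))) (lam, nu) > \<epsilon>}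
        \<le> measure (M N) {\<omega>\<in>space (M N). \<delta> \<le> sampling_error T m (\<lambda>t. empirical N (X N t \<omega>)) rho}"
    proof (rule finite_measure_mono[OF _ Z(1)], clarify)
      fix \<omega>
      assume far: "\<epsilon> < dist (alse idle T m (\<lambda>t. empirical N (X N t \<omega>))) (lam, nu)"
      show "\<delta> \<le> sampling_error T m (\<lambda>t. empirical N (X N t \<omega>)) rho"
        using near[of "\<lambda>t. empirical N (X N t \<omega>)", OF E] far by linarith
    qed
    also have "\<dots> \<le> (T + 2) * c / \<delta>" by (rule Z(2))
    also have "\<dots> = \<eta> / 2"
    proof -
      have "T + 2 \<noteq> 0" "\<delta> \<noteq> 0" using T \<delta> by auto
      then show ?thesis by (simp add: c_def divide_simps)
    qed
    also have "\<dots> < \<eta>" using \<open>0 < \<eta>\<close> by simp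
    finally show "case z of (N, m) \<Rightarrow> measure (M N)
      {\<omega>\<in>space (M N). dist (alse idle T m (\<lambda>t. empirical N (X N t \<omega>))) (lam, nu) > \<epsilon>} < \<eta>"
      by (simp add: z)
  qed
  then show "\<forall>\<^sub>F x in sequentially \<times>\<^sub>F sequentially. dist (case x of (N, m) \<Rightarrow> measure (M N)
      {\<omega>\<in>space (M N). dist (alse idle T m (\<lambda>t. empirical N (X N t \<omega>))) (lam, nu) > \<epsilon>}) 0 < \<eta>"
    by (rule eventually_mono) (auto simp: dist_real_def)
qed

end
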